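(* Let $m\ge1$, $\vec{\bm c}_0,\vec{\bm c}_1\in\mathcal{C}^m$, and let $f$ be a spherical polynomial of degree $d$ on $\mathbb{R}^{2m}$. For $\vec{\bm a},\vec{\bm b}\in\mathbb{R}^{2m}$ the series $\theta^{\vec{\bm c}_0,\vec{\bm c}_1}_{\vec{\bm a},\vec{\bm b}}[f](\tau)$ converges absolutely and satisfies \[ \theta^{\vec{\bm c}_0,\vec{\bm c}_1}_{\vec{\bm a},\vec{\bm b}}[f]\Big(-\frac1\tau\Big)=(-\tau)^{m+d}e^{2\pi iB_m(\vec{\bm a},\vec{\bm b})}\,\theta^{\vec{\bm c}_0,\vec{\bm c}_1}_{-\vec{\bm b},\vec{\bm a}}[f](\tau). \]
   Context: Write points of $\mathbb{R}^{2m}$ as $\vec{\bm x}=(\bm x_1,\dots,\bm x_m)$ with $\bm x_j=(x_j,y_j)^T$. $Q_m(\vec{\bm x})=\sum_j x_jy_j$, $B_m(\vec{\bm x},\vec{\bm x}')=\sum_j(x_jy_j'+y_jx_j')$; $Q_1,B_1$ are the case $m=1$. $\Delta_m=2\sum_j\partial^2/\partial x_j\partial y_j$; a spherical polynomial of degree $d$ is a homogeneous degree-$d$ polynomial annihilated by $\Delta_m$. $\mathcal{C}=\{\bm c=(c_1,c_2)^T\in\mathbb{R}^2: Q_1(\bm c)<0,\ c_2>0\}$. $E(z)=2\int_0^ze^{-\pi u^2}du$, $E^{(k)}$ its $k$-th derivative. For $\bm c\in\mathcal{C}$: $\rho_{\bm c,k}(\bm x)=E^{(k)}(B_1(\bm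 c,\bm x)/\sqrt{-Q_1(\bm c)})$ and $\partial_{\bm c}(\bm x)=\frac{1}{\sqrt{-Q_1(\bm c)}}(c_1\partial_x+c_2\partial_y)$ acting on the coordinates of $\bm x=(x,y)^T$. For $\vec{\bm c}_0=(\bm c^{(0)}_j)_j$, $\vec{\bm c}_1=(\bm c^{(1)}_j)_j$, $p^{\vec{\bm c}_0,\vec{\bm c}_1}[f](\vec{\bm x})=\sum_{\vec\sigma\in\{0,1\}^m}(-1)^{|\vec\sigma|}\sum_{k=0}^d\frac{(-1)^k}{(4\pi)^k}\sum_{\vec k\in\mathbb{Z}^m_{\ge0},|\vec k|=k}\prod_j\frac{\rho_{\bm c_j^{(\sigma_j)},k_j}(\bm x_j)}{k_j!}\big(\prod_j\partial_{\bm c_j^{(\sigma_j)}}(\bm x_j)^{k_j}\big)f(\vec{\bm x})$. For $\tau=u+iv$ in the upper half-plane, $q=e^{2\pi i\tau}$, define $\theta^{\vec{\bm c}_0,\vec{\bm c}_1}_{\vec{\bm a},\vec{\bm b}}[f](\tau)=v^{-d/2}\sum_{\vec{\bm x}\in\vec{\bm a}+\mathbb{Z}^{2m}}p^{\vec{\bm c}_0,\vec{\bm c}_1}[f](\vec{\bm x}\sqrt v)\,q^{Q_m(\vec{\bm x})}e^{2\pi iB_m(\vec{\bm x},\vec{\bm b})}$, where $q^{\alpha}=e^{2\pi i\alpha\tau}$. *)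

theory Defs
  imports "HOL-Analysis.Analysis"
begin

text \<open>
  A point of the real space of dimension \<open>2 m\<close> is an element \<open>x\<close> of type \<open>real^2^'m\<close>, with \<open>m = CARD('m)\<close>;
  its \<open>j\<close>-th block \<open>x $ j\<close> has the coordinates \<open>x $ j $ 1\<close> (the informal \<open>x\<^sub>j\<close>) and
  \<open>x $ j $ 2\<close> (the informal \<open>y\<^sub>j\<close>).
\<close>

definition Q1 :: "real^2 \<Rightarrow> real" where
  "Q1 x = x $ 1 * x $ 2"

definition B1 :: "real^2 \<Rightarrow> real^2 \<Rightarrow> real" where
  "B1 x x' = x $ 1 * x' $ 2 + x $ 2 * x' $ 1"

definition Qm :: "real^2^'m \<Rightarrow> real" where
  "Qm x = (\<Sum>j\<in>UNIV. Q1 (x $ j))"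

definition Bm :: "real^2^'m \<Rightarrow> real^2^'m \<Rightarrow> real" where
  "Bm x x' = (\<Sum>j\<in>UNIV. B1 (x $ j) (x' $ j))"

definition cone_C :: "(real^2) set" where
  "cone_C = {c. Q1 c < 0 \<and> c $ 2 > 0}"

definition homogeneous_polynomial :: "nat \<Rightarrow> (real^2^'m \<Rightarrow> complex) \<Rightarrow> bool" where
  "homogeneous_polynomial d f \<longleftrightarrow>
     (\<exists>coef :: nat^2^'m \<Rightarrow> complex. \<forall>x.
        f x = (\<Sum>\<alpha> | (\<Sum>j\<in>UNIV. \<Sum>i\<in>UNIV. \<alpha> $ j $ i) = d.
                 coef \<alpha> * of_real (\<Prod>j\<in>UNIV. \<Prod>i\<in>UNIV. (x $ j $ i) ^ (\<alpha> $ j $ i))))"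

definition partial :: "'m \<Rightarrow> 2 \<Rightarrow> (real^2^'m \<Rightarrow> complex) \<Rightarrow> real^2^'m \<Rightarrow> complex" where
  "partial j i f x = vector_derivative (\<lambda>t. f (x + t *\<^sub>R axis j (axis i 1))) (at 0)"

definition laplacian :: "(real^2^'m \<Rightarrow> complex) \<Rightarrow> real^2^'m \<Rightarrow> complex" where
  "laplacian f x = 2 * (\<Sum>j\<in>UNIV. partial j 1 (partial j 2 f) x)"

definition spherical_polynomial :: "nat \<Rightarrow> (real^2^'m \<Rightarrow> complex) \<Rightarrow> bool" where
  "spherical_polynomial d f \<longleftrightarrow> homogeneous_polynomial d f \<and> (\<forall>x. laplacian f x = 0)"

text \<open>The interval integral is oriented, so this is the odd function \<open>E\<close> also for \<open>z < 0\<close>.\<close>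

definition E :: "real \<Rightarrow> real" where
  "E z = 2 * (LBINT u=0..z. exp (- pi * u\<^sup>2))"

definition rho :: "real^2 \<Rightarrow> nat \<Rightarrow> real^2 \<Rightarrow> real" where
  "rho c k x = (deriv ^^ k) E (B1 c x / sqrt (- Q1 c))"

definition dir_deriv :: "'m \<Rightarrow> real^2 \<Rightarrow> (real^2^'m \<Rightarrow> complex) \<Rightarrow> real^2^'m \<Rightarrow> complex" where
  "dir_deriv j c f x =
     (1 / sqrt (- Q1 c)) *\<^sub>R (c $ 1 *\<^sub>R partial j 1 f x + c $ 2 *\<^sub>R partial j 2 f x)"

text \<open>
  The product over \<open>j\<close> of the operators \<open>dir_deriv j (c $ j) ^^ (k $ j)\<close> is their composition.
  The operators commute on smooth functions, in particular on the polynomials they are applied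
  to, so the choice of the enumeration of the index type is immaterial.
\<close>

definition index_list :: "'m::finite list" where
  "index_list = (SOME js. distinct js \<and> set js = UNIV)"

definition dir_deriv_prod ::
    "real^2^'m \<Rightarrow> nat^'m \<Rightarrow> (real^2^'m \<Rightarrow> complex) \<Rightarrow> real^2^'m \<Rightarrow> complex" where
  "dir_deriv_prod c k = foldr (\<lambda>j. dir_deriv j (c $ j) ^^ (k $ j)) index_list"

definition select :: "real^2^'m \<Rightarrow> real^2^'m \<Rightarrow> nat^'m \<Rightarrow> real^2^'m" where
  "select c0 c1 \<sigma> = (\<chi> j. if \<sigma> $ j = 0 then c0 $ j else c1 $ j)"

definition p_op :: "nat \<Rightarrow> real^2^'m \<Rightarrow> real^2^'m \<Rightarrow> (real^2^'m \<Rightarrow> complex) \<Rightarrow> real^2^'m \<Rightarrow> complex"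
  where
  "p_op d c0 c1 f x =
     (\<Sum>\<sigma> | \<forall>j. \<sigma> $ j \<in> {0, 1::nat}. (-1) ^ (\<Sum>j\<in>UNIV. \<sigma> $ j) *
       (\<Sum>k = 0..d. of_real ((-1) ^ k / (4 * pi) ^ k) *
         (\<Sum>kv | (\<Sum>j\<in>UNIV. kv $ j) = k.
            of_real (\<Prod>j\<in>UNIV. rho (select c0 c1 \<sigma> $ j) (kv $ j) (x $ j) / fact (kv $ j)) *
            dir_deriv_prod (select c0 c1 \<sigma>) kv f x)))"

definition shifted_lattice :: "real^2^'m \<Rightarrow> (real^2^'m) set" where
  "shifted_lattice a = {a + n | n. \<forall>j i. n $ j $ i \<in> \<int>}"

definition theta_term ::
    "nat \<Rightarrow> real^2^'m \<Rightarrow> real^2^'m \<Rightarrow> real^2^'m \<Rightarrow> (real^2^'m \<Rightarrow> complex) \<Rightarrow> complex \<Rightarrow>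
     real^2^'m \<Rightarrow> complex" where
  "theta_term d c0 c1 b f \<tau> x =
     p_op d c0 c1 f (sqrt (Im \<tau>) *\<^sub>R x) *
     exp (2 * of_real pi * \<i> * of_real (Qm x) * \<tau>) *
     exp (2 * of_real pi * \<i> * of_real (Bm x b))"

definition theta ::
    "nat \<Rightarrow> real^2^'m \<Rightarrow> real^2^'m \<Rightarrow> real^2^'m \<Rightarrow> real^2^'m \<Rightarrow> (real^2^'m \<Rightarrow> complex) \<Rightarrow>
     complex \<Rightarrow> complex" where
  "theta d c0 c1 a b f \<tau> =
     of_real (Im \<tau> powr (- real d / 2)) *
     (\<Sum>\<^sub>\<infinity>x\<in>shifted_lattice a. theta_term d c0 c1 b f \<tau> x)"

text \<open>All finite sums above range over finite sets, so none of them degenerates to 0.\<close>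

lemma finite_vec_sum_eq: "finite {k :: nat^'m. (\<Sum>j\<in>UNIV. k $ j) = n}"
proof (rule finite_subset)
  show "{k :: nat^'m. (\<Sum>j\<in>UNIV. k $ j) = n} \<subseteq> vec_lambda ` (PiE UNIV (\<lambda>_. {..n}))"
  proof
    fix k :: "nat^'m" assume "k \<in> {k. (\<Sum>j\<in>UNIV. k $ j) = n}"
    then have "k $ j \<le> n" for j
      using member_le_sum[of j UNIV "\<lambda>j. k $ j"] by auto
    then have "vec_nth k \<in> PiE UNIV (\<lambda>_. {..n})" by auto
    then show "k \<in> vec_lambda ` (PiE UNIV (\<lambda>_. {..n}))"
      by (rule image_eqI[where f = vec_lambda, rotated]) (simp add: vec_nth_inverse)
  qed
qed (auto intro!: finite_imageI finite_PiE)

lemma finite_vec_01: "finite {\<sigma> :: nat^'m. \<forall>j. \<sigma> $ j \<in> {0, 1}}"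
proof (rule finite_subset)
  show "{\<sigma> :: nat^'m. \<forall>j. \<sigma> $ j \<in> {0, 1}} \<subseteq> vec_lambda ` (PiE UNIV (\<lambda>_. {0, 1}))"
  proof
    fix s :: "nat^'m" assume "s \<in> {\<sigma>. \<forall>j. \<sigma> $ j \<in> {0, 1}}"
    then have "vec_nth s \<in> PiE UNIV (\<lambda>_. {0, 1})" by (simp add: PiE_iff)
    then show "s \<in> vec_lambda ` (PiE UNIV (\<lambda>_. {0, 1}))"
      by (rule image_eqI[where f = vec_lambda, rotated]) (simp add: vec_nth_inverse)
  qed
qed (auto intro!: finite_imageI finite_PiE)

lemma finite_multiindex:
  "finite {\<alpha> :: nat^2^'m. (\<Sum>j\<in>UNIV. \<Sum>i\<in>UNIV. \<alpha> $ j $ i) = d}"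
proof (rule finite_subset)
  let ?S = "{k :: nat^2. \<exists>n\<le>d. (\<Sum>i\<in>UNIV. k $ i) = n}"
  have "?S = (\<Union>n\<le>d. {k :: nat^2. (\<Sum>i\<in>UNIV. k $ i) = n})" by auto
  then have fin: "finite ?S" by (simp only:) (intro finite_UN_I finite_atMost finite_vec_sum_eq)
  then show "finite ((vec_lambda :: ('m \<Rightarrow> nat^2) \<Rightarrow> nat^2^'m) ` (PiE UNIV (\<lambda>_. ?S)))"
    by (intro finite_imageI finite_PiE) auto
  show "{\<alpha> :: nat^2^'m. (\<Sum>j\<in>UNIV. \<Sum>i\<in>UNIV. \<alpha> $ j $ i) = d}
          \<subseteq> vec_lambda ` (PiE UNIV (\<lambda>_. ?S))"
  proof
    fix k :: "nat^2^'m" assume "k \<in> {\<alpha>. (\<Sum>j\<in>UNIV. \<Sum>i\<in>UNIV. \<alpha> $ j $ i) = d}"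
    then have "(\<Sum>i\<in>UNIV. k $ j $ i) \<le> d" for j
      using member_le_sum[of j UNIV "\<lambda>j. \<Sum>i\<in>UNIV. k $ j $ i"] by auto
    then have "vec_nth k \<in> PiE UNIV (\<lambda>_. ?S)" by auto
    then show "k \<in> vec_lambda ` (PiE UNIV (\<lambda>_. ?S))"
      by (rule image_eqI[where f = vec_lambda, rotated]) (simp add: vec_nth_inverse)
  qed
qed

end

theory Submission
  imports Defs "HOL-Probability.Characteristic_Functions"
begin

text \<open>
  In one block the completed sign function is a primitive: on the hyperbola \<open>c = (- 1 / r, r)\<close> the
  difference \<open>E (r\<^sub>0 x - y / r\<^sub>0) - E (r\<^sub>1 x - y / r\<^sub>1)\<close> is the integral over \<open>r\<close> of a Hermite
  polynomial times a Gaussian, so that the indefinite theta series is an integral over a compact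
  path of absolutely convergent positive definite ones. For fixed \<open>r\<close>, Poisson summation in \<open>y\<close>
  alone turns the kernel into \<open>(cnj \<tau> x + \<eta>) ^ n * exp (- pi r\<^sup>2 \<bar>\<tau> x + \<eta>\<bar>\<^sup>2 / Im \<tau>)\<close>, and in this form
  \<open>\<tau> \<mapsto> - 1 / \<tau>\<close> is just the exchange of \<open>x\<close> and \<open>\<eta>\<close>.

  The monomials of the integral representation differ from those of the definition by the heat
  flow of the Laplacian, which acts trivially on a spherical polynomial; this is the only place
  where harmonicity enters, and it allows the blocks to be treated one monomial at a time.
\<close>


section \<open>Poisson summation\<close>

text \<open>In general a single cone vector gives no absolutely convergent series, since its kernel
  does not decay in every direction. The two vectors of a block must therefore be paired before
  anything is summed: \<open>p_op\<close> is factored into one difference per block, and the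
  difference becomes an integral whose integrand decays uniformly along the path. Transforming
  \<open>y\<close> alone keeps the analysis one-dimensional, and the inversion rests on \<open>norm
  (- x / \<tau> + \<eta>) = norm (x - \<tau> \<eta>) / norm \<tau>\<close>. The weight is collected
  as follows. Differentiating \<open>E (r x - y / r)\<close> in \<open>r\<close> adds one Hermite
  degree, so a block with exponents \<alpha> and \<beta> has degree
  \<open>\<alpha> + \<beta> + 1\<close>, and every degree contributes the factor
  \<open>- norm \<tau> / cnj \<tau>\<close>, in total \<open>m + d\<close> times. Poisson summation
  contributes \<open>norm \<tau>\<close> once per block, and the power \<open>- d / 2\<close> of
  \<open>Im \<tau>\<close> contributes it \<open>d\<close> times. Each pair of such factors
  multiplies to \<open>- \<tau>\<close>.\<close>

definition cis2pi :: "real \<Rightarrow> complex" where "cis2pi x = cis (2 * pi * x)"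

lemma cis2pi_0 [simp]: "cis2pi 0 = 1" by (simp add: cis2pi_def)

lemma norm_cis2pi [simp]: "norm (cis2pi x) = 1" by (simp add: cis2pi_def)

lemma cis2pi_nonzero [simp]: "cis2pi x \<noteq> 0" using norm_cis2pi[of x] by (metis norm_zero zero_neq_one)

lemma cis2pi_add: "cis2pi (x + y) = cis2pi x * cis2pi y"
  by (simp add: cis2pi_def cis_mult ring_distribs)

lemma cis2pi_of_int [simp]: "cis2pi (of_int k) = 1"
  by (simp add: cis2pi_def cis_multiple_2pi)

lemma cis2pi_exp: "cis2pi x = exp (2 * of_real pi * \<i> * of_real x)"
  by (simp add: cis2pi_def cis_conv_exp mult_ac)

lemma cis2pi_eq_1_iff: "cis2pi x = 1 \<longleftrightarrow> x \<in> \<int>"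
proof
  assume "cis2pi x = 1"
  then have "cos (2 * pi * x) = 1"
    by (simp add: cis2pi_def complex_eq_iff)
  then obtain n :: int where "2 * pi * x = of_int n * 2 * pi"
    by (auto simp: cos_one_2pi_int)
  then show "x \<in> \<int>" by simp
qed (auto elim!: Ints_cases)

lemma has_vector_derivative_cis2pi [derivative_intros]:
  assumes "(g has_real_derivative g') (at x within A)"
  shows "((\<lambda>x. cis2pi (g x)) has_vector_derivative (2 * of_real pi * \<i> * of_real g' * cis2pi (g x))) (at x within A)"
proof -
  have "(cis2pi has_vector_derivative (2 * of_real pi * \<i> * cis2pi y)) (at y)" for y
  proof -
    have fd: "((\<lambda>x. exp (2 * of_real pi * \<i> * x)) has_field_derivative
            exp (2 * of_real pi * \<i> * of_real y) * (2 * of_real pi * \<i>)) (at (of_real y))"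
      by (auto intro!: derivative_eq_intros)
    have "(((\<lambda>x. exp (2 * of_real pi * \<i> * x)) \<circ> of_real) has_vector_derivative
            1 * (exp (2 * of_real pi * \<i> * of_real y) * (2 * of_real pi * \<i>))) (at y)"
      using fd
      by (intro field_vector_diff_chain_at) (auto intro!: derivative_eq_intros has_vector_derivative_of_real)
    then show ?thesis
      unfolding cis2pi_exp[abs_def] by (simp add: o_def mult_ac)
  qed
  from vector_diff_chain_within[OF _ has_vector_derivative_at_within[OF this], of g g' x A]
  show ?thesis using assms
    by (simp add: has_real_derivative_iff_has_vector_derivative o_def scaleR_conv_of_real mult_ac)
qed

lemma continuous_on_cis2pi [continuous_intros]:
  "continuous_on A g \<Longrightarrow> continuous_on A (\<lambda>x. cis2pi (g x))"
  unfolding cis2pi_def by (intro continuous_intros)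

text \<open>Weierstrass approximation reduces \<open>G\<close> to a polynomial, for which one
  integration by parts gains the factor \<open>1 / k\<close>.\<close>

lemma riemann_lebesgue:
  fixes G :: "real \<Rightarrow> complex"
  assumes cont: "continuous_on {a..b} G" and ab: "a \<le> b" and e: "e > 0"
  shows "\<exists>N::nat. \<forall>k::int. \<bar>k\<bar> \<ge> int N \<longrightarrow>
           norm (integral {a..b} (\<lambda>x. G x * cis2pi (- (of_int k * x)))) < e"
proof -
  define \<epsilon> where "\<epsilon> = e / (2 * (b - a + 1))"
  have \<epsilon>: "\<epsilon> > 0" using ab e by (simp add: \<epsilon>_def)
  obtain p where p: "polynomial_function p" "\<And>x. x \<in> {a..b} \<Longrightarrow> norm (G x - p x) < \<epsilon>"
    using Stone_Weierstrass_polynomial_function[OF _ cont \<epsilon>] by auto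
  obtain p' where p': "polynomial_function p'" "\<And>x. (p has_vector_derivative (p' x)) (at x)"
    using has_vector_derivative_polynomial_function[OF p(1)] by blast
  have contp: "continuous_on {a..b} p" "continuous_on {a..b} p'"
    using p p' continuous_on_polymonial_function by blast+
  \<comment> \<open>\<open>K\<close> bounds the boundary terms and the remaining integral of the
    integration by parts; \<open>N\<close> is then chosen so that
    \<open>K < \<bar>k\<bar> * e / 2\<close>.\<close>
  define K where "K = norm (p a) + norm (p b) + integral {a..b} (\<lambda>x. norm (p' x))"
  have K0: "K \<ge> 0" unfolding K_def
    by (intro add_nonneg_nonneg integral_nonneg integrable_continuous_real continuous_intros contp) auto
  define N where "N = nat (\<lceil>K * 2 / e\<rceil>) + 1"
  have "norm (integral {a..b} (\<lambda>x. G x * cis2pi (- (of_int k * x)))) < e" if k: "\<bar>k\<bar> \<ge> int N" for k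
  proof -
    have k0: "k \<noteq> 0" using k of_nat_0_le_iff[of "N - 1", where ?'a = int] unfolding N_def by linarith
    define F where "F = (\<lambda>x. cis2pi (- (of_int k * x)))"
    define c where "c = - (2 * of_real pi * \<i> * of_int k)"
    have c0: "c \<noteq> 0" using k0 by (simp add: c_def)
    have nc: "norm c = 2 * pi * of_int \<bar>k\<bar>" by (simp add: c_def norm_mult)
    have dF: "(F has_vector_derivative c * F x) (at x within A)" for x A
      unfolding F_def c_def
      by (rule has_vector_derivative_eq_rhs, rule has_vector_derivative_cis2pi[where g' = "- of_int k"])
         (auto intro!: derivative_eq_intros)
    have contF: "continuous_on A F" for A unfolding F_def by (intro continuous_intros)
    have "((\<lambda>x. p x * (c * F x) + p' x * F x) has_integral (p b * F b - p a * F a)) {a..b}"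
    proof (rule fundamental_theorem_of_calculus[OF ab])
      fix x assume "x \<in> {a..b}"
      show "((\<lambda>x. p x * F x) has_vector_derivative p x * (c * F x) + p' x * F x) (at x within {a..b})"
        by (intro has_vector_derivative_mult dF has_vector_derivative_at_within[OF p'(2)])
    qed
    then have "integral {a..b} (\<lambda>x. c * (p x * F x) + p' x * F x) = p b * F b - p a * F a"
      by (simp add: mult_ac has_integral_iff)
    also have "integral {a..b} (\<lambda>x. c * (p x * F x) + p' x * F x)
               = c * integral {a..b} (\<lambda>x. p x * F x) + integral {a..b} (\<lambda>x. p' x * F x)"
      by (subst integral_add) (auto intro!: integrable_continuous_real continuous_intros contp contF)
    finally have eq: "c * integral {a..b} (\<lambda>x. p x * F x) =
        p b * F b - p a * F a - integral {a..b} (\<lambda>x. p' x * F x)" by (simp add: algebra_simps)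
    have "norm (integral {a..b} (\<lambda>x. p' x * F x)) \<le> integral {a..b} (\<lambda>x. norm (p' x))"
      by (intro integral_norm_bound_integral integrable_continuous_real continuous_intros contp contF)
         (auto simp: norm_mult F_def)
    then have "norm (c * integral {a..b} (\<lambda>x. p x * F x)) \<le> K"
      using norm_triangle_ineq4[of "p b * F b - p a * F a" "integral {a..b} (\<lambda>x. p' x * F x)"]
        norm_triangle_ineq4[of "p b * F b" "p a * F a"]
      unfolding eq K_def by (simp add: norm_mult F_def)
    then have 1: "2 * pi * of_int \<bar>k\<bar> * norm (integral {a..b} (\<lambda>x. p x * F x)) \<le> K"
      by (simp add: norm_mult nc)
    have kN: "real_of_int \<bar>k\<bar> > K * 2 / e"
    proof -
      have "K * 2 / e \<le> of_int \<lceil>K * 2 / e\<rceil>" by simp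
      also have "\<dots> < of_int \<bar>k\<bar>" using k unfolding N_def by linarith
      finally show ?thesis .
    qed
    have "norm (integral {a..b} (\<lambda>x. p x * F x)) < e / 2"
    proof (rule ccontr)
      assume "\<not> ?thesis"
      then have "real_of_int \<bar>k\<bar> * (e / 2) \<le> of_int \<bar>k\<bar> * norm (integral {a..b} (\<lambda>x. p x * F x))"
        by (intro mult_left_mono) auto
      moreover have "of_int \<bar>k\<bar> * norm (integral {a..b} (\<lambda>x. p x * F x)) \<le>
          2 * pi * (of_int \<bar>k\<bar> * norm (integral {a..b} (\<lambda>x. p x * F x)))"
        using mult_right_mono[of 1 "2 * pi" "of_int \<bar>k\<bar> * norm (integral {a..b} (\<lambda>x. p x * F x))"] pi_ge_two
        by simp
      moreover have "K < real_of_int \<bar>k\<bar> * (e / 2)" using kN e by (simp add: field_simps)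
      ultimately show False using 1 by (simp add: mult_ac)
    qed
    moreover have "norm (integral {a..b} (\<lambda>x. (G x - p x) * F x)) \<le> integral {a..b} (\<lambda>x. \<epsilon>)"
      using p(2)
      by (intro integral_norm_bound_integral integrable_continuous_real continuous_intros contp contF cont)
         (auto simp: norm_mult F_def less_imp_le)
    moreover have "integral {a..b} (\<lambda>x. \<epsilon>) \<le> e / 2"
    proof -
      have "integral {a..b} (\<lambda>x. \<epsilon>) = (b - a) * \<epsilon>" using ab by simp
      also have "\<dots> \<le> e / 2" using ab e by (simp add: \<epsilon>_def field_simps)
      finally show ?thesis .
    qed
    moreover have eqG: "integral {a..b} (\<lambda>x. G x * F x) =
       integral {a..b} (\<lambda>x. (G x - p x) * F x) + integral {a..b} (\<lambda>x. p x * F x)"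
      by (subst integral_add[symmetric])
         (auto intro!: integrable_continuous_real continuous_intros contp contF cont simp: algebra_simps)
    moreover have "norm (integral {a..b} (\<lambda>x. G x * F x)) \<le>
        norm (integral {a..b} (\<lambda>x. (G x - p x) * F x)) + norm (integral {a..b} (\<lambda>x. p x * F x))"
      unfolding eqG by (rule norm_triangle_ineq)
    ultimately show ?thesis unfolding F_def by linarith
  qed
  then show ?thesis by blast
qed

text \<open>The Weierstrass test gives uniform convergence along the finite subsets of
  \<open>S\<close>, and uniform limits commute with integrals over a compact interval. Both the
  Poisson formula and the integral over the path use this exchange.\<close>

lemma has_sum_integral_M_test:
  fixes g :: "'i \<Rightarrow> real \<Rightarrow> complex"
  assumes cont: "\<And>i. continuous_on {a..b} (g i)"
    and bound: "\<And>i x. i \<in> S \<Longrightarrow> x \<in> {a..b} \<Longrightarrow> norm (g i x) \<le> M i"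
    and sm: "M summable_on S"
  shows "((\<lambda>i. integral {a..b} (g i)) has_sum integral {a..b} (\<lambda>x. \<Sum>\<^sub>\<infinity>i\<in>S. g i x)) S"
    and "continuous_on {a..b} (\<lambda>x. \<Sum>\<^sub>\<infinity>i\<in>S. g i x)"
proof -
  have ul: "uniform_limit {a..b} (\<lambda>X y. \<Sum>i\<in>X. g i y) (\<lambda>y. \<Sum>\<^sub>\<infinity>i\<in>S. g i y) (finite_subsets_at_top S)"
    by (rule Weierstrass_m_test_general[OF bound sm])
  have c: "continuous_on {a..b} (\<lambda>y. \<Sum>i\<in>X. g i y)" for X
    by (intro continuous_intros cont)
  show "continuous_on {a..b} (\<lambda>x. \<Sum>\<^sub>\<infinity>i\<in>S. g i x)"
    by (rule uniform_limit_theorem[OF _ ul]) (auto intro: c)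
  obtain I J where IJ: "\<And>X. ((\<lambda>y. \<Sum>i\<in>X. g i y) has_integral I X) {a..b}"
    "((\<lambda>y. \<Sum>\<^sub>\<infinity>i\<in>S. g i y) has_integral J) {a..b}" "(I \<longlongrightarrow> J) (finite_subsets_at_top S)"
    by (rule uniform_limit_integral[OF ul c]) auto
  have "I X = (\<Sum>i\<in>X. integral {a..b} (g i))" if "finite X" for X
    by (rule has_integral_unique[OF IJ(1) has_integral_sum[OF that]])
       (auto intro!: integrable_integral integrable_continuous_real cont)
  then have "((\<lambda>X. \<Sum>i\<in>X. integral {a..b} (g i)) \<longlongrightarrow> J) (finite_subsets_at_top S)"
    by (intro Lim_transform_eventually[OF IJ(3)] eventually_finite_subsets_at_top_weakI) auto
  moreover have "J = integral {a..b} (\<lambda>x. \<Sum>\<^sub>\<infinity>i\<in>S. g i x)" using IJ(2) by (simp add: has_integral_iff)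
  ultimately show "((\<lambda>i. integral {a..b} (g i)) has_sum integral {a..b} (\<lambda>x. \<Sum>\<^sub>\<infinity>i\<in>S. g i x)) S"
    by (simp add: has_sum_def)
qed

text \<open>The derivative fills the removable singularity. Numerator and denominator of the
  quotients \<open>G\<close> in the Poisson formula are both treated this way.\<close>

lemma continuous_on_diff_quotient:
  fixes f :: "real \<Rightarrow> complex"
  assumes "\<And>y. (f has_vector_derivative f' y) (at y)"
  shows "continuous_on A (\<lambda>x. if x = 0 then f' c else (f (c + x) - f c) /\<^sub>R x)"
proof -
  let ?g = "\<lambda>x. if x = 0 then f' c else (f (c + x) - f c) /\<^sub>R x"
  have cf: "isCont f y" for y
    using assms has_vector_derivative_continuous by blast
  have "isCont ?g x" for x
  proof (cases "x = 0")
    case True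
    have "((\<lambda>h. (f (c + h) - f c) /\<^sub>R h) \<longlongrightarrow> f' c) (at 0)"
    proof -
      have "((\<lambda>h. norm (f (c + h) - f c - h *\<^sub>R f' c) / norm h) \<longlongrightarrow> 0) (at 0)"
        using assms[of c] unfolding has_vector_derivative_def has_derivative_at by auto
      then have "((\<lambda>h. norm ((f (c + h) - f c) /\<^sub>R h - f' c)) \<longlongrightarrow> 0) (at 0)"
      proof (rule Lim_transform_eventually)
        show "\<forall>\<^sub>F h in at 0. norm (f (c + h) - f c - h *\<^sub>R f' c) / norm h =
                norm ((f (c + h) - f c) /\<^sub>R h - f' c)"
        proof (rule eventually_at_filter[THEN iffD2], rule always_eventually, intro allI impI)
          fix h :: real assume "h \<noteq> 0"
          then have "(f (c + h) - f c) /\<^sub>R h - f' c = (f (c + h) - f c - h *\<^sub>R f' c) /\<^sub>R h"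
            by (simp add: scaleR_diff_right)
          then show "norm (f (c + h) - f c - h *\<^sub>R f' c) / norm h =
                norm ((f (c + h) - f c) /\<^sub>R h - f' c)" by (simp add: divide_inverse mult.commute)
        qed
      qed
      then show ?thesis by (simp add: tendsto_norm_zero_iff LIM_zero_iff)
    qed
    then have "(?g \<longlongrightarrow> f' c) (at 0)"
      by (rule Lim_transform_eventually) (auto simp: eventually_at_filter)
    then show ?thesis using True by (simp add: isCont_def)
  next
    case False
    have cf': "isCont (\<lambda>x. f (c + x)) x"
      by (rule isCont_o2[OF _ cf]) (auto intro!: continuous_intros)
    have "isCont (\<lambda>x. (f (c + x) - f c) /\<^sub>R x) x"
      using False cf' by (auto intro!: continuous_intros)
    moreover have "\<forall>\<^sub>F y in nhds x. y \<noteq> 0" using False t1_space_nhds by blast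
    then have "\<forall>\<^sub>F y in nhds x. ?g y = (f (c + y) - f c) /\<^sub>R y"
      by eventually_elim auto
    ultimately show ?thesis by (simp add: isCont_cong)
  qed
  then show ?thesis by (simp add: continuous_at_imp_continuous_on)
qed

section \<open>Majorants and symmetric partial sums over the integers\<close>

lemma summable_on_int_inverse_squares:
  "(\<lambda>m::int. 1 / (1 + (real_of_int m)\<^sup>2)) summable_on UNIV"
proof -
  let ?f = "\<lambda>m::int. 1 / (1 + (real_of_int m)\<^sup>2)"
  have "summable (\<lambda>n. inverse (real (Suc n) ^ 2))"
    using inverse_power_summable[of 2, where ?'a = real] by (subst summable_Suc_iff) simp
  then have "summable (\<lambda>n::nat. norm (1 / (1 + (real n)\<^sup>2)))"
  proof (rule summable_comparison_test'[OF summable_mult[of _ 2], of _ 0])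
    fix n :: nat
    have "(real (Suc n))\<^sup>2 \<le> 2 * (1 + (real n)\<^sup>2)"
      using zero_le_power2[of "real n - 1"] by (simp add: power2_eq_square algebra_simps)
    then show "norm (norm (1 / (1 + (real n)\<^sup>2))) \<le> 2 * inverse (real (Suc n) ^ 2)"
      using add_pos_nonneg[of 1 "(real n)\<^sup>2"]
      by (simp add: divide_le_eq field_simps)
  qed
  then have *: "(\<lambda>n::nat. 1 / (1 + (real n)\<^sup>2)) summable_on UNIV"
    by (rule norm_summable_imp_summable_on)
  have "?f summable_on (range int)"
    by (subst summable_on_reindex) (auto simp: o_def *)
  moreover have "?f summable_on (range (\<lambda>n. - int n))"
    by (subst summable_on_reindex) (auto simp: o_def * inj_on_def)
  ultimately have "?f summable_on (range int \<union> range (\<lambda>n. - int n))"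
    by (rule summable_on_union)
  moreover have "range int \<union> range (\<lambda>n. - int n) = UNIV"
    by (auto simp: image_iff) (metis int_cases2)
  ultimately show ?thesis by simp
qed

text \<open>One majorant per integer serves the whole unit interval around it.\<close>

lemma one_plus_square_shift_le:
  fixes x m :: real
  assumes "\<bar>x\<bar> \<le> 1"
  shows "1 / (1 + (m + x)\<^sup>2) \<le> 3 / (1 + m\<^sup>2)"
proof -
  have "m\<^sup>2 \<le> 2 * (m + x)\<^sup>2 + 2 * x\<^sup>2"
    using zero_le_power2[of "m + 2 * x"] by (simp add: power2_eq_square algebra_simps)
  moreover have "x\<^sup>2 \<le> 1" using assms by (simp add: abs_square_le_1)
  ultimately have "1 + m\<^sup>2 \<le> 3 * (1 + (m + x)\<^sup>2)"
    using zero_le_power2[of "m + x"] unfolding distrib_left by linarith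
  moreover have "1 + m\<^sup>2 > 0" "1 + (m + x)\<^sup>2 > 0" by (simp_all add: add_pos_nonneg)
  ultimately show ?thesis by (simp add: field_simps)
qed

text \<open>\<open>has_sum\<close> is a limit along all finite sets, whereas telescoping needs
  consecutive integers.\<close>

lemma filterlim_symmetric_intervals:
  "filterlim (\<lambda>N::nat. {- int N..int N}) (finite_subsets_at_top UNIV) sequentially"
  unfolding filterlim_finite_subsets_at_top
proof safe
  fix X :: "int set" assume "finite X"
  then obtain B where B: "\<And>k. k \<in> X \<Longrightarrow> \<bar>k\<bar> \<le> B"
    using finite_imageI[of X abs] by (metis bdd_above.unfold bdd_above_finite imageI)
  have "\<forall>\<^sub>F N::nat in sequentially. N \<ge> nat B" by (rule eventually_ge_at_top)
  then show "\<forall>\<^sub>F N in sequentially. finite {- int N..int N} \<and> X \<subseteq> {- int N..int N} \<and>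
       {- int N..int N} \<subseteq> UNIV"
  proof eventually_elim
    case (elim N)
    have "k \<in> {- int N..int N}" if "k \<in> X" for k using B[OF that] elim by auto
    then show ?case by auto
  qed
qed

lemma has_sum_int_imp_symmetric_limit:
  fixes f :: "int \<Rightarrow> 'a :: topological_comm_monoid_add"
  assumes "(f has_sum S) UNIV"
  shows "(\<lambda>N::nat. \<Sum>k = - int N..int N. f k) \<longlonglongrightarrow> S"
  using filterlim_compose[OF assms[unfolded has_sum_def] filterlim_symmetric_intervals] .

lemma has_sum_diff:
  fixes f g :: "'i \<Rightarrow> 'a :: real_normed_vector"
  assumes "(f has_sum a) A" "(g has_sum b) A"
  shows "((\<lambda>x. f x - g x) has_sum (a - b)) A"
  using has_sum_add[OF assms(1), of "\<lambda>x. - g x" "- b"] assms(2) by (simp add: has_sum_uminus)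

lemma sum_symmetric_Suc:
  fixes f :: "int \<Rightarrow> 'a :: comm_monoid_add"
  shows "(\<Sum>k = - int (Suc N)..int (Suc N). f k) =
    f (- int (Suc N)) + (f (int (Suc N)) + (\<Sum>k = - int N..int N. f k))"
proof -
  have "{- int (Suc N)..int (Suc N)} = insert (- int (Suc N)) (insert (int (Suc N)) {- int N..int N})"
    by auto
  then show ?thesis by simp
qed

lemma integral_cis2pi_period:
  fixes k :: int
  shows "integral {-1/2..1/2} (\<lambda>x. cis2pi (- (of_int k * x))) = (if k = 0 then 1 else 0)"
proof (cases "k = 0")
  case False
  define c where "c = - (2 * of_real pi * \<i> * of_int k)"
  have c0: "c \<noteq> 0" using False by (simp add: c_def)
  have "((\<lambda>x. cis2pi (- (of_int k * x))) has_integral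
      (cis2pi (- (of_int k * (1/2))) / c - cis2pi (- (of_int k * (-1/2))) / c)) {-1/2..1/2}"
  proof (rule fundamental_theorem_of_calculus)
    fix x :: real
    have "((\<lambda>x. cis2pi (- (of_int k * x))) has_vector_derivative c * cis2pi (- (of_int k * x))) (at x within {-1/2..1/2})"
      unfolding c_def
      by (rule has_vector_derivative_eq_rhs, rule has_vector_derivative_cis2pi[where g' = "- of_int k"])
         (auto intro!: derivative_eq_intros)
    from has_vector_derivative_mult_right[OF this, of "1 / c"]
    show "((\<lambda>x. cis2pi (- (of_int k * x)) / c) has_vector_derivative cis2pi (- (of_int k * x))) (at x within {-1/2..1/2})"
      using c0 by simp
  qed simp
  moreover have "cis2pi (of_int k * (1/2)) = cis2pi (- (of_int k * (1/2)))"
    using cis2pi_add[of "of_int k" "- (of_int k * (1/2))"] by simp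
  ultimately show ?thesis using False by (simp add: has_integral_iff)
qed simp

text \<open>
  With \<open>G\<^sub>m x = (\<phi> (m + x) - \<phi> m) / (e (x) - 1)\<close> the \<open>k\<close>-th Fourier coefficient of \<open>\<phi> (m + x) - \<phi> m\<close> on
  the unit interval is a difference of two consecutive Fourier coefficients of \<open>G\<^sub>m\<close>. Summing over
  \<open>m\<close> and \<open>k\<close> telescopes, and the two remaining boundary terms vanish by Riemann--Lebesgue.
\<close>

theorem poisson_summation:
  fixes \<phi> \<phi>' :: "real \<Rightarrow> complex" and \<psi> :: "int \<Rightarrow> complex"
  assumes deriv: "\<And>y. (\<phi> has_vector_derivative \<phi>' y) (at y)"
    and bound: "\<And>y. norm (\<phi> y) \<le> C / (1 + y\<^sup>2)"
    and bound': "\<And>y. norm (\<phi>' y) \<le> C / (1 + y\<^sup>2)"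
    and ft: "\<And>k. ((\<lambda>y. \<phi> y * cis2pi (- (of_int k * y))) has_integral \<psi> k) UNIV"
    and sm: "\<psi> summable_on UNIV"
  shows "(\<Sum>\<^sub>\<infinity>m. \<phi> (of_int m)) = (\<Sum>\<^sub>\<infinity>k. \<psi> k)"
proof -
  have C0: "C \<ge> 0" using order_trans[OF norm_ge_zero bound[of 0]] by simp
  let ?I = "{-1/2..1/2::real}"
  let ?M = "\<lambda>m::int. 3 * C * (1 / (1 + (of_int m)\<^sup>2))"
  have M: "?M summable_on UNIV"
    by (intro summable_on_cmult_right summable_on_int_inverse_squares)
  have shift: "C / (1 + (of_int m + x)\<^sup>2) \<le> ?M m" if "\<bar>x\<bar> \<le> 1" for m x
    using mult_left_mono[OF one_plus_square_shift_le[OF that, of "of_int m"] C0] by (simp add: mult_ac)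
  have shift0: "C / (1 + (of_int m)\<^sup>2) \<le> ?M m" for m
    using shift[of 0 m] by simp
  have cont\<phi>: "continuous_on A \<phi>" for A
    using deriv has_vector_derivative_continuous continuous_at_imp_continuous_on by blast
  \<comment> \<open>\<open>cis2pi x - 1\<close> and \<open>\<phi> (m + x) - \<phi> m\<close> both
    vanish at 0. Dividing each of them by \<open>x\<close> first makes their quotient continuous
    there.\<close>
  define w where "w = (\<lambda>x. if x = 0 then 2 * of_real pi * \<i> * cis2pi 0 else (cis2pi (0 + x) - cis2pi 0) /\<^sub>R x)"
  define g where "g = (\<lambda>(m::int) x. if x = 0 then \<phi>' (of_int m) else (\<phi> (of_int m + x) - \<phi> (of_int m)) /\<^sub>R x)"
  have contw: "continuous_on A w" for A
    unfolding w_def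
    by (rule continuous_on_diff_quotient[where f = cis2pi and f' = "\<lambda>y. 2 * of_real pi * \<i> * cis2pi y"])
       (rule has_vector_derivative_eq_rhs, rule has_vector_derivative_cis2pi[OF DERIV_ident], simp)
  have contg: "continuous_on A (g m)" for A m
    unfolding g_def by (rule continuous_on_diff_quotient[OF deriv])
  \<comment> \<open>The period is centred at 0 so that \<open>cis2pi x = 1\<close> holds only at 0
    on the closed interval, and not at an endpoint.\<close>
  have w0: "w x \<noteq> 0" if "x \<in> ?I" for x
  proof (cases "x = 0")
    case False
    have "x \<notin> \<int>"
    proof
      assume "x \<in> \<int>"
      then obtain k :: int where k: "x = of_int k" by (auto elim: Ints_cases)
      then have "k = 0" using that by auto
      then show False using k False by simp
    qed
    then show ?thesis using False by (simp add: w_def cis2pi_eq_1_iff)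
  qed (simp add: w_def)
  have "\<exists>x\<in>?I. \<forall>y\<in>?I. norm (w x) \<le> norm (w y)"
    by (rule continuous_attains_inf) (auto intro!: continuous_intros contw)
  then obtain x0 where x0: "x0 \<in> ?I" "\<And>y. y \<in> ?I \<Longrightarrow> norm (w x0) \<le> norm (w y)" by blast
  define \<delta> where "\<delta> = norm (w x0)"
  have \<delta>: "\<delta> > 0" using w0[OF x0(1)] by (simp add: \<delta>_def)
  define G where "G = (\<lambda>(m::int) x. g m x / w x)"
  have contG: "continuous_on ?I (G m)" for m
    unfolding G_def using w0 by (intro continuous_intros contg contw) auto
  have boundg: "norm (g m x) \<le> ?M m" if "x \<in> ?I" for m x
  proof (cases "x = 0")
    case True
    then show ?thesis using order_trans[OF bound'[of "of_int m"] shift0[of m]] by (simp add: g_def)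
  next
    case False
    have "norm (\<phi> (of_int m + x) - \<phi> (of_int m)) \<le> norm ((of_int m + x) - of_int m) * ?M m"
    proof (rule differentiable_bound[where S = "closed_segment (of_int m) (of_int m + x)"
            and f' = "\<lambda>y h. h *\<^sub>R \<phi>' y", THEN order_trans])
      fix y assume y: "y \<in> closed_segment (real_of_int m) (of_int m + x)"
      show "(\<phi> has_derivative (\<lambda>h. h *\<^sub>R \<phi>' y)) (at y within closed_segment (of_int m) (of_int m + x))"
        using has_vector_derivative_at_within[OF deriv] unfolding has_vector_derivative_def .
      have "\<bar>y - of_int m\<bar> \<le> 1"
        using y that by (auto simp: closed_segment_eq_real_ivl split: if_splits)
      then have *: "norm (\<phi>' y) \<le> ?M m"
        using order_trans[OF bound'[of y]] shift[of "y - of_int m" m] by simp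
      show "onorm (\<lambda>h. h *\<^sub>R \<phi>' y) \<le> ?M m"
      proof (rule onorm_le)
        fix h :: real
        show "norm (h *\<^sub>R \<phi>' y) \<le> ?M m * norm h"
          using mult_left_mono[OF *, of "norm h"] by (simp only: norm_scaleR real_norm_def mult.commute[of _ "\<bar>h\<bar>"])
      qed
    qed (auto simp: mult_ac)
    then have "norm (\<phi> (of_int m + x) - \<phi> (of_int m)) / \<bar>x\<bar> \<le> ?M m"
      using False by (simp add: pos_divide_le_eq mult_ac)
    then show ?thesis using False by (simp add: g_def divide_inverse mult.commute)
  qed
  have boundG: "norm (G m x) \<le> ?M m / \<delta>" if "x \<in> ?I" for m x
    using frac_le[OF _ boundg[OF that, of m] \<delta>, of "norm (w x)"] x0(2)[OF that] C0
    by (simp add: G_def norm_divide \<delta>_def)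
  have M': "(\<lambda>m. ?M m / \<delta>) summable_on UNIV"
    using summable_on_cmult_left[OF M, of "1 / \<delta>"] by simp
  define Gh where "Gh = (\<lambda>k::int. integral ?I (\<lambda>x. (\<Sum>\<^sub>\<infinity>m. G m x) * cis2pi (- (of_int k * x))))"
  have contGs: "continuous_on ?I (\<lambda>x. \<Sum>\<^sub>\<infinity>m. G m x)"
    by (rule has_sum_integral_M_test(2)[OF contG _ M']) (use boundG in auto)
  have Gh: "((\<lambda>m. integral ?I (\<lambda>x. G m x * cis2pi (- (of_int k * x)))) has_sum Gh k) UNIV" for k
  proof -
    have "((\<lambda>m. integral ?I (\<lambda>x. G m x * cis2pi (- (of_int k * x)))) has_sum
             integral ?I (\<lambda>x. \<Sum>\<^sub>\<infinity>m. G m x * cis2pi (- (of_int k * x)))) UNIV"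
    proof (rule has_sum_integral_M_test(1)[OF _ _ M'])
      show "continuous_on ?I (\<lambda>x. G m x * cis2pi (- (of_int k * x)))" for m
        by (intro continuous_intros contG)
      show "norm (G m x * cis2pi (- (of_int k * x))) \<le> ?M m / \<delta>" if "x \<in> ?I" for m x
        using boundG[OF that] by (simp add: norm_mult)
    qed
    also have "integral ?I (\<lambda>x. \<Sum>\<^sub>\<infinity>m. G m x * cis2pi (- (of_int k * x))) = Gh k"
      unfolding Gh_def by (intro integral_cong) (simp add: infsum_cmult_left')
    finally show ?thesis .
  qed
  have sm\<phi>: "(\<lambda>m::int. \<phi> (of_int m)) summable_on UNIV"
  proof (rule abs_summable_summable, rule summable_on_comparison_test[OF M])
    fix m :: int
    show "norm (\<phi> (of_int m)) \<le> ?M m" using order_trans[OF bound[of "of_int m"] shift0[of m]] by simp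
  qed auto
  define S where "S = (\<Sum>\<^sub>\<infinity>m::int. \<phi> (of_int m))"
  have S: "((\<lambda>m::int. \<phi> (of_int m)) has_sum S) UNIV" unfolding S_def using sm\<phi> by (rule has_sum_infsum)
  \<comment> \<open>The translates of \<open>?I\<close> tile the line. Absolute summability gives a
    sum at all, and its symmetric partial sums are integrals over growing intervals, which
    identifies it with the Fourier integral.\<close>
  have \<psi>: "((\<lambda>m. integral ?I (\<lambda>x. \<phi> (of_int m + x) * cis2pi (- (of_int k * x)))) has_sum \<psi> k) UNIV" for k
  proof -
    let ?h = "\<lambda>y. \<phi> y * cis2pi (- (of_int k * y))"
    let ?a = "\<lambda>m::int. integral ?I (\<lambda>x. \<phi> (of_int m + x) * cis2pi (- (of_int k * x)))"
    have conth: "continuous_on A ?h" for A by (intro continuous_intros cont\<phi>)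
    have "?a summable_on UNIV"
    proof (rule abs_summable_summable, rule summable_on_comparison_test[OF M])
      fix m :: int
      have "norm (?a m) \<le> integral ?I (\<lambda>x. ?M m)"
      proof (rule integral_norm_bound_integral)
        fix x assume "x \<in> ?I"
        then have "\<bar>x\<bar> \<le> 1" by auto
        then show "norm (\<phi> (of_int m + x) * cis2pi (- (of_int k * x))) \<le> ?M m"
          using order_trans[OF bound shift] by (simp add: norm_mult)
      qed (auto intro!: integrable_continuous_real continuous_intros continuous_on_compose2[OF cont\<phi>[of UNIV]])
      then show "norm (?a m) \<le> ?M m" by simp
    qed auto
    then obtain s where s: "(?a has_sum s) UNIV" by (auto simp: summable_on_def)
    have a_eq: "?a m = integral {of_int m - 1/2..of_int m + 1/2} ?h" for m
    proof -
      have "((\<lambda>y. ?h y) has_integral integral {of_int m - 1/2..of_int m + 1/2} ?h) (cbox (of_int m - 1/2) (of_int m + 1/2))"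
        by (auto intro!: integrable_integral integrable_continuous_real conth)
      from has_integral_affinity[OF this, of 1 "of_int m"]
      have "((\<lambda>x. ?h (x + of_int m)) has_integral integral {of_int m - 1/2..of_int m + 1/2} ?h) ?I"
        by (simp add: image_affinity_atLeastAtMost[where m = 1, simplified])
      moreover have "?h (x + of_int m) = \<phi> (of_int m + x) * cis2pi (- (of_int k * x))" for x
      proof -
        have "cis2pi (- (of_int k * (x + of_int m))) = cis2pi (- (of_int k * x) + of_int (- (k * m)))"
          by (simp add: algebra_simps)
        then show ?thesis by (simp only: cis2pi_add cis2pi_of_int) (simp add: add.commute)
      qed
      ultimately show ?thesis by (simp add: has_integral_iff)
    qed
    have partial: "(\<Sum>m = - int N..int N. ?a m) = integral {- real N - 1/2..real N + 1/2} ?h" for N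
    proof (induction N)
      case (Suc N)
      have "(\<Sum>m = - int (Suc N)..int (Suc N). ?a m) =
          ?a (- int (Suc N)) + (?a (int (Suc N)) + integral {- real N - 1/2..real N + 1/2} ?h)"
        unfolding sum_symmetric_Suc Suc.IH ..
      also have "?a (- int (Suc N)) = integral {- real (Suc N) - 1/2..- real N - 1/2} ?h"
        unfolding a_eq by (rule arg_cong2[where f = integral]) auto
      also have "?a (int (Suc N)) = integral {real N + 1/2..real (Suc N) + 1/2} ?h"
        unfolding a_eq by (rule arg_cong2[where f = integral]) auto
      also have "integral {real N + 1/2..real (Suc N) + 1/2} ?h + integral {- real N - 1/2..real N + 1/2} ?h =
          integral {- real N - 1/2..real (Suc N) + 1/2} ?h"
        by (rule trans[OF add.commute], rule Henstock_Kurzweil_Integration.integral_combine) (auto intro!: integrable_continuous_real conth)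
      also have "integral {- real (Suc N) - 1/2..- real N - 1/2} ?h + \<dots> =
          integral {- real (Suc N) - 1/2..real (Suc N) + 1/2} ?h"
        by (rule Henstock_Kurzweil_Integration.integral_combine) (auto intro!: integrable_continuous_real conth)
      finally show ?case .
    qed (simp add: a_eq)
    have "(\<lambda>N. integral {- real N - 1/2..real N + 1/2} ?h) \<longlonglongrightarrow> \<psi> k"
    proof (rule LIMSEQ_I)
      fix e :: real assume "e > 0"
      have "\<not> (\<exists>a b :: real. UNIV = cbox a b)" by (metis bounded_cbox not_bounded_UNIV)
      from ft[of k] this \<open>e > 0\<close>
      obtain B where B: "\<forall>a b. ball 0 B \<subseteq> cbox a b \<longrightarrow>
          (\<exists>z. ((\<lambda>x. if x \<in> UNIV then ?h x else 0) has_integral z) (cbox a b) \<and> norm (z - \<psi> k) < e)"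
        by (rule has_integral_altD)
      have "norm (integral {- real N - 1/2..real N + 1/2} ?h - \<psi> k) < e" if "N \<ge> nat \<lceil>B\<rceil>" for N
      proof -
        have "B \<le> real N" using that by linarith
        then have "ball 0 B \<subseteq> cbox (- real N - 1/2) (real N + 1/2)" by (auto simp: dist_real_def)
        from B[rule_format, OF this] show ?thesis by (auto simp: has_integral_iff)
      qed
      then show "\<exists>no. \<forall>n\<ge>no. norm (integral {- real n - 1/2..real n + 1/2} ?h - \<psi> k) < e" by blast
    qed
    with has_sum_int_imp_symmetric_limit[OF s] have "s = \<psi> k"
      unfolding partial by (rule LIMSEQ_unique)
    with s show ?thesis by simp
  qed
  \<comment> \<open>The subtracted constant \<open>\<phi> m\<close> has only a zeroth Fourier
    coefficient, so after summation over \<open>m\<close> the left-hand sum \<open>S\<close> of the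
    Poisson formula enters at \<open>k = 0\<close> alone.\<close>
  have step: "integral ?I (\<lambda>x. \<phi> (of_int m + x) * cis2pi (- (of_int k * x))) - (if k = 0 then \<phi> (of_int m) else 0) =
      integral ?I (\<lambda>x. G m x * cis2pi (- (of_int (k - 1) * x))) - integral ?I (\<lambda>x. G m x * cis2pi (- (of_int k * x)))" for m k :: int
  proof -
    have "integral ?I (\<lambda>x. \<phi> (of_int m + x) * cis2pi (- (of_int k * x))) - \<phi> (of_int m) * integral ?I (\<lambda>x. cis2pi (- (of_int k * x)))
       = integral ?I (\<lambda>x. \<phi> (of_int m + x) * cis2pi (- (of_int k * x)) - \<phi> (of_int m) * cis2pi (- (of_int k * x)))"
      by (subst integral_diff)
         (auto intro!: integrable_continuous_real continuous_intros continuous_on_compose2[OF cont\<phi>[of UNIV]])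
    also have "\<dots> = integral ?I (\<lambda>x. G m x * cis2pi (- (of_int (k - 1) * x)) - G m x * cis2pi (- (of_int k * x)))"
    proof (rule integral_cong)
      fix x assume x: "x \<in> ?I"
      have ww: "\<phi> (of_int m + x) - \<phi> (of_int m) = G m x * (cis2pi x - 1)"
        using w0[OF x] by (auto simp: G_def g_def w_def field_simps scaleR_conv_of_real)
      have "cis2pi (- (of_int (k - 1) * x)) = cis2pi x * cis2pi (- (of_int k * x))"
        by (simp add: cis2pi_add[symmetric] algebra_simps)
      then have "G m x * cis2pi (- (of_int (k - 1) * x)) - G m x * cis2pi (- (of_int k * x)) = (G m x * (cis2pi x - 1)) * cis2pi (- (of_int k * x))"
        by (simp add: algebra_simps)
      from this[folded ww]
      show "\<phi> (of_int m + x) * cis2pi (- (of_int k * x)) - \<phi> (of_int m) * cis2pi (- (of_int k * x)) =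
          G m x * cis2pi (- (of_int (k - 1) * x)) - G m x * cis2pi (- (of_int k * x))"
        by (metis left_diff_distrib)
    qed
    also have "\<dots> = integral ?I (\<lambda>x. G m x * cis2pi (- (of_int (k - 1) * x))) - integral ?I (\<lambda>x. G m x * cis2pi (- (of_int k * x)))"
      by (rule integral_diff) (intro integrable_continuous_real continuous_intros contG)+
    finally show ?thesis unfolding integral_cis2pi_period by (cases "k = 0") (simp_all only: if_True if_False simp_thms mult_1_right mult_zero_right)
  qed
  have step': "\<psi> k - (if k = 0 then S else 0) = Gh (k - 1) - Gh k" for k
  proof -
    have "((\<lambda>m. integral ?I (\<lambda>x. \<phi> (of_int m + x) * cis2pi (- (of_int k * x))) - (if k = 0 then \<phi> (of_int m) else 0))
        has_sum (\<psi> k - (if k = 0 then S else 0))) UNIV"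
      by (intro has_sum_diff \<psi>) (auto simp: S)
    moreover have "((\<lambda>m. integral ?I (\<lambda>x. G m x * cis2pi (- (of_int (k - 1) * x))) -
        integral ?I (\<lambda>x. G m x * cis2pi (- (of_int k * x)))) has_sum (Gh (k - 1) - Gh k)) UNIV"
      by (intro has_sum_diff Gh)
    ultimately show ?thesis unfolding step by (rule has_sum_unique)
  qed
  have tele: "(\<Sum>k = - int N..int N. \<psi> k) - S = Gh (- int N - 1) - Gh (int N)" for N
  proof (induction N)
    case 0
    show ?case using step'[of 0] by simp
  next
    case (Suc N)
    have "(\<Sum>k = - int (Suc N)..int (Suc N). \<psi> k) - S = \<psi> (- int (Suc N)) + \<psi> (int (Suc N)) + ((\<Sum>k = - int N..int N. \<psi> k) - S)"
      unfolding sum_symmetric_Suc by simp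
    also have "\<dots> = Gh (- int (Suc N) - 1) - Gh (int (Suc N))"
    proof -
      have s1: "\<psi> (- int (Suc N)) = Gh (- int (Suc N) - 1) - Gh (- int (Suc N))"
        using step'[of "- int (Suc N)"] by (simp del: of_nat_Suc)
      have s2: "\<psi> (int (Suc N)) = Gh (int N) - Gh (int (Suc N))"
        using step'[of "int (Suc N)"] by simp
      have eq: "- int N - 1 = - int (Suc N)" by simp
      show ?thesis unfolding Suc.IH eq s1 s2 by (simp del: of_nat_Suc)
    qed
    finally show ?case .
  qed
  have "(\<lambda>N. Gh (- int N - 1) - Gh (int N)) \<longlonglongrightarrow> 0"
  proof (rule LIMSEQ_I)
    fix e :: real assume "e > 0"
    then obtain N0 :: nat where N0: "\<And>k. \<bar>k\<bar> \<ge> int N0 \<Longrightarrow> norm (Gh k) < e / 2"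
      using riemann_lebesgue[OF contGs, of "e / 2"] unfolding Gh_def by auto
    have "norm (Gh (- int N - 1) - Gh (int N) - 0) < e" if "N \<ge> N0" for N
      using N0[of "- int N - 1"] N0[of "int N"] that norm_triangle_ineq4[of "Gh (- int N - 1)" "Gh (int N)"]
      by simp
    then show "\<exists>no. \<forall>n\<ge>no. norm (Gh (- int n - 1) - Gh (int n) - 0) < e" by blast
  qed
  moreover have "(\<lambda>N. (\<Sum>k = - int N..int N. \<psi> k) - S) \<longlonglongrightarrow> (\<Sum>\<^sub>\<infinity>k. \<psi> k) - S"
    by (intro tendsto_intros has_sum_int_imp_symmetric_limit has_sum_infsum sm)
  ultimately have "(\<Sum>\<^sub>\<infinity>k. \<psi> k) - S = 0" unfolding tele by (metis LIMSEQ_unique)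
  then show ?thesis by (simp add: S_def)
qed

section \<open>Hermite polynomials times Gaussians\<close>

text \<open>On an interval containing \<open>[- B, B]\<close> the integral is
  \<open>G b - G a\<close>, which the decay of \<open>G\<close> makes small. This meets the
  definition of the integral over the line directly, so integrability of \<open>G'\<close> comes
  with the value.\<close>

lemma has_integral_derivative_vanishing:
  fixes G G' :: "real \<Rightarrow> complex"
  assumes deriv: "\<And>y. (G has_vector_derivative G' y) (at y)"
    and bound: "\<And>y. norm (G y) \<le> C / (1 + y\<^sup>2)"
  shows "(G' has_integral 0) UNIV"
proof -
  have C0: "C \<ge> 0" using order_trans[OF norm_ge_zero bound[of 0]] by simp
  have "\<exists>B>0. \<forall>a b. ball 0 B \<subseteq> cbox a b \<longrightarrow> (\<exists>z. (G' has_integral z) (cbox a b) \<and> norm z < e)"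
    if e: "e > 0" for e
  proof -
    \<comment> \<open>The summand 1 gives \<open>B \<le> B\<^sup>2\<close>, so that the quadratic
      decay beats \<open>2 * C / e\<close>.\<close>
    define B where "B = 2 * C / e + 1"
    have B: "B \<ge> 1" using C0 e by (simp add: B_def)
    have small: "norm (G y) < e / 2" if "\<bar>y\<bar> \<ge> B" for y
    proof -
      have "B \<le> B\<^sup>2" using B by (simp add: power2_eq_square)
      also have "B\<^sup>2 \<le> y\<^sup>2" using that B by (simp add: abs_le_square_iff[symmetric])
      finally have "2 * C / e < 1 + y\<^sup>2" unfolding B_def by linarith
      then have "C / (1 + y\<^sup>2) < e / 2"
        using e C0 by (simp add: field_simps add_pos_nonneg)
      then show ?thesis using bound[of y] by linarith
    qed
    have "\<exists>z. (G' has_integral z) (cbox a b) \<and> norm z < e" if sub: "ball 0 B \<subseteq> cbox a b" for a b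
    proof -
      have closed: "cball 0 B \<subseteq> cbox a b"
        using closure_mono[OF sub] B by (simp add: closure_cbox)
      then have "B \<in> cbox a b" "- B \<in> cbox a b" using B by (auto simp: subset_iff dist_real_def)
      then have ab: "a \<le> - B" "B \<le> b" by auto
      then have "a \<le> b" using B by linarith
      then have "(G' has_integral (G b - G a)) {a..b}"
        by (intro fundamental_theorem_of_calculus has_vector_derivative_at_within[OF deriv])
      moreover have "norm (G b - G a) < e"
        using small[of a] small[of b] ab B norm_triangle_ineq4[of "G b" "G a"] by simp
      ultimately show ?thesis by auto
    qed
    then show ?thesis using B by (intro exI[of _ B]) auto
  qed
  moreover have "\<not> (\<exists>a b :: real. UNIV = cbox a b)" by (metis bounded_cbox not_bounded_UNIV)
  ultimately show ?thesis by (subst has_integral_alt) simp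
qed

section \<open>Polynomials dominated by Gaussians\<close>

text \<open>Induction on the coefficients: the factor \<open>s\<close> and the remaining polynomial
  each receive half of the exponent. Hence any small part of a Gaussian pays for a polynomial of any
  degree.\<close>

lemma poly_exp_square_bound:
  fixes p :: "real poly"
  assumes "\<delta> > 0"
  shows "\<exists>K\<ge>0. \<forall>s. \<bar>poly p s\<bar> \<le> K * exp (\<delta> * s\<^sup>2)"
  using assms
proof (induction p arbitrary: \<delta>)
  case 0
  then show ?case by (auto intro!: exI[of _ 0])
next
  case (pCons a p)
  from pCons.IH[of "\<delta> / 2"] pCons.prems obtain K where K: "K \<ge> 0" "\<And>s. \<bar>poly p s\<bar> \<le> K * exp (\<delta> / 2 * s\<^sup>2)" by auto
  define L where "L = 1 + 2 / \<delta>"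
  have L0: "L \<ge> 0" using pCons.prems by (simp add: L_def)
  have L: "\<bar>s\<bar> \<le> L * exp (\<delta> / 2 * s\<^sup>2)" for s :: real
  proof -
    have "\<bar>s\<bar> \<le> 1 + s\<^sup>2" using zero_le_power2[of "\<bar>s\<bar> - 1"] zero_le_power2[of s]
      by (simp add: power2_eq_square algebra_simps)
    also have "\<dots> \<le> L * (1 + \<delta> / 2 * s\<^sup>2)" using pCons.prems by (simp add: L_def field_simps)
    also have "\<dots> \<le> L * exp (\<delta> / 2 * s\<^sup>2)"
      using L0 by (intro mult_left_mono exp_ge_add_one_self) auto
    finally show ?thesis .
  qed
  have "\<bar>poly (pCons a p) s\<bar> \<le> (\<bar>a\<bar> + L * K) * exp (\<delta> * s\<^sup>2)" for s
  proof -
    have "\<bar>poly (pCons a p) s\<bar> \<le> \<bar>a\<bar> + \<bar>s\<bar> * \<bar>poly p s\<bar>"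
      by (simp add: abs_mult[symmetric])
    also have "\<bar>s\<bar> * \<bar>poly p s\<bar> \<le> (L * exp (\<delta> / 2 * s\<^sup>2)) * (K * exp (\<delta> / 2 * s\<^sup>2))"
      using L0 by (intro mult_mono L K) auto
    also have "\<dots> = L * K * exp (\<delta> / 2 * s\<^sup>2 + \<delta> / 2 * s\<^sup>2)" by (simp only: exp_add mult_ac)
    also have "\<delta> / 2 * s\<^sup>2 + \<delta> / 2 * s\<^sup>2 = \<delta> * s\<^sup>2" by (simp add: field_simps)
    also have "\<bar>a\<bar> \<le> \<bar>a\<bar> * exp (\<delta> * s\<^sup>2)" using pCons.prems by (simp add: mult_le_cancel_left1)
    finally show ?thesis by (simp add: algebra_simps)
  qed
  then show ?case using K L0 by (intro exI[of _ "\<bar>a\<bar> + L * K"]) auto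
qed

text \<open>From \<open>1 + c * x\<^sup>2 \<le> exp (c * x\<^sup>2)\<close>. All Gaussian bounds are
  reduced to this inverse square form, whose sums over a lattice factor coordinatewise.\<close>

lemma exp_minus_square_le:
  fixes c x :: real
  assumes "c > 0"
  shows "exp (- (c * x\<^sup>2)) \<le> (1 + 1 / c) / (1 + x\<^sup>2)"
proof -
  have "1 + x\<^sup>2 \<le> (1 + 1 / c) * (1 + c * x\<^sup>2)" using assms by (simp add: field_simps)
  also have "\<dots> \<le> (1 + 1 / c) * exp (c * x\<^sup>2)"
    using assms by (intro mult_left_mono exp_ge_add_one_self) auto
  finally have "exp (- (c * x\<^sup>2)) * (1 + x\<^sup>2) \<le> exp (- (c * x\<^sup>2)) * ((1 + 1 / c) * exp (c * x\<^sup>2))"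
    by (intro mult_left_mono) auto
  also have "\<dots> = 1 + 1 / c" by (simp add: exp_minus field_simps)
  finally show ?thesis by (simp add: pos_le_divide_eq add_pos_nonneg)
qed

lemma poly_gaussian_bound:
  fixes p :: "real poly"
  assumes "c > 0"
  shows "\<exists>C\<ge>0. \<forall>y. \<bar>poly p y\<bar> * exp (- (c * y\<^sup>2)) \<le> C / (1 + y\<^sup>2)"
proof -
  obtain K where K: "K \<ge> 0" "\<And>s. \<bar>poly p s\<bar> \<le> K * exp (c / 2 * s\<^sup>2)"
    using poly_exp_square_bound[of "c / 2" p] assms by auto
  have "\<bar>poly p y\<bar> * exp (- (c * y\<^sup>2)) \<le> K * (1 + 1 / (c / 2)) / (1 + y\<^sup>2)" for y
  proof -
    have "\<bar>poly p y\<bar> * exp (- (c * y\<^sup>2)) \<le> K * exp (c / 2 * y\<^sup>2) * exp (- (c * y\<^sup>2))"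
      using K by (intro mult_right_mono) auto
    also have "\<dots> = K * exp (- (c / 2 * y\<^sup>2))" unfolding mult.assoc exp_add[symmetric] by (simp add: field_simps)
    also have "\<dots> \<le> K * ((1 + 1 / (c / 2)) / (1 + y\<^sup>2))"
      using assms K by (intro mult_left_mono exp_minus_square_le) auto
    finally show ?thesis by simp
  qed
  then show ?thesis using K assms by (intro exI[of _ "K * (1 + 1 / (c / 2))"]) auto
qed

text \<open>The monic Hermite polynomials orthogonal for \<open>exp (- pi * s\<^sup>2)\<close>, that
  is \<open>exp (- (d/ds)\<^sup>2 / (4 * pi))\<close> applied to \<open>s ^ n\<close>. In this
  normalisation the Fourier transform of polynomial times Gaussian is a pure power times a
  Gaussian.\<close>

primrec hermite_poly :: "nat \<Rightarrow> real poly" where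
  "hermite_poly 0 = 1"
| "hermite_poly (Suc n) = [:0, 1:] * hermite_poly n - smult (1 / (2 * pi)) (pderiv (hermite_poly n))"

text \<open>An affine substitution in the characteristic function of the standard normal
  distribution.\<close>

lemma gaussian_fourier:
  fixes l a w :: real
  assumes l: "l > 0"
  shows "((\<lambda>y. of_real (exp (- pi * (l * (a + y))\<^sup>2)) * cis2pi ((a + y) * w)) has_integral
           of_real (exp (- pi * (w / l)\<^sup>2) / l)) UNIV"
proof -
  \<comment> \<open>With \<open>z = c * (a + y)\<close> the exponent \<open>z\<^sup>2 / 2\<close>
    becomes \<open>pi * (l * (a + y))\<^sup>2\<close>, and \<open>t * z\<close> becomes
    \<open>2 * pi * (a + y) * w\<close>.\<close>
  define t where "t = sqrt (2 * pi) * w / l"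
  define F where "F = (\<lambda>x. std_normal_density x *\<^sub>R iexp (t * x))"
  define c where "c = sqrt (2 * pi) * l"
  have c: "c > 0" using l by (simp add: c_def)
  have intF: "integrable lborel F"
    unfolding F_def
  proof (rule Bochner_Integration.integrable_bound)
    show "integrable lborel std_normal_density" by (rule integrable_normal_density) simp
  qed auto
  have "integral\<^sup>L lborel F = char std_normal_distribution t"
    unfolding F_def char_def by (subst integral_density) (auto simp: normal_density_nonneg)
  also have "\<dots> = of_real (exp (- t\<^sup>2 / 2))" by (simp add: char_std_normal_distribution)
  finally have 1: "integral\<^sup>L lborel F = of_real (exp (- t\<^sup>2 / 2))" .
  have int2: "integrable lborel (\<lambda>y. F (c * a + c * y))"
    using lborel_integrable_real_affine[OF intF, of c "c * a"] c by simp
  have "integral\<^sup>L lborel F = c *\<^sub>R integral\<^sup>L lborel (\<lambda>y. F (c * a + c * y))"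
    using lborel_integral_real_affine[of c F "c * a"] c by simp
  with 1 have 2: "integral\<^sup>L lborel (\<lambda>y. F (c * a + c * y)) = of_real (exp (- t\<^sup>2 / 2) / c)"
    using c by (simp add: scaleR_conv_of_real field_simps)
  have "((\<lambda>y. F (c * a + c * y)) has_integral of_real (exp (- t\<^sup>2 / 2) / c)) UNIV"
    using has_integral_integral_lborel[OF int2] unfolding 2 .
  from has_integral_mult_right[OF this, of "of_real (sqrt (2 * pi))"]
  have "((\<lambda>y. of_real (sqrt (2 * pi)) * F (c * a + c * y)) has_integral
      of_real (sqrt (2 * pi)) * of_real (exp (- t\<^sup>2 / 2) / c)) UNIV" .
  also have "(\<lambda>y. of_real (sqrt (2 * pi)) * F (c * a + c * y)) =
      (\<lambda>y. of_real (exp (- pi * (l * (a + y))\<^sup>2)) * cis2pi ((a + y) * w))"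
  proof
    fix y
    have "(c * a + c * y)\<^sup>2 / 2 = pi * (l * (a + y))\<^sup>2"
      by (simp add: c_def power_mult_distrib flip: distrib_left)
    moreover have "t * (c * a + c * y) = 2 * pi * ((a + y) * w)"
      using l by (simp add: c_def t_def field_simps)
    ultimately show "of_real (sqrt (2 * pi)) * F (c * a + c * y) =
       of_real (exp (- pi * (l * (a + y))\<^sup>2)) * cis2pi ((a + y) * w)"
      unfolding F_def cis2pi_def cis_conv_exp std_normal_density_def scaleR_conv_of_real minus_divide_left[symmetric]
      by (simp only:) simp
  qed
  also have "of_real (sqrt (2 * pi)) * of_real (exp (- t\<^sup>2 / 2) / c) = (of_real (exp (- pi * (w / l)\<^sup>2) / l) :: complex)"
    by (simp add: c_def t_def power_divide power_mult_distrib)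
  finally show ?thesis .
qed

lemma has_vector_derivative_poly_gaussian:
  fixes p :: "real poly" and l a w :: real
  shows "((\<lambda>y. of_real (poly p (a + y) * exp (- pi * (l * (a + y))\<^sup>2)) * cis2pi ((a + y) * w)) has_vector_derivative
      (of_real ((poly (pderiv p) (a + y) - 2 * pi * l\<^sup>2 * (a + y) * poly p (a + y)) * exp (- pi * (l * (a + y))\<^sup>2))
         * cis2pi ((a + y) * w)
       + 2 * of_real pi * \<i> * of_real w * (of_real (poly p (a + y) * exp (- pi * (l * (a + y))\<^sup>2)) * cis2pi ((a + y) * w)))) (at y)"
proof -
  have 1: "((\<lambda>y. poly p (a + y) * exp (- pi * (l * (a + y))\<^sup>2)) has_real_derivative
      (poly (pderiv p) (a + y) - 2 * pi * l\<^sup>2 * (a + y) * poly p (a + y)) * exp (- pi * (l * (a + y))\<^sup>2)) (at y)"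
    by (rule derivative_eq_intros DERIV_chain'[OF _ poly_DERIV] refl)+
       (simp add: algebra_simps power2_eq_square)
  have 2: "((\<lambda>y. cis2pi ((a + y) * w)) has_vector_derivative 2 * of_real pi * \<i> * of_real w * cis2pi ((a + y) * w)) (at y)"
    by (rule has_vector_derivative_cis2pi) (auto intro!: derivative_eq_intros)
  show ?thesis
    by (rule has_vector_derivative_eq_rhs[OF has_vector_derivative_mult[OF has_vector_derivative_of_real[OF 1] 2]])
       (simp only: mult_ac add_ac)
qed

text \<open>Recentring at \<open>a\<close> costs half of the exponent and a constant, by
  \<open>(a + y)\<^sup>2 \<ge> y\<^sup>2 / 2 - a\<^sup>2\<close>.\<close>

lemma hermite_gaussian_bound:
  fixes p :: "real poly"
  assumes l: "l > 0"
  shows "\<exists>C. \<forall>y. \<bar>poly p (a + y)\<bar> * exp (- pi * (l * (a + y))\<^sup>2) \<le> C / (1 + y\<^sup>2)"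
proof -
  define q where "q = p \<circ>\<^sub>p [:a, 1:]"
  have q: "poly q y = poly p (a + y)" for y by (simp add: q_def poly_pcompose)
  define K where "K = exp (pi * l\<^sup>2 * a\<^sup>2)"
  have sq: "(l * (a + y))\<^sup>2 \<ge> l\<^sup>2 / 2 * y\<^sup>2 - l\<^sup>2 * a\<^sup>2" for y
  proof -
    have "y\<^sup>2 / 2 \<le> (a + y)\<^sup>2 + a\<^sup>2"
      using zero_le_power2[of "2 * a + y"] by (simp add: power2_eq_square algebra_simps)
    from mult_left_mono[OF this, of "l\<^sup>2"] show ?thesis
      unfolding power_mult_distrib by (simp add: algebra_simps)
  qed
  have *: "exp (- pi * (l * (a + y))\<^sup>2) \<le> K * exp (- (pi * l\<^sup>2 / 2 * y\<^sup>2))" for y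
  proof -
    have "- pi * (l * (a + y))\<^sup>2 \<le> - pi * (l\<^sup>2 / 2 * y\<^sup>2 - l\<^sup>2 * a\<^sup>2)"
      by (rule mult_left_mono_neg) (use sq in auto)
    also have "\<dots> = pi * l\<^sup>2 * a\<^sup>2 + - (pi * l\<^sup>2 / 2 * y\<^sup>2)" by (simp add: algebra_simps)
    finally have "exp (- pi * (l * (a + y))\<^sup>2) \<le> exp (pi * l\<^sup>2 * a\<^sup>2 + - (pi * l\<^sup>2 / 2 * y\<^sup>2))" by simp
    then show ?thesis unfolding exp_add K_def .
  qed
  obtain C where C: "\<And>y. \<bar>poly q y\<bar> * exp (- (pi * l\<^sup>2 / 2 * y\<^sup>2)) \<le> C / (1 + y\<^sup>2)"
    using poly_gaussian_bound[of "pi * l\<^sup>2 / 2" q] l by auto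
  have "\<bar>poly p (a + y)\<bar> * exp (- pi * (l * (a + y))\<^sup>2) \<le> (K * C) / (1 + y\<^sup>2)" for y
  proof -
    have "\<bar>poly p (a + y)\<bar> * exp (- pi * (l * (a + y))\<^sup>2) \<le> \<bar>poly q y\<bar> * (K * exp (- (pi * l\<^sup>2 / 2 * y\<^sup>2)))"
      unfolding q by (intro mult_left_mono *) auto
    also have "\<dots> = K * (\<bar>poly q y\<bar> * exp (- (pi * l\<^sup>2 / 2 * y\<^sup>2)))" by (simp only: mult_ac)
    also have "\<dots> \<le> K * (C / (1 + y\<^sup>2))" by (intro mult_left_mono C) (simp add: K_def)
    finally show ?thesis by simp
  qed
  then show ?thesis by blast
qed

text \<open>The derivative of the integrand has integral 0. Subtracting
  \<open>1 / (2 * pi * l)\<close> times it from \<open>R + i w / l\<close> times the integrand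
  cancels the frequency and leaves exactly the Hermite recursion, while on the transformed side only
  the factor \<open>R + i w / l\<close> appears. The offset \<open>R\<close> will carry the variable
  \<open>x\<close> that is kept fixed.\<close>

lemma hermite_gaussian_fourier:
  fixes l a w R :: real
  assumes l: "l > 0"
  shows "((\<lambda>y. of_real (poly (hermite_poly n) (R + l * (a + y)) * exp (- pi * (l * (a + y))\<^sup>2)) * cis2pi ((a + y) * w)) has_integral
           (of_real R + \<i> * of_real (w / l)) ^ n * of_real (exp (- pi * (w / l)\<^sup>2) / l)) UNIV"
proof (induction n)
  case 0
  show ?case using gaussian_fourier[OF l, of a w] by simp
next
  case (Suc n)
  define p where "p = hermite_poly n \<circ>\<^sub>p [:R, l:]"
  have p: "poly p y = poly (hermite_poly n) (R + l * y)" for y by (simp add: p_def poly_pcompose mult.commute)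
  have p': "poly (pderiv p) y = l * poly (pderiv (hermite_poly n)) (R + l * y)" for y
    by (simp add: p_def pderiv_pcompose poly_pcompose pderiv_pCons mult.commute)
  let ?g = "\<lambda>y. of_real (poly (hermite_poly n) (R + l * (a + y)) * exp (- pi * (l * (a + y))\<^sup>2)) * cis2pi ((a + y) * w)"
  let ?G' = "\<lambda>y. of_real ((poly (pderiv p) (a + y) - 2 * pi * l\<^sup>2 * (a + y) * poly p (a + y)) * exp (- pi * (l * (a + y))\<^sup>2))
         * cis2pi ((a + y) * w)
       + 2 * of_real pi * \<i> * of_real w * (of_real (poly p (a + y) * exp (- pi * (l * (a + y))\<^sup>2)) * cis2pi ((a + y) * w))"
  obtain C where C: "\<And>y. \<bar>poly p (a + y)\<bar> * exp (- pi * (l * (a + y))\<^sup>2) \<le> C / (1 + y\<^sup>2)"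
    using hermite_gaussian_bound[OF l, of p a] by blast
  have "(?G' has_integral 0) UNIV"
    by (rule has_integral_derivative_vanishing[OF has_vector_derivative_poly_gaussian, of _ _ _ _ C])
       (use C in \<open>simp add: norm_mult abs_mult\<close>)
  from has_integral_diff[OF has_integral_mult_right[OF Suc.IH, of "of_real R + \<i> * of_real (w / l)"]
       has_integral_mult_right[OF this, of "of_real (1 / (2 * pi * l))"]]
  have "((\<lambda>y. (of_real R + \<i> * of_real (w / l)) * ?g y - of_real (1 / (2 * pi * l)) * ?G' y) has_integral
     (of_real R + \<i> * of_real (w / l)) ^ Suc n * of_real (exp (- pi * (w / l)\<^sup>2) / l)) UNIV"
    by (simp only: mult_zero_right diff_zero power_Suc mult.assoc)
  moreover have "(of_real R + \<i> * of_real (w / l)) * ?g y - of_real (1 / (2 * pi * l)) * ?G' y =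
     of_real (poly (hermite_poly (Suc n)) (R + l * (a + y)) * exp (- pi * (l * (a + y))\<^sup>2)) * cis2pi ((a + y) * w)" for y
  proof -
    define X :: complex where "X = of_real (exp (- pi * (l * (a + y))\<^sup>2)) * cis2pi ((a + y) * w)"
    define P :: complex where "P = of_real (poly (hermite_poly n) (R + l * (a + y)))"
    define P' :: complex where "P' = of_real (poly (pderiv (hermite_poly n)) (R + l * (a + y)))"
    have "(of_real R + \<i> * of_real (w / l)) * ?g y - of_real (1 / (2 * pi * l)) * ?G' y =
       X * ((of_real R + \<i> * of_real (w / l)) * P - of_real (1 / (2 * pi * l)) *
         ((of_real l * P' - 2 * of_real pi * of_real l ^ 2 * of_real (a + y) * P) + 2 * of_real pi * \<i> * of_real w * P))"
      unfolding p p' X_def P_def P'_def of_real_mult of_real_diff of_real_power by (simp add: ring_distribs mult_ac)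
    also have "\<dots> = X * (of_real (R + l * (a + y)) * P - of_real (1 / (2 * pi)) * P')"
      using l by (simp add: field_simps power2_eq_square)
    also have "\<dots> = of_real (poly (hermite_poly (Suc n)) (R + l * (a + y)) * exp (- pi * (l * (a + y))\<^sup>2)) * cis2pi ((a + y) * w)"
      unfolding X_def P_def P'_def by (simp add: mult_ac)
    finally show ?thesis .
  qed
  ultimately show ?case by simp
qed

section \<open>Absolutely summable double series\<close>

lemma abs_summable_on_infsum_iterated:
  fixes f :: "'a \<times> 'b \<Rightarrow> 'c :: banach"
  assumes "(\<lambda>p. norm (f p)) summable_on UNIV"
  shows "infsum f UNIV = (\<Sum>\<^sub>\<infinity>x. \<Sum>\<^sub>\<infinity>y. f (x, y))"
proof -
  have "f summable_on (UNIV \<times> UNIV)" using abs_summable_summable[OF assms] by simp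
  then have "(\<lambda>(x, y). f (x, y)) summable_on (UNIV \<times> UNIV)" by (simp add: case_prod_eta)
  from infsum_Sigma'_banach[OF this] show ?thesis by (simp add: case_prod_eta)
qed

lemma summable_on_shifted_inverse_squares:
  "(\<lambda>m::int. 1 / (1 + (a + real_of_int m)\<^sup>2)) summable_on UNIV"
proof (rule summable_on_comparison_test)
  show "(\<lambda>m::int. (2 + 2 * a\<^sup>2) * (1 / (1 + (real_of_int m)\<^sup>2))) summable_on UNIV"
    by (intro summable_on_cmult_right summable_on_int_inverse_squares)
  fix m :: int
  have "(of_int m)\<^sup>2 \<le> 2 * (a + of_int m)\<^sup>2 + 2 * a\<^sup>2"
    using zero_le_power2[of "of_int m + 2 * a"] by (simp add: power2_eq_square algebra_simps)
  moreover have "0 \<le> a\<^sup>2 * (a + of_int m)\<^sup>2" by simp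
  ultimately have "1 + (of_int m)\<^sup>2 \<le> (2 + 2 * a\<^sup>2) * (1 + (a + of_int m)\<^sup>2)"
    unfolding distrib_left distrib_right by linarith
  moreover have "1 + (real_of_int m)\<^sup>2 > 0" "1 + (a + of_int m)\<^sup>2 > 0" by (simp_all add: add_pos_nonneg)
  ultimately show "1 / (1 + (a + of_int m)\<^sup>2) \<le> (2 + 2 * a\<^sup>2) * (1 / (1 + (real_of_int m)\<^sup>2))"
    by (simp add: field_simps)
qed auto

lemma summable_on_shifted_inverse_squares_2:
  "(\<lambda>(m::int, k::int). C * (1 / (1 + (a + real_of_int m)\<^sup>2) * (1 / (1 + (b + real_of_int k)\<^sup>2)))) summable_on UNIV"
proof -
  have "(\<lambda>(m::int, k::int). 1 / (1 + (a + real_of_int m)\<^sup>2) * (1 / (1 + (b + real_of_int k)\<^sup>2))) summable_on (UNIV \<times> UNIV)"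
  proof (rule summable_on_SigmaI)
    fix m :: int
    show "((\<lambda>k::int. case (m, k) of (m, k) \<Rightarrow> 1 / (1 + (a + real_of_int m)\<^sup>2) * (1 / (1 + (b + real_of_int k)\<^sup>2))) has_sum
       (1 / (1 + (a + real_of_int m)\<^sup>2) * (\<Sum>\<^sub>\<infinity>k::int. 1 / (1 + (b + real_of_int k)\<^sup>2)))) UNIV"
      unfolding prod.case
      by (intro has_sum_cmult_right has_sum_infsum summable_on_shifted_inverse_squares)
    show "(\<lambda>m::int. 1 / (1 + (a + real_of_int m)\<^sup>2) * (\<Sum>\<^sub>\<infinity>k::int. 1 / (1 + (b + real_of_int k)\<^sup>2))) summable_on UNIV"
      by (rule summable_on_cmult_left, rule summable_on_shifted_inverse_squares)
  qed auto
  from summable_on_cmult_right[OF this, of C] show ?thesis by (simp add: case_prod_unfold)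
qed

text \<open>The character \<open>\<xi>\<close> shifts the dual lattice, and the shift
  \<open>a\<close> of the lattice becomes a character on the dual side.\<close>

lemma hermite_poisson:
  fixes l a R \<xi> :: real
  assumes l: "l > 0"
  shows "(\<Sum>\<^sub>\<infinity>m::int. of_real (poly (hermite_poly n) (R + l * (a + of_int m)) * exp (- pi * (l * (a + of_int m))\<^sup>2)) * cis2pi ((a + of_int m) * \<xi>))
    = (\<Sum>\<^sub>\<infinity>k::int. (of_real R + \<i> * of_real ((\<xi> + of_int k) / l)) ^ n *
          of_real (exp (- pi * ((\<xi> + of_int k) / l)\<^sup>2) / l) * cis2pi (- (a * of_int k)))"
proof -
  define p where "p = hermite_poly n \<circ>\<^sub>p [:R, l:]"
  have p: "poly p y = poly (hermite_poly n) (R + l * y)" for y by (simp add: p_def poly_pcompose mult.commute)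
  let ?\<phi> = "\<lambda>y. of_real (poly p (a + y) * exp (- pi * (l * (a + y))\<^sup>2)) * cis2pi ((a + y) * \<xi>)"
  let ?\<phi>' = "\<lambda>y. of_real ((poly (pderiv p) (a + y) - 2 * pi * l\<^sup>2 * (a + y) * poly p (a + y)) * exp (- pi * (l * (a + y))\<^sup>2))
         * cis2pi ((a + y) * \<xi>)
       + 2 * of_real pi * \<i> * of_real \<xi> * (of_real (poly p (a + y) * exp (- pi * (l * (a + y))\<^sup>2)) * cis2pi ((a + y) * \<xi>))"
  let ?\<psi> = "\<lambda>k::int. (of_real R + \<i> * of_real ((\<xi> + of_int k) / l)) ^ n *
          of_real (exp (- pi * ((\<xi> + of_int k) / l)\<^sup>2) / l) * cis2pi (- (a * of_int k))"
  obtain C where C: "\<And>y. \<bar>poly p (a + y)\<bar> * exp (- pi * (l * (a + y))\<^sup>2) \<le> C / (1 + y\<^sup>2)"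
    using hermite_gaussian_bound[OF l, of p a] by blast
  define p' where "p' = pderiv p - smult (2 * pi * l\<^sup>2) ([:0, 1:] * p)"
  obtain C' where C': "\<And>y. \<bar>poly p' (a + y)\<bar> * exp (- pi * (l * (a + y))\<^sup>2) \<le> C' / (1 + y\<^sup>2)"
    using hermite_gaussian_bound[OF l, of p' a] by blast
  have C0: "0 \<le> C" "0 \<le> C'" using order_trans[OF _ C[of 0], of 0] order_trans[OF _ C'[of 0], of 0] by auto
  define K where "K = C + C' + 2 * pi * \<bar>\<xi>\<bar> * C"
  have K: "C \<le> K" "C' + 2 * pi * \<bar>\<xi>\<bar> * C \<le> K" using C0 by (auto simp: K_def)
  have b: "norm (?\<phi> y) \<le> C / (1 + y\<^sup>2)" for y using C[of y] by (simp add: norm_mult abs_mult)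
  have b': "norm (?\<phi>' y) \<le> (C' + 2 * pi * \<bar>\<xi>\<bar> * C) / (1 + y\<^sup>2)" for y
  proof -
    have pp: "poly (pderiv p) (a + y) - 2 * pi * l\<^sup>2 * (a + y) * poly p (a + y) = poly p' (a + y)"
      by (simp add: p'_def algebra_simps)
    have "norm (?\<phi>' y) \<le> \<bar>poly p' (a + y)\<bar> * exp (- pi * (l * (a + y))\<^sup>2) + 2 * pi * \<bar>\<xi>\<bar> * norm (?\<phi> y)"
      unfolding pp by (rule order_trans[OF norm_triangle_ineq]) (simp add: norm_mult abs_mult)
    also have "\<dots> \<le> C' / (1 + y\<^sup>2) + 2 * pi * \<bar>\<xi>\<bar> * (C / (1 + y\<^sup>2))"
      by (intro add_mono mult_left_mono b C') auto
    finally show ?thesis by (simp add: add_divide_distrib)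
  qed
  have sm: "?\<psi> summable_on UNIV"
  proof -
    \<comment> \<open>A real polynomial dominating the n-th power of the complex factor, since
      \<open>norm (R + i t) \<le> 1 + R\<^sup>2 + t\<^sup>2\<close>.\<close>
    define q where "q = ([:1 + R\<^sup>2, 0, 1:] ^ n) \<circ>\<^sub>p [:0, 1 / l:]"
    have q: "poly q t = (1 + R\<^sup>2 + (t / l)\<^sup>2) ^ n" for t
      by (simp add: q_def poly_pcompose poly_power power2_eq_square mult.commute)
    obtain D where D: "\<And>y. \<bar>poly q (\<xi> + y)\<bar> * exp (- pi * (1 / l * (\<xi> + y))\<^sup>2) \<le> D / (1 + y\<^sup>2)"
      using hermite_gaussian_bound[of "1 / l" q \<xi>] l by auto
    show ?thesis
    proof (rule abs_summable_summable, rule Infinite_Sum.abs_summable_on_comparison_test')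
      show "(\<lambda>k::int. D / l * (1 / (1 + (real_of_int k)\<^sup>2))) summable_on UNIV"
        by (intro summable_on_cmult_right summable_on_int_inverse_squares)
      fix k :: int
      define t where "t = (\<xi> + of_int k) / l"
      have "norm (of_real R + \<i> * of_real t) \<le> 1 + R\<^sup>2 + t\<^sup>2"
      proof -
        have n2: "(norm (of_real R + \<i> * of_real t))\<^sup>2 = R\<^sup>2 + t\<^sup>2" by (simp add: cmod_power2)
        have "2 * norm (of_real R + \<i> * of_real t) \<le> (norm (of_real R + \<i> * of_real t))\<^sup>2 + 1"
          using zero_le_power2[of "norm (of_real R + \<i> * of_real t) - 1"] unfolding power2_diff by simp
        then show ?thesis
          using n2 zero_le_power2[of R] zero_le_power2[of t] by linarith
      qed
      then have "norm (of_real R + \<i> * of_real t) ^ n \<le> poly q (\<xi> + of_int k)"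
        unfolding q t_def[symmetric] by (intro power_mono) auto
      then have "norm (?\<psi> k) \<le> \<bar>poly q (\<xi> + of_int k)\<bar> * exp (- pi * (1 / l * (\<xi> + of_int k))\<^sup>2) / l"
        using l by (simp add: norm_mult norm_power norm_divide t_def[symmetric] field_simps)
          (simp add: t_def field_simps)?
      also have "\<dots> \<le> D / (1 + (of_int k)\<^sup>2) / l" using l by (intro divide_right_mono D) auto
      finally show "norm (?\<psi> k) \<le> D / l * (1 / (1 + (of_int k)\<^sup>2))" by (simp add: mult.commute)
    qed
  qed
  \<comment> \<open>The coefficient against \<open>cis2pi (- (k * y))\<close> is the transform at
    \<open>\<xi> - k\<close>, so the dual sum has to be reflected to run over
    \<open>\<xi> + k\<close>.\<close>
  have bij: "bij (uminus :: int \<Rightarrow> int)" by (rule bij_uminus)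
  have "(\<Sum>\<^sub>\<infinity>m. ?\<phi> (of_int m)) = (\<Sum>\<^sub>\<infinity>k. ?\<psi> (- k))"
  proof (rule poisson_summation[where C = K, OF has_vector_derivative_poly_gaussian])
    show "norm (?\<phi> y) \<le> K / (1 + y\<^sup>2)" for y
      by (rule order_trans[OF b]) (intro divide_right_mono K, simp)
    show "norm (?\<phi>' y) \<le> K / (1 + y\<^sup>2)" for y
      by (rule order_trans[OF b']) (intro divide_right_mono K, simp)
    show "(\<lambda>k. ?\<psi> (- k)) summable_on UNIV"
      using summable_on_reindex_bij_betw[OF bij, of ?\<psi>] sm by simp
    fix k :: int
    from has_integral_mult_left[OF hermite_gaussian_fourier[OF l, of n R a "\<xi> + of_int (- k)"], of "cis2pi (a * of_int k)"]
    show "((\<lambda>y. ?\<phi> y * cis2pi (- (of_int k * y))) has_integral ?\<psi> (- k)) UNIV"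
    proof (rule has_integral_eq_rhs[OF has_integral_eq[rotated]])
      fix y :: real
      have "cis2pi ((a + y) * (\<xi> + of_int (- k))) * cis2pi (a * of_int k) = cis2pi ((a + y) * \<xi>) * cis2pi (- (of_int k * y))"
        by (simp add: cis2pi_add[symmetric] algebra_simps)
      then show "of_real (poly (hermite_poly n) (R + l * (a + y)) * exp (- pi * (l * (a + y))\<^sup>2)) * cis2pi ((a + y) * (\<xi> + of_int (- k))) * cis2pi (a * of_int k)
          = ?\<phi> y * cis2pi (- (of_int k * y))" unfolding p by (simp only: mult.assoc)
    qed simp
  qed
  also have "\<dots> = (\<Sum>\<^sub>\<infinity>k. ?\<psi> k)" by (rule infsum_reindex_bij_betw[OF bij])
  finally show ?thesis unfolding p .
qed

section \<open>Positive definite kernels\<close>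

text \<open>The summand of a Siegel theta series for the form \<open>x y\<close>. The modulus
  \<open>exp (- 2 pi x y Im \<tau>)\<close> of the q-power cancels the cross term of
  \<open>(r x - y / r)\<^sup>2\<close>, which leaves a definite quadratic form in the exponent. The
  Hermite polynomial sees only \<open>r x + y / r\<close>, the coordinate whose square enters
  \<open>x y\<close> with positive sign.\<close>

definition gauss_kernel :: "nat \<Rightarrow> real \<Rightarrow> complex \<Rightarrow> real \<Rightarrow> real \<Rightarrow> real \<Rightarrow> real \<Rightarrow> complex" where
  "gauss_kernel n r \<tau> b1 b2 x y =
     of_real (poly (hermite_poly n) (sqrt (Im \<tau>) * (r * x + y / r)) * exp (- pi * Im \<tau> * ((r * x)\<^sup>2 + (y / r)\<^sup>2))) *
     cis2pi (Re \<tau> * x * y + x * b2 + y * b1)"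

text \<open>One constant for all \<open>r\<close> in a compact interval and for all phases, as
  required for summing under the integral over the path. The lower end of the interval controls
  \<open>r x\<close>, the upper end \<open>y / r\<close>.\<close>

lemma gauss_kernel_bound:
  assumes v: "Im \<tau> > 0" and m: "0 < m"
  shows "\<exists>C\<ge>0. \<forall>r\<in>{m..M}. \<forall>x y b1 b2. norm (gauss_kernel n r \<tau> b1 b2 x y) \<le> C * (1 / (1 + x\<^sup>2) * (1 / (1 + y\<^sup>2)))"
proof (cases "m \<le> M")
  case False
  then show ?thesis by (intro exI[of _ 0]) auto
next
  case True
  then have M: "M > 0" using m by simp
  let ?v = "Im \<tau>"
  \<comment> \<open>The squared argument is at most \<open>2 * X\<close>, so \<open>pi / 4\<close>
    spends exactly half of \<open>exp (- pi * X)\<close> on the polynomial.\<close>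
  obtain K where K: "K \<ge> 0" "\<And>s. \<bar>poly (hermite_poly n) s\<bar> \<le> K * exp (pi / 4 * s\<^sup>2)"
    using poly_exp_square_bound[of "pi / 4" "hermite_poly n"] by auto
  define c where "c = pi / 2 * ?v * m\<^sup>2"
  define d where "d = pi / 2 * ?v / M\<^sup>2"
  have cd: "c > 0" "d > 0" using v m M by (auto simp: c_def d_def)
  define C where "C = K * ((1 + 1 / c) * (1 + 1 / d))"
  have "norm (gauss_kernel n r \<tau> b1 b2 x y) \<le> C * (1 / (1 + x\<^sup>2) * (1 / (1 + y\<^sup>2)))" if r: "r \<in> {m..M}" for r x y b1 b2
  proof -
    have r0: "r > 0" using r m by auto
    define X where "X = ?v * ((r * x)\<^sup>2 + (y / r)\<^sup>2)"
    have s: "(sqrt ?v * (r * x + y / r))\<^sup>2 \<le> 2 * X"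
    proof -
      have "(r * x + y / r)\<^sup>2 \<le> 2 * ((r * x)\<^sup>2 + (y / r)\<^sup>2)"
        using zero_le_power2[of "r * x - y / r"] by (simp add: power2_sum power2_diff)
      from mult_left_mono[OF this, of ?v] v show ?thesis by (simp add: X_def power_mult_distrib)
    qed
    have "norm (gauss_kernel n r \<tau> b1 b2 x y) = \<bar>poly (hermite_poly n) (sqrt ?v * (r * x + y / r))\<bar> * exp (- pi * X)"
      by (simp add: gauss_kernel_def norm_mult abs_mult X_def mult.assoc)
    also have "\<dots> \<le> (K * exp (pi / 4 * (2 * X))) * exp (- pi * X)"
    proof (rule mult_right_mono)
      have "\<bar>poly (hermite_poly n) (sqrt ?v * (r * x + y / r))\<bar> \<le> K * exp (pi / 4 * (sqrt ?v * (r * x + y / r))\<^sup>2)" by (rule K)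
      also have "\<dots> \<le> K * exp (pi / 4 * (2 * X))" using s K by (intro mult_left_mono) auto
      finally show "\<bar>poly (hermite_poly n) (sqrt ?v * (r * x + y / r))\<bar> \<le> K * exp (pi / 4 * (2 * X))" .
    qed simp
    also have "\<dots> = K * exp (- (pi / 2 * X))"
      unfolding mult.assoc exp_add[symmetric] by (simp add: field_simps)
    also have "\<dots> \<le> K * exp (- (c * x\<^sup>2) + - (d * y\<^sup>2))"
    proof -
      have "m\<^sup>2 * x\<^sup>2 \<le> (r * x)\<^sup>2" unfolding power_mult_distrib
        using r m by (intro mult_right_mono power_mono) auto
      moreover have "y\<^sup>2 / M\<^sup>2 \<le> (y / r)\<^sup>2" unfolding power_divide
        using r m r0 M by (intro divide_left_mono power_mono) auto
      ultimately have "m\<^sup>2 * x\<^sup>2 + y\<^sup>2 / M\<^sup>2 \<le> (r * x)\<^sup>2 + (y / r)\<^sup>2" by simp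
      from mult_left_mono[OF this, of "pi / 2 * ?v"] v
      have "pi / 2 * X \<ge> c * x\<^sup>2 + d * y\<^sup>2" by (simp add: X_def c_def d_def algebra_simps)
      then show ?thesis using K by (intro mult_left_mono) auto
    qed
    also have "\<dots> \<le> K * (((1 + 1 / c) / (1 + x\<^sup>2)) * ((1 + 1 / d) / (1 + y\<^sup>2)))"
      unfolding exp_add using cd K by (intro mult_left_mono mult_mono exp_minus_square_le) auto
    finally show ?thesis by (simp add: C_def mult_ac)
  qed
  moreover have "C \<ge> 0" using K cd by (simp add: C_def)
  ultimately show ?thesis by blast
qed

lemma gauss_kernel_abs_summable:
  assumes v: "Im \<tau> > 0" and r: "r > 0"
  shows "(\<lambda>(m::int, k::int). norm (gauss_kernel n r \<tau> b1 b2 (a1 + of_int m) (a2 + of_int k))) summable_on UNIV"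
proof -
  obtain C where C': "\<forall>s\<in>{r..r}. \<forall>x y b1 b2. norm (gauss_kernel n s \<tau> b1 b2 x y) \<le> C * (1 / (1 + x\<^sup>2) * (1 / (1 + y\<^sup>2)))"
    using gauss_kernel_bound[OF v r, of r n] by blast
  have C: "norm (gauss_kernel n r \<tau> b1 b2 x y) \<le> C * (1 / (1 + x\<^sup>2) * (1 / (1 + y\<^sup>2)))" for x y
    by (rule C'[rule_format]) simp
  show ?thesis
  proof (rule summable_on_comparison_test[OF summable_on_shifted_inverse_squares_2[of C a1 a2]])
    fix p :: "int \<times> int"
    show "(case p of (m, k) \<Rightarrow> norm (gauss_kernel n r \<tau> b1 b2 (a1 + of_int m) (a2 + of_int k))) \<le>
       (case p of (m, k) \<Rightarrow> C * (1 / (1 + (a1 + real_of_int m)\<^sup>2) * (1 / (1 + (a2 + real_of_int k)\<^sup>2))))"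
      unfolding case_prod_unfold by (rule C)
  qed auto
qed

definition gauss_kernel_hat :: "nat \<Rightarrow> real \<Rightarrow> complex \<Rightarrow> real \<Rightarrow> real \<Rightarrow> complex" where
  "gauss_kernel_hat n r \<tau> x \<eta> = (\<i> * of_real (r / sqrt (Im \<tau>)) * (cnj \<tau> * of_real x + of_real \<eta>)) ^ n *
     of_real (exp (- pi * r\<^sup>2 * (norm (\<tau> * of_real x + of_real \<eta>))\<^sup>2 / Im \<tau>))"

text \<open>For fixed \<open>x\<close> the phase \<open>Re \<tau> x y\<close> is a frequency shift
  in \<open>y\<close>, so the dual variable is \<open>Re \<tau> x + \<eta>\<close>. The Gaussian in
  \<open>x\<close> and the offset \<open>R\<close> supply the missing \<open>Im \<tau> x\<close>:
  the former completes the exponent to the squared norm of \<open>\<tau> x + \<eta>\<close>, the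
  latter completes the power to \<open>cnj \<tau> x + \<eta>\<close>.\<close>

lemma gauss_kernel_poisson:
  assumes v: "Im \<tau> > 0" and r: "r > 0"
  shows "(\<Sum>\<^sub>\<infinity>k::int. gauss_kernel n r \<tau> b1 b2 x (a2 + of_int k)) =
    of_real (r / sqrt (Im \<tau>)) * (\<Sum>\<^sub>\<infinity>k::int. gauss_kernel_hat n r \<tau> x (b1 + of_int k) * cis2pi (x * b2 - a2 * of_int k))"
proof -
  let ?v = "Im \<tau>" and ?u = "Re \<tau>"
  define l where "l = sqrt ?v / r"
  have l: "l > 0" using v r by (simp add: l_def)
  define R where "R = sqrt ?v * r * x"
  define \<xi> where "\<xi> = ?u * x + b1"
  have sv: "(sqrt ?v)\<^sup>2 = ?v" using v by simp
  have l2: "l\<^sup>2 = ?v / r\<^sup>2" by (simp add: l_def power_divide sv)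
  let ?A = "of_real (exp (- pi * ?v * (r * x)\<^sup>2)) * cis2pi (x * b2)"
  have "gauss_kernel n r \<tau> b1 b2 x y = ?A * (of_real (poly (hermite_poly n) (R + l * y) * exp (- pi * (l * y)\<^sup>2)) * cis2pi (y * \<xi>))" for y
  proof -
    have 1: "sqrt ?v * (r * x + y / r) = R + l * y" by (simp add: R_def l_def algebra_simps)
    have "- pi * ?v * ((r * x)\<^sup>2 + (y / r)\<^sup>2) = - pi * ?v * (r * x)\<^sup>2 + - pi * (l * y)\<^sup>2"
      by (simp add: power_mult_distrib power_divide l2 algebra_simps)
    then have 2: "exp (- pi * ?v * ((r * x)\<^sup>2 + (y / r)\<^sup>2)) = exp (- pi * ?v * (r * x)\<^sup>2) * exp (- pi * (l * y)\<^sup>2)"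
      by (simp only: exp_add)
    have 3: "cis2pi (?u * x * y + x * b2 + y * b1) = cis2pi (x * b2) * cis2pi (y * \<xi>)"
      by (simp add: \<xi>_def cis2pi_add[symmetric] algebra_simps)
    show ?thesis unfolding gauss_kernel_def 1 2 3 by (simp only: of_real_mult mult_ac)
  qed
  then have "(\<Sum>\<^sub>\<infinity>k::int. gauss_kernel n r \<tau> b1 b2 x (a2 + of_int k)) =
     ?A * (\<Sum>\<^sub>\<infinity>k::int. of_real (poly (hermite_poly n) (R + l * (a2 + of_int k)) * exp (- pi * (l * (a2 + of_int k))\<^sup>2)) * cis2pi ((a2 + of_int k) * \<xi>))"
    by (simp only: infsum_cmult_right')
  also have "\<dots> = (\<Sum>\<^sub>\<infinity>k::int. ?A * ((of_real R + \<i> * of_real ((\<xi> + of_int k) / l)) ^ n *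
          of_real (exp (- pi * ((\<xi> + of_int k) / l)\<^sup>2) / l) * cis2pi (- (a2 * of_int k))))"
    unfolding hermite_poisson[OF l] by (simp only: infsum_cmult_right')
  also have "\<dots> = (\<Sum>\<^sub>\<infinity>k::int. of_real (r / sqrt ?v) * (gauss_kernel_hat n r \<tau> x (b1 + of_int k) * cis2pi (x * b2 - a2 * of_int k)))"
  proof (rule infsum_cong)
    fix k :: int
    define \<eta> where "\<eta> = b1 + of_int k"
    have e: "\<xi> + of_int k = ?u * x + \<eta>" by (simp add: \<xi>_def \<eta>_def)
    have 1: "of_real R + \<i> * of_real ((?u * x + \<eta>) / l) = \<i> * of_real (r / sqrt ?v) * (cnj \<tau> * of_real x + of_real \<eta>)"
      using v r sv by (simp add: complex_eq_iff R_def l_def field_simps power2_eq_square)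
    have N: "(norm (\<tau> * of_real x + of_real \<eta>))\<^sup>2 = (?u * x + \<eta>)\<^sup>2 + (?v * x)\<^sup>2"
      by (simp add: cmod_power2)
    have A: "(X / l)\<^sup>2 = X\<^sup>2 * r\<^sup>2 / ?v" for X by (simp add: power_divide l2)
    have "- pi * r\<^sup>2 * (X\<^sup>2 + (?v * x)\<^sup>2) / ?v = - pi * ?v * (r * x)\<^sup>2 + - pi * (X\<^sup>2 * r\<^sup>2 / ?v)" for X
      using v by (simp add: field_simps power2_eq_square)
    then have "- pi * r\<^sup>2 * (norm (\<tau> * of_real x + of_real \<eta>))\<^sup>2 / ?v = - pi * ?v * (r * x)\<^sup>2 + - pi * ((?u * x + \<eta>) / l)\<^sup>2"
      unfolding N A .
    then have 2: "exp (- pi * r\<^sup>2 * (norm (\<tau> * of_real x + of_real \<eta>))\<^sup>2 / ?v) = exp (- pi * ?v * (r * x)\<^sup>2) * exp (- pi * ((?u * x + \<eta>) / l)\<^sup>2)"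
      by (simp only: exp_add)
    have 3: "cis2pi (x * b2 - a2 * of_int k) = cis2pi (x * b2) * cis2pi (- (a2 * of_int k))" by (simp add: cis2pi_add[symmetric])
    have 4: "X / l = r / sqrt ?v * X" for X by (simp add: l_def)
    show "?A * ((of_real R + \<i> * of_real ((\<xi> + of_int k) / l)) ^ n *
          of_real (exp (- pi * ((\<xi> + of_int k) / l)\<^sup>2) / l) * cis2pi (- (a2 * of_int k))) =
      of_real (r / sqrt ?v) * (gauss_kernel_hat n r \<tau> x (b1 + of_int k) * cis2pi (x * b2 - a2 * of_int k))"
      unfolding e \<eta>_def[symmetric] gauss_kernel_hat_def 1 2 3 4[of "exp _"] by (simp only: of_real_mult mult_ac)
  qed
  finally show ?thesis by (simp only: infsum_cmult_right')
qed

text \<open>\<open>(norm (\<tau> x + \<eta>))\<^sup>2\<close> is a definite quadratic form in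
  \<open>x\<close> and \<eta>. Summability of the transformed kernel is what permits the exchange of
  the two sums in the inversion formula.\<close>

lemma gauss_kernel_hat_abs_summable:
  assumes v: "Im \<tau> > 0" and r: "r > 0"
  shows "(\<lambda>(m::int, k::int). norm (gauss_kernel_hat n r \<tau> (a + of_int m) (b + of_int k))) summable_on UNIV"
proof -
  let ?v = "Im \<tau>" and ?u = "Re \<tau>"
  define c where "c = pi * r\<^sup>2 / ?v"
  have c: "c > 0" using v r by (simp add: c_def)
  obtain K where K: "K \<ge> 0" "\<And>s. \<bar>poly (monom 1 n) s\<bar> \<le> K * exp (c / 2 * s\<^sup>2)"
    using poly_exp_square_bound[of "c / 2" "monom 1 n"] c by auto
  \<comment> \<open>From \<open>\<eta>\<^sup>2 \<le> 2 (u x + \<eta>)\<^sup>2 + 2 u\<^sup>2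
    x\<^sup>2\<close>: the summand 2 pays for the first term, the quotient turns
    \<open>(1 + 2 u\<^sup>2) x\<^sup>2\<close> into a multiple of
    \<open>(v x)\<^sup>2\<close>.\<close>
  define L where "L = (1 + 2 * ?u\<^sup>2) / ?v\<^sup>2 + 2"
  have L: "L > 0" by (simp add: L_def add_nonneg_pos)
  define e where "e = c / 2 / L"
  have e: "e > 0" using c L by (simp add: e_def)
  define A where "A = (r / sqrt ?v) ^ n"
  have A: "A \<ge> 0" using v r by (simp add: A_def)
  define C where "C = A * K * ((1 + 1 / e) * (1 + 1 / e))"
  have "norm (gauss_kernel_hat n r \<tau> x \<eta>) \<le> C * (1 / (1 + x\<^sup>2) * (1 / (1 + \<eta>\<^sup>2)))" for x \<eta>
  proof -
    define z where "z = norm (\<tau> * of_real x + of_real \<eta>)"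
    have cn: "norm (cnj \<tau> * of_real x + of_real \<eta>) = z"
      using complex_mod_cnj[of "\<tau> * of_real x + of_real \<eta>"] by (simp add: z_def)
    have z2: "z\<^sup>2 = (?u * x + \<eta>)\<^sup>2 + (?v * x)\<^sup>2" by (simp add: z_def cmod_power2)
    have "x\<^sup>2 + \<eta>\<^sup>2 \<le> L * z\<^sup>2"
    proof -
      have "\<eta>\<^sup>2 \<le> 2 * (?u * x + \<eta>)\<^sup>2 + 2 * (?u * x)\<^sup>2"
        using zero_le_power2[of "2 * (?u * x) + \<eta>"] by (simp add: power2_eq_square algebra_simps)
      moreover have "(1 + 2 * ?u\<^sup>2) * x\<^sup>2 = (1 + 2 * ?u\<^sup>2) / ?v\<^sup>2 * (?v * x)\<^sup>2"
        using v by (simp add: power_mult_distrib)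
      moreover have "(1 + 2 * ?u\<^sup>2) / ?v\<^sup>2 * (?u * x + \<eta>)\<^sup>2 \<ge> 0" "(?v * x)\<^sup>2 \<ge> 0" by auto
      ultimately show ?thesis unfolding L_def z2 distrib_left distrib_right power_mult_distrib by linarith
    qed
    from mult_left_mono[OF this, of e] have ez: "e * (x\<^sup>2 + \<eta>\<^sup>2) \<le> c / 2 * z\<^sup>2" using e L by (simp add: e_def)
    have "norm (gauss_kernel_hat n r \<tau> x \<eta>) = A * (z ^ n * exp (- (c * z\<^sup>2)))"
      using v r by (simp add: gauss_kernel_hat_def norm_mult norm_power norm_divide cn z_def[symmetric] A_def c_def power_mult_distrib power_divide)
    also have "\<dots> \<le> A * (K * exp (c / 2 * z\<^sup>2) * exp (- (c * z\<^sup>2)))"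
      using K(2)[of z] A by (intro mult_left_mono mult_right_mono) (auto simp: z_def poly_monom)
    also have "\<dots> = A * (K * exp (- (c / 2 * z\<^sup>2)))" 
      unfolding mult.assoc exp_add[symmetric] by (simp add: field_simps)
    also have "\<dots> \<le> A * (K * exp (- (e * x\<^sup>2) + - (e * \<eta>\<^sup>2)))"
      using ez A K by (intro mult_left_mono) (auto simp: algebra_simps)
    also have "\<dots> \<le> A * (K * (((1 + 1 / e) / (1 + x\<^sup>2)) * ((1 + 1 / e) / (1 + \<eta>\<^sup>2))))"
      unfolding exp_add using e A K by (intro mult_left_mono mult_mono exp_minus_square_le) auto
    finally show ?thesis by (simp add: C_def mult_ac)
  qed
  then show ?thesis
    by (intro summable_on_comparison_test[OF summable_on_shifted_inverse_squares_2[of C a b]]) auto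
qed

lemma Im_inversion: "Im (- 1 / \<tau>) = Im \<tau> / (norm \<tau>)\<^sup>2"
  by (simp add: Im_divide cmod_power2)

text \<open>Since \<open>- x / \<tau> + \<eta>\<close> is
  \<open>- (x - \<tau> \<eta>) / \<tau>\<close>, its squared norm scales exactly like the imaginary
  part and the exponent is unchanged. In the power, \<open>1 / cnj \<tau>\<close> meets
  \<open>norm \<tau>\<close> from the square root of the imaginary part, which leaves one phase per
  degree.\<close>

lemma gauss_kernel_hat_inversion:
  assumes v: "Im \<tau> > 0" and r: "r > 0"
  shows "gauss_kernel_hat n r (- 1 / \<tau>) x \<eta> = (- of_real (norm \<tau>) / cnj \<tau>) ^ n * gauss_kernel_hat n r \<tau> (- \<eta>) x"
proof -
  have t0: "\<tau> \<noteq> 0" using v by auto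
  have sq: "sqrt (Im (- 1 / \<tau>)) = sqrt (Im \<tau>) / norm \<tau>" by (simp only: Im_inversion real_sqrt_divide real_sqrt_abs abs_norm_cancel)
  have 1: "\<i> * of_real (r / sqrt (Im (- 1 / \<tau>))) * (cnj (- 1 / \<tau>) * of_real x + of_real \<eta>) =
     (- of_real (norm \<tau>) / cnj \<tau>) * (\<i> * of_real (r / sqrt (Im \<tau>)) * (cnj \<tau> * of_real (- \<eta>) + of_real x))"
    unfolding sq using t0 v by (simp add: field_simps)
  have "- 1 / \<tau> * of_real x + of_real \<eta> = - ((\<tau> * of_real (- \<eta>) + of_real x) / \<tau>)"
    using t0 by (simp add: field_simps)
  then have "norm (- 1 / \<tau> * of_real x + of_real \<eta>) = norm ((\<tau> * of_real (- \<eta>) + of_real x) / \<tau>)"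
    by (simp only: norm_minus_cancel)
  then have 2: "- pi * r\<^sup>2 * (norm (- 1 / \<tau> * of_real x + of_real \<eta>))\<^sup>2 / Im (- 1 / \<tau>) =
     - pi * r\<^sup>2 * (norm (\<tau> * of_real (- \<eta>) + of_real x))\<^sup>2 / Im \<tau>"
    unfolding Im_inversion using t0 v by (simp add: norm_divide power_divide)
  show ?thesis unfolding gauss_kernel_hat_def 1 2 power_mult_distrib[of "- of_real (norm \<tau>) / cnj \<tau>"] by (simp only: mult.assoc)
qed

text \<open>Both sides are brought to the partially transformed form. The factor
  \<open>norm \<tau>\<close> is the ratio of the two Poisson prefactors.\<close>

lemma gauss_kernel_sum_inversion:
  assumes v: "Im \<tau> > 0" and r: "r > 0"
  shows "(\<Sum>\<^sub>\<infinity>(m::int, k::int). gauss_kernel n r (- 1 / \<tau>) b1 b2 (a1 + of_int m) (a2 + of_int k)) =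
     of_real (norm \<tau>) * (- of_real (norm \<tau>) / cnj \<tau>) ^ n * cis2pi (a1 * b2 + a2 * b1) *
     (\<Sum>\<^sub>\<infinity>(m::int, k::int). gauss_kernel n r \<tau> a1 a2 (- b1 + of_int m) (- b2 + of_int k))"
proof -
  have t0: "\<tau> \<noteq> 0" using v by auto
  have v': "Im (- 1 / \<tau>) > 0" using Im_inversion[of \<tau>] v t0 by simp
  have sq: "sqrt (Im (- 1 / \<tau>)) = sqrt (Im \<tau>) / norm \<tau>" by (simp only: Im_inversion real_sqrt_divide real_sqrt_abs abs_norm_cancel)
  have iter: "(\<Sum>\<^sub>\<infinity>(m::int, k::int). gauss_kernel n r t c1 c2 (d1 + of_int m) (d2 + of_int k)) =
     of_real (r / sqrt (Im t)) * (\<Sum>\<^sub>\<infinity>m::int. \<Sum>\<^sub>\<infinity>k::int. gauss_kernel_hat n r t (d1 + of_int m) (c1 + of_int k) *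
        cis2pi ((d1 + of_int m) * c2 - d2 * of_int k))" if "Im t > 0" for t c1 c2 d1 d2
  proof -
    have "(\<Sum>\<^sub>\<infinity>(m::int, k::int). gauss_kernel n r t c1 c2 (d1 + of_int m) (d2 + of_int k)) =
       (\<Sum>\<^sub>\<infinity>m::int. \<Sum>\<^sub>\<infinity>k::int. gauss_kernel n r t c1 c2 (d1 + of_int m) (d2 + of_int k))"
    proof -
      have "(\<lambda>p. norm (case p of (m, k) \<Rightarrow> gauss_kernel n r t c1 c2 (d1 + of_int m) (d2 + of_int k))) summable_on UNIV"
        using gauss_kernel_abs_summable[OF that r, of n c1 c2 d1 d2] by (simp only: case_prod_unfold)
      from abs_summable_on_infsum_iterated[OF this] show ?thesis by (simp only: prod.case)
    qed
    then show ?thesis by (simp only: gauss_kernel_poisson[OF that r] infsum_cmult_right')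
  qed
  let ?f = "- of_real (norm \<tau>) / cnj \<tau>"
  let ?g = "\<lambda>k m. gauss_kernel_hat n r \<tau> (- b1 + of_int k) (a1 + of_int m) * cis2pi ((- b1 + of_int k) * a2 - (- b2) * of_int m)"
  have "(\<Sum>\<^sub>\<infinity>m::int. \<Sum>\<^sub>\<infinity>k::int. gauss_kernel_hat n r (- 1 / \<tau>) (a1 + of_int m) (b1 + of_int k) * cis2pi ((a1 + of_int m) * b2 - a2 * of_int k))
     = (\<Sum>\<^sub>\<infinity>m::int. \<Sum>\<^sub>\<infinity>k::int. (?f ^ n * cis2pi (a1 * b2 + a2 * b1)) * ?g (- k) m)"
  proof (intro infsum_cong)
    fix m k :: int
    have e1: "cis2pi ((a1 + of_int m) * b2 - a2 * of_int k) = cis2pi (a1 * b2 + a2 * b1) * cis2pi ((- b1 + of_int (- k)) * a2 - (- b2) * of_int m)"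
      by (simp add: cis2pi_add[symmetric] algebra_simps)
    have e2: "- (b1 + of_int k) = - b1 + of_int (- k)" by simp
    show "gauss_kernel_hat n r (- 1 / \<tau>) (a1 + of_int m) (b1 + of_int k) * cis2pi ((a1 + of_int m) * b2 - a2 * of_int k) =
        (?f ^ n * cis2pi (a1 * b2 + a2 * b1)) * ?g (- k) m"
      unfolding gauss_kernel_hat_inversion[OF v r] e1 e2 by (simp only: mult_ac)
  qed
  also have "\<dots> = ?f ^ n * cis2pi (a1 * b2 + a2 * b1) * (\<Sum>\<^sub>\<infinity>m::int. \<Sum>\<^sub>\<infinity>k::int. ?g (- k) m)"
    by (simp only: infsum_cmult_right')
  \<comment> \<open>The reflection undoes the sign in
    \<open>(x, \<eta>) \<mapsto> (- \<eta>, x)\<close>. The following exchange of sums makes the old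
    frequency the new lattice variable.\<close>
  also have "(\<Sum>\<^sub>\<infinity>m::int. \<Sum>\<^sub>\<infinity>k::int. ?g (- k) m) = (\<Sum>\<^sub>\<infinity>m::int. \<Sum>\<^sub>\<infinity>k::int. ?g k m)"
    by (rule infsum_cong) (rule infsum_reindex_bij_betw[OF bij_uminus])
  also have "\<dots> = (\<Sum>\<^sub>\<infinity>k::int. \<Sum>\<^sub>\<infinity>m::int. ?g k m)"
  proof (rule infsum_swap_banach[symmetric])
    show "(\<lambda>(k, m). ?g k m) summable_on UNIV \<times> UNIV"
      using gauss_kernel_hat_abs_summable[OF v r, of n "- b1" a1]
      by - (rule abs_summable_summable, simp add: case_prod_unfold norm_mult)
  qed
  finally have eq: "(\<Sum>\<^sub>\<infinity>m::int. \<Sum>\<^sub>\<infinity>k::int. gauss_kernel_hat n r (- 1 / \<tau>) (a1 + of_int m) (b1 + of_int k) * cis2pi ((a1 + of_int m) * b2 - a2 * of_int k))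
     = ?f ^ n * cis2pi (a1 * b2 + a2 * b1) * (\<Sum>\<^sub>\<infinity>k::int. \<Sum>\<^sub>\<infinity>m::int. ?g k m)" .
  have sc: "of_real (r / sqrt (Im (- 1 / \<tau>))) = of_real (norm \<tau>) * (of_real (r / sqrt (Im \<tau>)) :: complex)"
    unfolding sq by simp
  show ?thesis unfolding iter[OF v'] iter[OF v] eq sc by (simp only: mult_ac)
qed

section \<open>Theta series of one block\<close>

text \<open>For \<alpha> = \<beta> = 0 this is the derivative of \<open>E (r * x - y / r)\<close> in
  \<open>r\<close>, with inner derivative \<open>(r * x + y / r) / r\<close>, the first Hermite
  polynomial divided by \<open>r\<close>. Each raising of \<alpha> by
  \<open>x - \<partial>\<^sub>y / (4 pi)\<close> multiplies by \<open>1 / (2 r)\<close> and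
  increases the Hermite index; each raising of \<beta> does so with \<open>r / 2\<close>.\<close>

definition J_density :: "nat \<Rightarrow> nat \<Rightarrow> real \<Rightarrow> real \<Rightarrow> real \<Rightarrow> real" where
  "J_density \<alpha> \<beta> r x y = 2 / 2 ^ (\<alpha> + \<beta>) * (r ^ \<beta> / r ^ Suc \<alpha>) * poly (hermite_poly (Suc (\<alpha> + \<beta>))) (r * x + y / r) *
      exp (- pi * (r * x - y / r)\<^sup>2)"

text \<open>
  The straight path from \<open>r\<^sub>1\<close> to \<open>r\<^sub>0\<close> makes the integral oriented, so that no case distinction on
  the order of \<open>r\<^sub>0\<close> and \<open>r\<^sub>1\<close> is needed.
\<close>

definition J_block :: "real \<Rightarrow> real \<Rightarrow> nat \<Rightarrow> nat \<Rightarrow> real \<Rightarrow> real \<Rightarrow> real" where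
  "J_block r0 r1 \<alpha> \<beta> x y = integral {0..1} (\<lambda>t. (r0 - r1) * J_density \<alpha> \<beta> (r1 + t * (r0 - r1)) x y)"

definition theta_block_term :: "real \<Rightarrow> real \<Rightarrow> nat \<Rightarrow> nat \<Rightarrow> complex \<Rightarrow> real \<Rightarrow> real \<Rightarrow> real \<Rightarrow> real \<Rightarrow> complex" where
  "theta_block_term r0 r1 \<alpha> \<beta> \<tau> b1 b2 x y = of_real (J_block r0 r1 \<alpha> \<beta> (sqrt (Im \<tau>) * x) (sqrt (Im \<tau>) * y)) *
     exp (2 * of_real pi * \<i> * of_real (x * y) * \<tau>) * cis2pi (x * b2 + y * b1)"

lemma path_bounds:
  fixes r0 r1 t :: real
  assumes "r0 > 0" "r1 > 0" "t \<in> {0..1}"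
  shows "r1 + t * (r0 - r1) \<in> {min r0 r1..max r0 r1}" "r1 + t * (r0 - r1) > 0"
proof -
  have eq: "r1 + t * (r0 - r1) = (1 - t) * r1 + t * r0" by (simp add: algebra_simps)
  have "(1 - t) * min r0 r1 + t * min r0 r1 \<le> (1 - t) * r1 + t * r0"
    "(1 - t) * r1 + t * r0 \<le> (1 - t) * max r0 r1 + t * max r0 r1"
    using assms by (intro add_mono mult_left_mono; simp)+
  moreover have "(1 - t) * z + t * z = z" for z :: real by (simp add: algebra_simps)
  ultimately show *: "r1 + t * (r0 - r1) \<in> {min r0 r1..max r0 r1}" unfolding eq by simp
  have "min r0 r1 > 0" using assms by simp
  also have "min r0 r1 \<le> r1 + t * (r0 - r1)" using * unfolding atLeastAtMost_iff by (rule conjunct1)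
  finally show "r1 + t * (r0 - r1) > 0" .
qed

lemma continuous_on_J_density [continuous_intros]:
  assumes "continuous_on A f" "continuous_on A g" "continuous_on A h" "\<And>t. t \<in> A \<Longrightarrow> f t \<noteq> 0"
  shows "continuous_on A (\<lambda>t. J_density \<alpha> \<beta> (f t) (g t) (h t))"
  unfolding J_density_def using assms by (intro continuous_intros) auto

text \<open>The speed of the path and the part of \<open>J_density\<close> depending on
  \<open>r\<close> alone; the rest merges with the q-power into \<open>gauss_kernel\<close>.\<close>

definition J_weight :: "real \<Rightarrow> real \<Rightarrow> nat \<Rightarrow> nat \<Rightarrow> real \<Rightarrow> real" where
  "J_weight r0 r1 \<alpha> \<beta> t = (r0 - r1) * (2 / 2 ^ (\<alpha> + \<beta>) * ((r1 + t * (r0 - r1)) ^ \<beta> / (r1 + t * (r0 - r1)) ^ Suc \<alpha>))"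

lemma continuous_on_gauss_kernel [continuous_intros]:
  assumes "continuous_on A f" "\<And>t. t \<in> A \<Longrightarrow> f t \<noteq> 0"
  shows "continuous_on A (\<lambda>t. gauss_kernel n (f t) \<tau> b1 b2 x y)"
  unfolding gauss_kernel_def using assms by (intro continuous_intros) auto

lemma continuous_on_J_weight:
  assumes "r0 > 0" "r1 > 0"
  shows "continuous_on {0..1} (J_weight r0 r1 \<alpha> \<beta>)"
proof -
  have "r1 + t * (r0 - r1) \<noteq> 0" if "t \<in> {0..1}" for t
    using path_bounds(2)[OF assms that] by simp
  then show ?thesis unfolding J_weight_def by (intro continuous_intros) auto
qed

lemma theta_block_term_eq_integral:
  assumes v: "Im \<tau> > 0" and r: "r0 > 0" "r1 > 0"
  shows "theta_block_term r0 r1 \<alpha> \<beta> \<tau> b1 b2 x y =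
    integral {0..1} (\<lambda>t. of_real (J_weight r0 r1 \<alpha> \<beta> t) * gauss_kernel (Suc (\<alpha> + \<beta>)) (r1 + t * (r0 - r1)) \<tau> b1 b2 x y)"
proof -
  let ?v = "Im \<tau>"
  let ?E = "exp (2 * of_real pi * \<i> * of_real (x * y) * \<tau>) * cis2pi (x * b2 + y * b1)"
  let ?h = "\<lambda>t. (r0 - r1) * J_density \<alpha> \<beta> (r1 + t * (r0 - r1)) (sqrt ?v * x) (sqrt ?v * y)"
  have nz: "r1 + t * (r0 - r1) \<noteq> 0" if "t \<in> {0..1}" for t
    using path_bounds(2)[OF r that] by simp
  have "continuous_on {0..1} ?h" using nz by (intro continuous_intros) auto
  then have int: "?h integrable_on {0..1}" by (rule integrable_continuous_real)
  have "of_real (integral {0..1} ?h) = (integral {0..1} (\<lambda>t. of_real (?h t)) :: complex)"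
    using integral_linear[OF int bounded_linear_of_real[where ?'a = complex]] by (simp only: o_def)
  then have "theta_block_term r0 r1 \<alpha> \<beta> \<tau> b1 b2 x y = integral {0..1} (\<lambda>t. of_real (?h t) * ?E)"
    by (simp add: theta_block_term_def J_block_def mult.assoc)
  also have "\<dots> = integral {0..1} (\<lambda>t. of_real (J_weight r0 r1 \<alpha> \<beta> t) * gauss_kernel (Suc (\<alpha> + \<beta>)) (r1 + t * (r0 - r1)) \<tau> b1 b2 x y)"
  proof (rule integral_cong)
    fix t :: real assume t: "t \<in> {0..1}"
    define s where "s = r1 + t * (r0 - r1)"
    have s: "s \<noteq> 0" using nz[OF t] by (simp add: s_def)
    have "- pi * (s * (sqrt ?v * x) - sqrt ?v * y / s)\<^sup>2 = - pi * ?v * ((s * x)\<^sup>2 + (y / s)\<^sup>2) + 2 * pi * ?v * x * y"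
    proof -
      have "(s * (sqrt ?v * x) - sqrt ?v * y / s)\<^sup>2 = (sqrt ?v)\<^sup>2 * (s * x - y / s)\<^sup>2"
        by (simp add: power_mult_distrib[symmetric] algebra_simps)
      also have "\<dots> = ?v * ((s * x)\<^sup>2 + (y / s)\<^sup>2 - 2 * (x * y))"
        using v s by (simp add: power2_diff)
      finally have *: "(s * (sqrt ?v * x) - sqrt ?v * y / s)\<^sup>2 = ?v * ((s * x)\<^sup>2 + (y / s)\<^sup>2 - 2 * (x * y))" .
      show ?thesis unfolding * by (simp add: algebra_simps)
    qed
    moreover have "2 * of_real pi * \<i> * of_real (x * y) * \<tau> =
        of_real (- (2 * pi * ?v * x * y)) + 2 * of_real pi * \<i> * of_real (Re \<tau> * x * y)"
      by (simp add: complex_eq_iff)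
    ultimately have 1: "of_real (exp (- pi * (s * (sqrt ?v * x) - sqrt ?v * y / s)\<^sup>2)) * exp (2 * of_real pi * \<i> * of_real (x * y) * \<tau>) =
        of_real (exp (- pi * ?v * ((s * x)\<^sup>2 + (y / s)\<^sup>2))) * cis2pi (Re \<tau> * x * y)"
      unfolding cis2pi_exp exp_of_real[symmetric] exp_add[symmetric] by (simp only: of_real_add of_real_minus) simp
    have 2: "s * (sqrt ?v * x) + sqrt ?v * y / s = sqrt ?v * (s * x + y / s)" by (simp add: algebra_simps)
    have 3: "cis2pi (Re \<tau> * x * y + x * b2 + y * b1) = cis2pi (Re \<tau> * x * y) * cis2pi (x * b2 + y * b1)"
      by (simp add: cis2pi_add[symmetric] add.assoc)
    have "of_real (?h t) * ?E = of_real (J_weight r0 r1 \<alpha> \<beta> t) * of_real (poly (hermite_poly (Suc (\<alpha> + \<beta>))) (sqrt ?v * (s * x + y / s))) *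
       (of_real (exp (- pi * (s * (sqrt ?v * x) - sqrt ?v * y / s)\<^sup>2)) * exp (2 * of_real pi * \<i> * of_real (x * y) * \<tau>)) * cis2pi (x * b2 + y * b1)"
      unfolding J_density_def J_weight_def s_def[symmetric] 2 by (simp only: of_real_mult mult_ac)
    then show "of_real (?h t) * ?E = of_real (J_weight r0 r1 \<alpha> \<beta> t) * gauss_kernel (Suc (\<alpha> + \<beta>)) (r1 + t * (r0 - r1)) \<tau> b1 b2 x y"
      unfolding 1 gauss_kernel_def s_def[symmetric] 3 by (simp only: of_real_mult mult_ac)
  qed
  finally show ?thesis .
qed

text \<open>The weight is bounded on the compact path and the kernels have a common summable
  majorant, so summation and integration commute.\<close>

lemma theta_block_term_sum:
  assumes v: "Im \<tau> > 0" and r: "r0 > 0" "r1 > 0"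
  shows "(\<lambda>(m::int, k::int). norm (theta_block_term r0 r1 \<alpha> \<beta> \<tau> b1 b2 (a1 + of_int m) (a2 + of_int k))) summable_on UNIV"
    and "(\<Sum>\<^sub>\<infinity>(m::int, k::int). theta_block_term r0 r1 \<alpha> \<beta> \<tau> b1 b2 (a1 + of_int m) (a2 + of_int k)) =
      integral {0..1} (\<lambda>t. of_real (J_weight r0 r1 \<alpha> \<beta> t) *
        (\<Sum>\<^sub>\<infinity>(m::int, k::int). gauss_kernel (Suc (\<alpha> + \<beta>)) (r1 + t * (r0 - r1)) \<tau> b1 b2 (a1 + of_int m) (a2 + of_int k)))"
proof -
  let ?g = "\<lambda>(p::int \<times> int) t. of_real (J_weight r0 r1 \<alpha> \<beta> t) * gauss_kernel (Suc (\<alpha> + \<beta>)) (r1 + t * (r0 - r1)) \<tau> b1 b2 (a1 + of_int (fst p)) (a2 + of_int (snd p))"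
  have nz: "r1 + t * (r0 - r1) \<noteq> 0" if "t \<in> {0..1}" for t
    using path_bounds(2)[OF r that] by simp
  have cont: "continuous_on {0..1} (?g p)" for p
    by (intro continuous_intros continuous_on_J_weight r nz)
  have "min r0 r1 > 0" using r by simp
  from gauss_kernel_bound[OF v this, of "max r0 r1" "Suc (\<alpha> + \<beta>)"] obtain C where C: "C \<ge> 0"
    "\<And>r x y b1 b2. r \<in> {min r0 r1..max r0 r1} \<Longrightarrow> norm (gauss_kernel (Suc (\<alpha> + \<beta>)) r \<tau> b1 b2 x y) \<le> C * (1 / (1 + x\<^sup>2) * (1 / (1 + y\<^sup>2)))"
    by blast
  have "compact (J_weight r0 r1 \<alpha> \<beta> ` {0..1})"
    by (intro compact_continuous_image continuous_on_J_weight r) auto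
  then obtain W where "\<forall>y\<in>J_weight r0 r1 \<alpha> \<beta> ` {0..1}. norm y \<le> W"
    using compact_imp_bounded[of "J_weight r0 r1 \<alpha> \<beta> ` {0..1}"] unfolding bounded_iff by blast
  then have W: "\<bar>J_weight r0 r1 \<alpha> \<beta> t\<bar> \<le> W" if "t \<in> {0..1}" for t
    using that by simp
  have W0: "W \<ge> 0" using W[of 0] by simp
  define M where "M = (\<lambda>(m::int, k::int). (W * C) * (1 / (1 + (a1 + real_of_int m)\<^sup>2) * (1 / (1 + (a2 + real_of_int k)\<^sup>2))))"
  have M: "M summable_on UNIV" unfolding M_def by (rule summable_on_shifted_inverse_squares_2)
  have bound: "norm (?g p t) \<le> M p" if "t \<in> {0..1}" for p t
    unfolding norm_mult M_def case_prod_unfold mult.assoc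
    using W[OF that] W0 C(2)[OF path_bounds(1)[OF r that]] by (intro mult_mono) auto
  have eq: "(\<lambda>(m::int, k::int). theta_block_term r0 r1 \<alpha> \<beta> \<tau> b1 b2 (a1 + of_int m) (a2 + of_int k)) = (\<lambda>p. integral {0..1} (?g p))"
    by (simp only: case_prod_unfold theta_block_term_eq_integral[OF v r])
  have "norm (integral {0..1} (?g p)) \<le> M p" for p
  proof -
    have "norm (integral {0..1} (?g p)) \<le> integral {0..1} (\<lambda>t::real. M p)"
      using bound by (intro integral_norm_bound_integral integrable_continuous_real cont) auto
    then show ?thesis by simp
  qed
  then have "(\<lambda>p. norm (integral {0..1} (?g p))) summable_on UNIV"
    by (intro Infinite_Sum.abs_summable_on_comparison_test'[OF M]) auto
  then show "(\<lambda>(m::int, k::int). norm (theta_block_term r0 r1 \<alpha> \<beta> \<tau> b1 b2 (a1 + of_int m) (a2 + of_int k))) summable_on UNIV"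
    by (simp only: case_prod_unfold theta_block_term_eq_integral[OF v r])
  have "((\<lambda>p. integral {0..1} (?g p)) has_sum integral {0..1} (\<lambda>t. \<Sum>\<^sub>\<infinity>p. ?g p t)) UNIV"
    by (rule has_sum_integral_M_test(1)[OF cont bound M])
  then show "(\<Sum>\<^sub>\<infinity>(m::int, k::int). theta_block_term r0 r1 \<alpha> \<beta> \<tau> b1 b2 (a1 + of_int m) (a2 + of_int k)) =
      integral {0..1} (\<lambda>t. of_real (J_weight r0 r1 \<alpha> \<beta> t) *
        (\<Sum>\<^sub>\<infinity>(m::int, k::int). gauss_kernel (Suc (\<alpha> + \<beta>)) (r1 + t * (r0 - r1)) \<tau> b1 b2 (a1 + of_int m) (a2 + of_int k)))"
    unfolding eq by (simp only: infsumI infsum_cmult_right' case_prod_unfold)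
qed

text \<open>The Hermite degree is constant along the path, so the factor in the inversion of the
  kernels is independent of \<open>t\<close> and leaves the integral.\<close>

theorem theta_block_term_inversion:
  assumes v: "Im \<tau> > 0" and r: "r0 > 0" "r1 > 0"
  shows "(\<Sum>\<^sub>\<infinity>(m::int, k::int). theta_block_term r0 r1 \<alpha> \<beta> (- 1 / \<tau>) b1 b2 (a1 + of_int m) (a2 + of_int k)) =
     of_real (norm \<tau>) * (- of_real (norm \<tau>) / cnj \<tau>) ^ Suc (\<alpha> + \<beta>) * cis2pi (a1 * b2 + a2 * b1) *
     (\<Sum>\<^sub>\<infinity>(m::int, k::int). theta_block_term r0 r1 \<alpha> \<beta> \<tau> a1 a2 (- b1 + of_int m) (- b2 + of_int k))"
proof -
  have t0: "\<tau> \<noteq> 0" using v by auto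
  have v': "Im (- 1 / \<tau>) > 0" using Im_inversion[of \<tau>] v t0 by simp
  let ?c = "of_real (norm \<tau>) * (- of_real (norm \<tau>) / cnj \<tau>) ^ Suc (\<alpha> + \<beta>) * cis2pi (a1 * b2 + a2 * b1)"
  let ?S = "\<lambda>t. \<Sum>\<^sub>\<infinity>(m::int, k::int). gauss_kernel (Suc (\<alpha> + \<beta>)) (r1 + t * (r0 - r1)) \<tau> a1 a2 (- b1 + of_int m) (- b2 + of_int k)"
  have "(\<Sum>\<^sub>\<infinity>(m::int, k::int). theta_block_term r0 r1 \<alpha> \<beta> (- 1 / \<tau>) b1 b2 (a1 + of_int m) (a2 + of_int k)) =
     integral {0..1} (\<lambda>t. ?c * (of_real (J_weight r0 r1 \<alpha> \<beta> t) * ?S t))"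
    unfolding theta_block_term_sum(2)[OF v' r]
  proof (rule integral_cong)
    fix t :: real assume t: "t \<in> {0..1}"
    show "of_real (J_weight r0 r1 \<alpha> \<beta> t) * (\<Sum>\<^sub>\<infinity>(m::int, k::int). gauss_kernel (Suc (\<alpha> + \<beta>)) (r1 + t * (r0 - r1)) (- 1 / \<tau>) b1 b2 (a1 + of_int m) (a2 + of_int k))
       = ?c * (of_real (J_weight r0 r1 \<alpha> \<beta> t) * ?S t)"
      unfolding gauss_kernel_sum_inversion[OF v path_bounds(2)[OF r t]] by (simp only: mult_ac)
  qed
  also have "\<dots> = ?c * integral {0..1} (\<lambda>t. of_real (J_weight r0 r1 \<alpha> \<beta> t) * ?S t)"
    by (rule integral_mult_right)
  finally show ?thesis unfolding theta_block_term_sum(2)[OF v r] .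
qed

section \<open>The completion of a monomial\<close>

lemma has_real_derivative_E: "(E has_real_derivative 2 * exp (- pi * z\<^sup>2)) (at z)"
proof -
  let ?f = "\<lambda>u::real. exp (- pi * u\<^sup>2)"
  define A where "A = \<bar>z\<bar> + 1"
  have A: "- A < z" "z < A" "0 < A" unfolding A_def by linarith+
  have "((\<lambda>u. LBINT y=ereal 0..ereal u. ?f y) has_vector_derivative ?f z) (at z within {- A..A})"
    using A by (intro interval_integral_FTC2 continuous_intros) auto
  then have "((\<lambda>u. LBINT y=0..u. ?f y) has_vector_derivative ?f z) (at z within {- A..A})"
    unfolding zero_ereal_def .
  then have "((\<lambda>u. LBINT y=0..u. ?f y) has_vector_derivative ?f z) (at z)"
    using at_within_Icc_at[OF A(1,2)] by simp
  then have "((\<lambda>u. LBINT y=0..u. ?f y) has_real_derivative ?f z) (at z)"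
    by (simp add: has_real_derivative_iff_has_vector_derivative)
  from DERIV_cmult[OF this, of 2] show ?thesis unfolding E_def[abs_def] .
qed

text \<open>Polynomial factors of the derivatives of \<open>E\<close>, with index shifted by one:
  \<open>E\<close> itself is not a polynomial times a Gaussian.\<close>

primrec E_deriv_poly :: "nat \<Rightarrow> real poly" where
  "E_deriv_poly 0 = [:2:]"
| "E_deriv_poly (Suc k) = pderiv (E_deriv_poly k) - smult (2 * pi) ([:0, 1:] * E_deriv_poly k)"

lemma has_real_derivative_E_deriv_poly:
  "((\<lambda>z. poly (E_deriv_poly k) z * exp (- pi * z\<^sup>2)) has_real_derivative poly (E_deriv_poly (Suc k)) z * exp (- pi * z\<^sup>2)) (at z)"
  by (rule derivative_eq_intros poly_DERIV refl)+ (simp add: algebra_simps)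

lemma deriv_E_eq: "(deriv ^^ Suc k) E = (\<lambda>z. poly (E_deriv_poly k) z * exp (- pi * z\<^sup>2))"
proof (induction k)
  case 0
  show ?case using has_real_derivative_E DERIV_imp_deriv by (auto simp: fun_eq_iff)
next
  case (Suc k)
  show ?case
    unfolding funpow.simps(2)[of "Suc k"] o_apply Suc.IH
    by (intro ext DERIV_imp_deriv has_real_derivative_E_deriv_poly)
qed

lemma has_real_derivative_deriv_E:
  "((deriv ^^ k) E has_real_derivative (deriv ^^ Suc k) E z) (at z)"
proof (cases k)
  case 0
  then show ?thesis using has_real_derivative_E[of z] deriv_E_eq[of 0] by simp
next
  case (Suc j)
  show ?thesis unfolding Suc deriv_E_eq by (rule has_real_derivative_E_deriv_poly)
qed

text \<open>\<open>taylor_coeff c1 c2 \<alpha> \<beta> k\<close> is the \<open>k\<close>-th derivative of \<open>x ^ \<alpha> * y ^ \<beta>\<close> in the direction \<open>(c1, c2)\<close>, divided by \<open>k!\<close>.\<close>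

definition taylor_coeff :: "real \<Rightarrow> real \<Rightarrow> nat \<Rightarrow> nat \<Rightarrow> nat \<Rightarrow> real \<Rightarrow> real \<Rightarrow> real" where
  "taylor_coeff c1 c2 \<alpha> \<beta> k x y = coeff ([:x, c1:] ^ \<alpha> * [:y, c2:] ^ \<beta>) k"

section \<open>Directional Taylor coefficients of a monomial\<close>

lemma taylor_coeff_0_0: "taylor_coeff c1 c2 0 0 k x y = (if k = 0 then 1 else 0)"
  by (simp add: taylor_coeff_def)

lemma taylor_coeff_k0: "taylor_coeff c1 c2 \<alpha> \<beta> 0 x y = x ^ \<alpha> * y ^ \<beta>"
  by (simp add: taylor_coeff_def coeff_mult coeff_0_power)

lemma taylor_coeff_Suc1: "taylor_coeff c1 c2 (Suc \<alpha>) \<beta> k x y = x * taylor_coeff c1 c2 \<alpha> \<beta> k x y + c1 * (if k = 0 then 0 else taylor_coeff c1 c2 \<alpha> \<beta> (k - 1) x y)"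
  unfolding taylor_coeff_def power_Suc mult.assoc by (cases k) simp_all

lemma taylor_coeff_swap: "taylor_coeff c1 c2 \<alpha> \<beta> k x y = taylor_coeff c2 c1 \<beta> \<alpha> k y x"
  by (simp add: taylor_coeff_def mult.commute)

lemma taylor_coeff_Suc2: "taylor_coeff c1 c2 \<alpha> (Suc \<beta>) k x y = y * taylor_coeff c1 c2 \<alpha> \<beta> k x y + c2 * (if k = 0 then 0 else taylor_coeff c1 c2 \<alpha> \<beta> (k - 1) x y)"
  using taylor_coeff_Suc1[of c2 c1 \<beta> \<alpha> k y x] by (simp only: taylor_coeff_swap[of c2 c1])

lemma taylor_coeff_eq_0: assumes "k > \<alpha> + \<beta>" shows "taylor_coeff c1 c2 \<alpha> \<beta> k x y = 0"
proof -
  have "degree ([:x, c1:] ^ \<alpha> * [:y, c2:] ^ \<beta>) \<le> degree ([:x, c1:] ^ \<alpha>) + degree ([:y, c2:] ^ \<beta>)"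
    by (rule degree_mult_le)
  also have "\<dots> \<le> degree [:x, c1:] * \<alpha> + degree [:y, c2:] * \<beta>"
    by (intro add_mono degree_power_le)
  also have "\<dots> \<le> 1 * \<alpha> + 1 * \<beta>" by (intro add_mono mult_right_mono) auto
  finally show ?thesis unfolding taylor_coeff_def using assms by (intro coeff_eq_0) simp
qed

lemma taylor_coeff_dy: "((\<lambda>y. taylor_coeff c1 c2 \<alpha> \<beta> k x y) has_real_derivative of_nat \<beta> * taylor_coeff c1 c2 \<alpha> (\<beta> - 1) k x y) (at y)"
proof (induction \<alpha> arbitrary: k)
  case 0
  show ?case
  proof (induction \<beta> arbitrary: k)
    case (Suc \<beta>)
    note [derivative_intros] = Suc.IH
    have d: "((\<lambda>y. taylor_coeff c1 c2 0 (Suc \<beta>) k x y) has_real_derivative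
        taylor_coeff c1 c2 0 \<beta> k x y + y * (of_nat \<beta> * taylor_coeff c1 c2 0 (\<beta> - 1) k x y) +
        c2 * (if k = 0 then 0 else of_nat \<beta> * taylor_coeff c1 c2 0 (\<beta> - 1) (k - 1) x y)) (at y)"
      unfolding taylor_coeff_Suc2 by (cases "k = 0") (auto intro!: derivative_eq_intros)
    have eq: "of_nat \<beta> * taylor_coeff c1 c2 0 \<beta> k x y =
        of_nat \<beta> * (y * taylor_coeff c1 c2 0 (\<beta> - 1) k x y + c2 * (if k = 0 then 0 else taylor_coeff c1 c2 0 (\<beta> - 1) (k - 1) x y))"
      by (cases \<beta>) (simp_all add: taylor_coeff_Suc2)
    show ?case
      by (rule DERIV_cong[OF d]) (use eq in \<open>cases "k = 0"; auto simp: algebra_simps\<close>)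
  next
    case 0
    have "taylor_coeff c1 c2 0 0 k x = (\<lambda>_. if k = 0 then 1 else 0)" by (simp add: fun_eq_iff taylor_coeff_0_0)
    then show ?case by simp
  qed
next
  case (Suc \<alpha>)
  note [derivative_intros] = Suc.IH
  show ?case unfolding taylor_coeff_Suc1
    by (cases "k = 0") (auto intro!: derivative_eq_intros simp: algebra_simps)
qed

lemma taylor_coeff_dx: "((\<lambda>x. taylor_coeff c1 c2 \<alpha> \<beta> k x y) has_real_derivative of_nat \<alpha> * taylor_coeff c1 c2 (\<alpha> - 1) \<beta> k x y) (at x)"
  using taylor_coeff_dy[of c2 c1 \<beta> \<alpha> k y x] by (simp add: taylor_coeff_swap[of c2 c1])

text \<open>Compare coefficients in the derivative of
  \<open>(x + c1 t) ^ \<alpha> * (y + c2 t) ^ \<beta>\<close> with respect to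
  \<open>t\<close>.\<close>

lemma taylor_coeff_dir:
  "c1 * (of_nat \<alpha> * taylor_coeff c1 c2 (\<alpha> - 1) \<beta> k x y) + c2 * (of_nat \<beta> * taylor_coeff c1 c2 \<alpha> (\<beta> - 1) k x y)
     = of_nat (Suc k) * taylor_coeff c1 c2 \<alpha> \<beta> (Suc k) x y"
proof -
  let ?p = "[:x, c1:]" and ?q = "[:y, c2:]"
  have "pderiv (?p ^ \<alpha> * ?q ^ \<beta>) = smult (c1 * of_nat \<alpha>) (?p ^ (\<alpha> - 1) * ?q ^ \<beta>) + smult (c2 * of_nat \<beta>) (?p ^ \<alpha> * ?q ^ (\<beta> - 1))"
    by (simp add: pderiv_mult pderiv_power pderiv_pCons mult_ac)
  then have "coeff (pderiv (?p ^ \<alpha> * ?q ^ \<beta>)) k = c1 * of_nat \<alpha> * coeff (?p ^ (\<alpha> - 1) * ?q ^ \<beta>) k + c2 * of_nat \<beta> * coeff (?p ^ \<alpha> * ?q ^ (\<beta> - 1)) k"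
    by simp
  then show ?thesis by (simp add: taylor_coeff_def coeff_pderiv mult_ac)
qed

definition p_block :: "real \<Rightarrow> real \<Rightarrow> nat \<Rightarrow> nat \<Rightarrow> real \<Rightarrow> real \<Rightarrow> real" where
  "p_block c1 c2 \<alpha> \<beta> x y = (\<Sum>k\<le>\<alpha> + \<beta>. (- 1 / (4 * pi)) ^ k * ((deriv ^^ k) E (c2 * x + c1 * y) * taylor_coeff c1 c2 \<alpha> \<beta> k x y))"

text \<open>Coefficients beyond the total degree vanish, so sums belonging to different exponents
  can be compared over one common range.\<close>

lemma p_block_upto:
  assumes "N \<ge> \<alpha> + \<beta>"
  shows "p_block c1 c2 \<alpha> \<beta> x y = (\<Sum>k\<le>N. (- 1 / (4 * pi)) ^ k * ((deriv ^^ k) E (c2 * x + c1 * y) * taylor_coeff c1 c2 \<alpha> \<beta> k x y))"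
  unfolding p_block_def
  by (rule sum.mono_neutral_left) (use assms in \<open>auto simp: taylor_coeff_eq_0\<close>)

lemma p_block_swap: "p_block c1 c2 \<alpha> \<beta> x y = p_block c2 c1 \<beta> \<alpha> y x"
  unfolding p_block_def taylor_coeff_swap[of c1 c2] by (simp only: add.commute)

text \<open>Multiplying by \<open>x\<close> adds a Leibniz term with \<open>E ^ (k + 1)\<close>
  understood as the next derivative. The \<open>y\<close>-derivative of
  \<open>E (c2 * x + c1 * y)\<close> produces the same term, but it also hits the monomial, and the
  summand with \<open>\<beta> - 1\<close> compensates this. The factor \<open>of_nat \<beta>\<close>
  removes the truncated case \<beta> = 0. \<open>D\<close> is left abstract, to be identified later
  by uniqueness of derivatives.\<close>

lemma p_block_Suc1:
  "\<exists>D. ((\<lambda>y. p_block c1 c2 \<alpha> \<beta> x y) has_real_derivative D) (at y) \<and>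
     p_block c1 c2 (Suc \<alpha>) \<beta> x y = x * p_block c1 c2 \<alpha> \<beta> x y - D / (4 * pi) + of_nat \<beta> / (4 * pi) * p_block c1 c2 \<alpha> (\<beta> - 1) x y"
proof -
  let ?s = "- 1 / (4 * pi)"
  let ?E = "\<lambda>k. (deriv ^^ k) E (c2 * x + c1 * y)"
  let ?t = "\<lambda>k. taylor_coeff c1 c2 \<alpha> \<beta> k x y"
  let ?N = "Suc (\<alpha> + \<beta>)"
  define D where "D = (\<Sum>k\<le>?N. ?s ^ k * (?E (Suc k) * c1 * ?t k + ?E k * (of_nat \<beta> * taylor_coeff c1 c2 \<alpha> (\<beta> - 1) k x y)))"
  have dE: "((\<lambda>y. (deriv ^^ k) E (c2 * x + c1 * y)) has_real_derivative ?E (Suc k) * c1) (at y)" for k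
    by (rule DERIV_chain'[OF _ has_real_derivative_deriv_E]) (auto intro!: derivative_eq_intros)
  have "((\<lambda>y. \<Sum>k\<le>?N. ?s ^ k * ((deriv ^^ k) E (c2 * x + c1 * y) * taylor_coeff c1 c2 \<alpha> \<beta> k x y)) has_real_derivative D) (at y)"
    unfolding D_def
    by (intro DERIV_sum DERIV_cmult) (rule DERIV_mult'[OF dE taylor_coeff_dy, THEN DERIV_cong], simp add: algebra_simps)
  then have "((\<lambda>y. p_block c1 c2 \<alpha> \<beta> x y) has_real_derivative D) (at y)"
    unfolding p_block_upto[of \<alpha> \<beta> ?N, simplified] by simp
  moreover have "p_block c1 c2 (Suc \<alpha>) \<beta> x y = x * p_block c1 c2 \<alpha> \<beta> x y - D / (4 * pi) + of_nat \<beta> / (4 * pi) * p_block c1 c2 \<alpha> (\<beta> - 1) x y"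
  proof -
    have 1: "D = (\<Sum>k\<le>?N. ?s ^ k * (?E (Suc k) * c1 * ?t k)) + of_nat \<beta> * p_block c1 c2 \<alpha> (\<beta> - 1) x y"
      unfolding D_def
      by (subst p_block_upto[of \<alpha> "\<beta> - 1" ?N]) (simp_all add: sum.distrib sum_distrib_left algebra_simps)
    have "p_block c1 c2 (Suc \<alpha>) \<beta> x y = (\<Sum>k\<le>Suc ?N. ?s ^ k * (?E k * taylor_coeff c1 c2 (Suc \<alpha>) \<beta> k x y))"
      by (rule p_block_upto) simp
    also have "\<dots> = (\<Sum>k\<le>Suc ?N. x * (?s ^ k * (?E k * ?t k)) + ?s ^ k * (?E k * (c1 * (if k = 0 then 0 else ?t (k - 1)))))"
      unfolding taylor_coeff_Suc1 by (simp only: algebra_simps)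
    also have "\<dots> = x * p_block c1 c2 \<alpha> \<beta> x y + (\<Sum>k\<le>Suc ?N. ?s ^ k * (?E k * (c1 * (if k = 0 then 0 else ?t (k - 1)))))"
      by (subst p_block_upto[of \<alpha> \<beta> "Suc ?N"], simp, simp only: sum.distrib sum_distrib_left)
    \<comment> \<open>Shifting \<open>k\<close> releases one factor \<open>- 1 / (4 * pi)\<close>,
      which produces the part of \<open>- D / (4 * pi)\<close> where the derivative falls on
      \<open>E\<close>.\<close>
    also have "(\<Sum>k\<le>Suc ?N. ?s ^ k * (?E k * (c1 * (if k = 0 then 0 else ?t (k - 1))))) = (\<Sum>k\<le>?N. ?s ^ Suc k * (?E (Suc k) * (c1 * ?t k)))"
      by (subst sum.atMost_Suc_shift) simp
    also have "\<dots> = ?s * (\<Sum>k\<le>?N. ?s ^ k * (?E (Suc k) * c1 * ?t k))"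
      unfolding sum_distrib_left by (simp only: power_Suc mult_ac)
    finally show ?thesis unfolding 1 by (simp add: field_simps)
  qed
  ultimately show ?thesis by blast
qed

lemma p_block_Suc2:
  "\<exists>D. ((\<lambda>x. p_block c1 c2 \<alpha> \<beta> x y) has_real_derivative D) (at x) \<and>
     p_block c1 c2 \<alpha> (Suc \<beta>) x y = y * p_block c1 c2 \<alpha> \<beta> x y - D / (4 * pi) + of_nat \<alpha> / (4 * pi) * p_block c1 c2 (\<alpha> - 1) \<beta> x y"
  using p_block_Suc1[of c2 c1 \<beta> \<alpha> y x] by (simp add: p_block_swap[of c2 c1])

lemma p_block_0_0: "p_block c1 c2 0 0 x y = E (c2 * x + c1 * y)"
  by (simp add: p_block_def taylor_coeff_0_0)

section \<open>Differential equations of the path integrals\<close>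

text \<open>
  The operators \<open>x - \<partial>\<^sub>y / (4 pi)\<close> and \<open>y - \<partial>\<^sub>x / (4 pi)\<close> raise the exponents \<open>\<alpha>\<close> and \<open>\<beta>\<close>; the
  recursion of the Hermite polynomials is made for this.
\<close>

lemma J_density_dy:
  assumes r: "r \<noteq> 0"
  shows "((\<lambda>y. J_density \<alpha> \<beta> r x y) has_real_derivative 4 * pi * (x * J_density \<alpha> \<beta> r x y - J_density (Suc \<alpha>) \<beta> r x y)) (at y)"
proof -
  let ?n = "Suc (\<alpha> + \<beta>)"
  let ?K = "2 / 2 ^ (\<alpha> + \<beta>) * (r ^ \<beta> / r ^ Suc \<alpha>)"
  define s where "s = r * x + y / r"
  define e where "e = exp (- pi * (r * x - y / r)\<^sup>2)"
  have 1: "((\<lambda>y. poly (hermite_poly ?n) (r * x + y / r)) has_real_derivative poly (pderiv (hermite_poly ?n)) s * (1 / r)) (at y)"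
    unfolding s_def by (rule DERIV_chain'[OF _ poly_DERIV]) (use r in \<open>auto intro!: derivative_eq_intros\<close>)
  have 2: "((\<lambda>y. exp (- pi * (r * x - y / r)\<^sup>2)) has_real_derivative e * (2 * pi * (r * x - y / r) / r)) (at y)"
  proof -
    have d: "((\<lambda>y. r * x - y / r) has_real_derivative - 1 / r) (at y)" using r by (auto intro!: derivative_eq_intros)
    show ?thesis unfolding e_def by (rule DERIV_cong[OF DERIV_fun_exp[OF DERIV_cmult[OF DERIV_power[OF d]]]]) simp
  qed
  have "((\<lambda>y. ?K * (poly (hermite_poly ?n) (r * x + y / r) * exp (- pi * (r * x - y / r)\<^sup>2))) has_real_derivative
      ?K * (poly (hermite_poly ?n) s * (e * (2 * pi * (r * x - y / r) / r)) + poly (pderiv (hermite_poly ?n)) s * (1 / r) * e)) (at y)"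
    using DERIV_cmult[OF DERIV_mult'[OF 1 2], of ?K] unfolding s_def[symmetric] e_def[symmetric] .
  moreover have "?K * (poly (hermite_poly ?n) s * (e * (2 * pi * (r * x - y / r) / r)) + poly (pderiv (hermite_poly ?n)) s * (1 / r) * e) =
      4 * pi * (x * J_density \<alpha> \<beta> r x y - J_density (Suc \<alpha>) \<beta> r x y)"
  proof -
    have hn: "poly (hermite_poly (Suc ?n)) s = s * poly (hermite_poly ?n) s - poly (pderiv (hermite_poly ?n)) s / (2 * pi)"
      by simp
    have "J_density (Suc \<alpha>) \<beta> r x y = ?K / (2 * r) * (s * poly (hermite_poly ?n) s - poly (pderiv (hermite_poly ?n)) s / (2 * pi)) * e"
      unfolding J_density_def s_def[symmetric] e_def[symmetric] add_Suc hn by (simp add: field_simps)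
    moreover have "J_density \<alpha> \<beta> r x y = ?K * poly (hermite_poly ?n) s * e"
      unfolding J_density_def s_def[symmetric] e_def[symmetric] by simp
    moreover have "K * (h * (e * (2 * pi * (r * x - y / r) / r)) + h' * (1 / r) * e) =
        4 * pi * (x * (K * h * e) - K / (2 * r) * (s * h - h' / (2 * pi)) * e)" for K h h'
      using r by (simp add: s_def field_simps)
    ultimately show ?thesis by simp
  qed
  ultimately show ?thesis unfolding J_density_def by (simp add: mult.assoc)
qed

lemma J_density_dx:
  assumes r: "r \<noteq> 0"
  shows "((\<lambda>x. J_density \<alpha> \<beta> r x y) has_real_derivative 4 * pi * (y * J_density \<alpha> \<beta> r x y - J_density \<alpha> (Suc \<beta>) r x y)) (at x)"
proof -
  let ?n = "Suc (\<alpha> + \<beta>)"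
  let ?K = "2 / 2 ^ (\<alpha> + \<beta>) * (r ^ \<beta> / r ^ Suc \<alpha>)"
  define s where "s = r * x + y / r"
  define e where "e = exp (- pi * (r * x - y / r)\<^sup>2)"
  have 1: "((\<lambda>x. poly (hermite_poly ?n) (r * x + y / r)) has_real_derivative poly (pderiv (hermite_poly ?n)) s * r) (at x)"
    unfolding s_def by (rule DERIV_chain'[OF _ poly_DERIV]) (use r in \<open>auto intro!: derivative_eq_intros\<close>)
  have 2: "((\<lambda>x. exp (- pi * (r * x - y / r)\<^sup>2)) has_real_derivative e * (- 2 * pi * (r * x - y / r) * r)) (at x)"
  proof -
    have d: "((\<lambda>x. r * x - y / r) has_real_derivative r) (at x)" by (auto intro!: derivative_eq_intros)
    show ?thesis unfolding e_def by (rule DERIV_cong[OF DERIV_fun_exp[OF DERIV_cmult[OF DERIV_power[OF d]]]]) simp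
  qed
  have "((\<lambda>x. ?K * (poly (hermite_poly ?n) (r * x + y / r) * exp (- pi * (r * x - y / r)\<^sup>2))) has_real_derivative
      ?K * (poly (hermite_poly ?n) s * (e * (- 2 * pi * (r * x - y / r) * r)) + poly (pderiv (hermite_poly ?n)) s * r * e)) (at x)"
    using DERIV_cmult[OF DERIV_mult'[OF 1 2], of ?K] unfolding s_def[symmetric] e_def[symmetric] .
  moreover have "?K * (poly (hermite_poly ?n) s * (e * (- 2 * pi * (r * x - y / r) * r)) + poly (pderiv (hermite_poly ?n)) s * r * e) =
      4 * pi * (y * J_density \<alpha> \<beta> r x y - J_density \<alpha> (Suc \<beta>) r x y)"
  proof -
    have hn: "poly (hermite_poly (Suc ?n)) s = s * poly (hermite_poly ?n) s - poly (pderiv (hermite_poly ?n)) s / (2 * pi)"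
      by simp
    have "J_density \<alpha> (Suc \<beta>) r x y = ?K * r / 2 * (s * poly (hermite_poly ?n) s - poly (pderiv (hermite_poly ?n)) s / (2 * pi)) * e"
      unfolding J_density_def s_def[symmetric] e_def[symmetric] add_Suc_right hn by (simp add: field_simps)
    moreover have "J_density \<alpha> \<beta> r x y = ?K * poly (hermite_poly ?n) s * e"
      unfolding J_density_def s_def[symmetric] e_def[symmetric] by simp
    moreover have "K * (h * (e * (- 2 * pi * (r * x - y / r) * r)) + h' * r * e) =
        4 * pi * (y * (K * h * e) - K * r / 2 * (s * h - h' / (2 * pi)) * e)" for K h h'
      using r by (simp add: s_def field_simps)
    ultimately show ?thesis by simp
  qed
  ultimately show ?thesis unfolding J_density_def by (simp add: mult.assoc)
qed

lemma J_block_integrable: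
  assumes "r0 > 0" "r1 > 0"
  shows "(\<lambda>t. (r0 - r1) * J_density \<alpha> \<beta> (r1 + t * (r0 - r1)) x y) integrable_on {0..1}"
proof (rule integrable_continuous_real)
  have "r1 + t * (r0 - r1) \<noteq> 0" if "t \<in> {0..1}" for t using path_bounds(2)[OF assms that] by simp
  then show "continuous_on {0..1} (\<lambda>t. (r0 - r1) * J_density \<alpha> \<beta> (r1 + t * (r0 - r1)) x y)"
    by (intro continuous_intros) auto
qed

lemma J_block_dy:
  assumes r: "r0 > 0" "r1 > 0"
  shows "((\<lambda>y. J_block r0 r1 \<alpha> \<beta> x y) has_real_derivative
     4 * pi * (x * J_block r0 r1 \<alpha> \<beta> x y - J_block r0 r1 (Suc \<alpha>) \<beta> x y)) (at y)"
proof -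
  let ?p = "\<lambda>t. r1 + t * (r0 - r1)"
  have nz: "?p t \<noteq> 0" if "t \<in> {0..1}" for t using path_bounds(2)[OF r that] by simp
  let ?fx = "\<lambda>y t. (r0 - r1) * (4 * pi * (x * J_density \<alpha> \<beta> (?p t) x y - J_density (Suc \<alpha>) \<beta> (?p t) x y))"
  have "((\<lambda>y. integral (cbox 0 1) (\<lambda>t. (r0 - r1) * J_density \<alpha> \<beta> (?p t) x y)) has_real_derivative
      integral (cbox 0 1) (?fx y)) (at y within UNIV)"
  proof (rule leibniz_rule_field_derivative)
    show "((\<lambda>y. (r0 - r1) * J_density \<alpha> \<beta> (?p t) x y) has_real_derivative ?fx y t) (at y within UNIV)" if "t \<in> cbox 0 1" for y t
      using nz[of t] that by (intro DERIV_cmult J_density_dy) auto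
    show "(\<lambda>t. (r0 - r1) * J_density \<alpha> \<beta> (?p t) x y) integrable_on cbox 0 1" for y
      using J_block_integrable[OF r] by simp
    show "continuous_on (UNIV \<times> cbox 0 1) (\<lambda>(y, t). ?fx y t)"
      unfolding case_prod_unfold using nz by (intro continuous_intros) auto
  qed auto
  also have "integral (cbox 0 1) (?fx y) = 4 * pi * (x * J_block r0 r1 \<alpha> \<beta> x y - J_block r0 r1 (Suc \<alpha>) \<beta> x y)"
  proof -
    have "integral {0..1} (?fx y) = integral {0..1} (\<lambda>t. 4 * pi * (x * ((r0 - r1) * J_density \<alpha> \<beta> (?p t) x y) - (r0 - r1) * J_density (Suc \<alpha>) \<beta> (?p t) x y))"
      by (simp only: right_diff_distrib mult_ac)
    also have "\<dots> = 4 * pi * (x * J_block r0 r1 \<alpha> \<beta> x y - J_block r0 r1 (Suc \<alpha>) \<beta> x y)"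
      unfolding J_block_def
      by (intro integral_unique has_integral_mult_right has_integral_diff integrable_integral J_block_integrable[OF r])
    finally show ?thesis by simp
  qed
  finally show ?thesis by (simp add: J_block_def)
qed

lemma J_block_dx:
  assumes r: "r0 > 0" "r1 > 0"
  shows "((\<lambda>x. J_block r0 r1 \<alpha> \<beta> x y) has_real_derivative
     4 * pi * (y * J_block r0 r1 \<alpha> \<beta> x y - J_block r0 r1 \<alpha> (Suc \<beta>) x y)) (at x)"
proof -
  let ?p = "\<lambda>t. r1 + t * (r0 - r1)"
  have nz: "?p t \<noteq> 0" if "t \<in> {0..1}" for t using path_bounds(2)[OF r that] by simp
  let ?fx = "\<lambda>x t. (r0 - r1) * (4 * pi * (y * J_density \<alpha> \<beta> (?p t) x y - J_density \<alpha> (Suc \<beta>) (?p t) x y))"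
  have "((\<lambda>x. integral (cbox 0 1) (\<lambda>t. (r0 - r1) * J_density \<alpha> \<beta> (?p t) x y)) has_real_derivative
      integral (cbox 0 1) (?fx x)) (at x within UNIV)"
  proof (rule leibniz_rule_field_derivative)
    show "((\<lambda>x. (r0 - r1) * J_density \<alpha> \<beta> (?p t) x y) has_real_derivative ?fx x t) (at x within UNIV)" if "t \<in> cbox 0 1" for x t
      using nz[of t] that by (intro DERIV_cmult J_density_dx) auto
    show "(\<lambda>t. (r0 - r1) * J_density \<alpha> \<beta> (?p t) x y) integrable_on cbox 0 1" for x
      using J_block_integrable[OF r] by simp
    show "continuous_on (UNIV \<times> cbox 0 1) (\<lambda>(x, t). ?fx x t)"
      unfolding case_prod_unfold using nz by (intro continuous_intros) auto
  qed auto
  also have "integral (cbox 0 1) (?fx x) = 4 * pi * (y * J_block r0 r1 \<alpha> \<beta> x y - J_block r0 r1 \<alpha> (Suc \<beta>) x y)"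
  proof -
    have "integral {0..1} (?fx x) = integral {0..1} (\<lambda>t. 4 * pi * (y * ((r0 - r1) * J_density \<alpha> \<beta> (?p t) x y) - (r0 - r1) * J_density \<alpha> (Suc \<beta>) (?p t) x y))"
      by (simp only: right_diff_distrib mult_ac)
    also have "\<dots> = 4 * pi * (y * J_block r0 r1 \<alpha> \<beta> x y - J_block r0 r1 \<alpha> (Suc \<beta>) x y)"
      unfolding J_block_def
      by (intro integral_unique has_integral_mult_right has_integral_diff integrable_integral J_block_integrable[OF r])
    finally show ?thesis by simp
  qed
  finally show ?thesis by (simp add: J_block_def)
qed

text \<open>Integrate the derivative of \<open>E (r * x - y / r)\<close> along the path from
  \<open>r1\<close> to \<open>r0\<close>.\<close>

lemma J_block_0_0:
  assumes r: "r0 > 0" "r1 > 0"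
  shows "J_block r0 r1 0 0 x y = E (r0 * x - y / r0) - E (r1 * x - y / r1)"
proof -
  let ?p = "\<lambda>t. r1 + t * (r0 - r1)"
  let ?q = "\<lambda>t. ?p t * x - y / ?p t"
  have "((\<lambda>t. (r0 - r1) * J_density 0 0 (?p t) x y) has_integral (E (?q 1) - E (?q 0))) {0..1}"
  proof (rule fundamental_theorem_of_calculus)
    fix t :: real assume t: "t \<in> {0..1}"
    have nz: "?p t \<noteq> 0" using path_bounds(2)[OF r t] by simp
    have "(?q has_real_derivative (r0 - r1) * (x + y / (?p t)\<^sup>2)) (at t)"
    proof -
      have dp: "(?p has_real_derivative (r0 - r1)) (at t)" by (auto intro!: derivative_eq_intros)
      have alg: "d * x - (0 * p - y * d) / (p * p) = d * (x + y / p\<^sup>2)" if "p \<noteq> 0" for p d :: real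
        using that by (simp add: field_simps power2_eq_square)
      show ?thesis
        by (rule DERIV_cong[OF DERIV_diff[OF DERIV_cmult_right[OF dp] DERIV_divide[OF DERIV_const dp nz]] alg[OF nz]])
    qed
    from DERIV_chain'[OF this has_real_derivative_E]
    have "((\<lambda>t. E (?q t)) has_real_derivative 2 * exp (- pi * (?q t)\<^sup>2) * ((r0 - r1) * (x + y / (?p t)\<^sup>2))) (at t)" .
    moreover have "2 * exp (- pi * (?q t)\<^sup>2) * ((r0 - r1) * (x + y / (?p t)\<^sup>2)) = (r0 - r1) * J_density 0 0 (?p t) x y"
    proof -
      have "x + y / p\<^sup>2 = (p * x + y / p) / p" if "p \<noteq> 0" for p
        using that by (simp add: field_simps power2_eq_square)
      from this[OF nz] show ?thesis by (simp add: J_density_def)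
    qed
    ultimately have "((\<lambda>t. E (?q t)) has_real_derivative (r0 - r1) * J_density 0 0 (?p t) x y) (at t)"
      by (rule DERIV_cong)
    then show "((\<lambda>t. E (?q t)) has_vector_derivative (r0 - r1) * J_density 0 0 (?p t) x y) (at t within {0..1})"
      unfolding has_real_derivative_iff_has_vector_derivative by (rule has_vector_derivative_at_within)
  qed simp
  then show ?thesis by (simp add: J_block_def has_integral_iff)
qed

section \<open>Heat flow on a monomial\<close>

text \<open>
  The coefficients of \<open>exp (s \<partial>\<^sub>x \<partial>\<^sub>y)\<close> on the monomial \<open>x ^ \<alpha> * y ^ \<beta>\<close>, with \<open>g a b\<close> in the place
  of \<open>x ^ a * y ^ b\<close>.
\<close>

definition contraction_sum :: "'a::real_normed_field \<Rightarrow> (nat \<Rightarrow> nat \<Rightarrow> 'a) \<Rightarrow> nat \<Rightarrow> nat \<Rightarrow> 'a" where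
  "contraction_sum s g \<alpha> \<beta> = (\<Sum>k\<le>\<alpha>. s ^ k * of_nat (fact k * (\<alpha> choose k) * (\<beta> choose k)) * g (\<alpha> - k) (\<beta> - k))"

lemma contraction_sum_0_left [simp]: "contraction_sum s g 0 \<beta> = g 0 \<beta>"
  by (simp add: contraction_sum_def)

lemma contraction_sum_s0: "contraction_sum 0 g \<alpha> \<beta> = g \<alpha> \<beta>"
proof -
  have "contraction_sum 0 g \<alpha> \<beta> = (\<Sum>k\<le>\<alpha>. if k = 0 then g \<alpha> \<beta> else 0)"
    unfolding contraction_sum_def by (intro sum.cong) (auto simp: power_0_left)
  then show ?thesis by simp
qed

lemma fact_Suc_times_binomial:
  "(fact (Suc k) :: nat) * (n choose Suc k) = fact k * (n * (n - 1 choose k))"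
proof (cases n)
  case (Suc j)
  have "(fact (Suc k) :: nat) * (n choose Suc k) = fact k * (Suc k * (Suc j choose Suc k))"
    unfolding Suc by (simp only: fact_Suc of_nat_id mult_ac)
  also have "\<dots> = fact k * (n * (n - 1 choose k))"
    unfolding Suc_times_binomial Suc by simp
  finally show ?thesis .
qed simp

text \<open>The commutation \<open>exp (s \<partial>\<^sub>x \<partial>\<^sub>y) x = (x + s
  \<partial>\<^sub>y) exp (s \<partial>\<^sub>x \<partial>\<^sub>y)\<close> on coefficients, proved
  by Pascal's rule. For \<open>s = 1 / (4 * pi)\<close> its correction term is that of the recursion
  for \<open>p_block\<close>.\<close>

lemma contraction_sum_Suc:
  "contraction_sum s g (Suc \<alpha>) \<beta> = contraction_sum s (\<lambda>a b. g (Suc a) b) \<alpha> \<beta> + s * of_nat \<beta> * contraction_sum s g \<alpha> (\<beta> - 1)"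
proof -
  let ?c = "\<lambda>n k. of_nat (fact k * (n choose k) * (\<beta> choose k)) :: 'a"
  let ?d = "\<lambda>k. of_nat (fact k * (if k = 0 then 0 else \<alpha> choose (k - 1)) * (\<beta> choose k)) :: 'a"
  have c: "?c (Suc \<alpha>) k = ?c \<alpha> k + ?d k" for k
    by (cases k) (simp_all add: algebra_simps)
  have "contraction_sum s g (Suc \<alpha>) \<beta> = (\<Sum>k\<le>Suc \<alpha>. s ^ k * ?c \<alpha> k * g (Suc \<alpha> - k) (\<beta> - k)) + (\<Sum>k\<le>Suc \<alpha>. s ^ k * ?d k * g (Suc \<alpha> - k) (\<beta> - k))"
    unfolding contraction_sum_def c by (simp only: sum.distrib[symmetric] distrib_left distrib_right)
  also have "(\<Sum>k\<le>Suc \<alpha>. s ^ k * ?c \<alpha> k * g (Suc \<alpha> - k) (\<beta> - k)) = contraction_sum s (\<lambda>a b. g (Suc a) b) \<alpha> \<beta>"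
    unfolding contraction_sum_def by (simp add: Suc_diff_le)
  also have "(\<Sum>k\<le>Suc \<alpha>. s ^ k * ?d k * g (Suc \<alpha> - k) (\<beta> - k)) = (\<Sum>k\<le>\<alpha>. s ^ Suc k * ?d (Suc k) * g (\<alpha> - k) (\<beta> - Suc k))"
    by (subst sum.atMost_Suc_shift) simp
  also have "\<dots> = (\<Sum>k\<le>\<alpha>. s * of_nat \<beta> * (s ^ k * of_nat (fact k * (\<alpha> choose k) * (\<beta> - 1 choose k)) * g (\<alpha> - k) (\<beta> - 1 - k)))"
  proof (rule sum.cong)
    fix k
    have "fact (Suc k) * (\<beta> choose Suc k) = fact k * (\<beta> * (\<beta> - 1 choose k))"
      by (rule fact_Suc_times_binomial)
    then have "(\<alpha> choose k) * (fact (Suc k) * (\<beta> choose Suc k)) = (\<alpha> choose k) * (fact k * (\<beta> * (\<beta> - 1 choose k)))" by (rule arg_cong)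
    then have "fact (Suc k) * (\<alpha> choose k) * (\<beta> choose Suc k) = \<beta> * (fact k * (\<alpha> choose k) * (\<beta> - 1 choose k))"
      by (simp only: mult_ac)
    then have "?d (Suc k) = of_nat \<beta> * of_nat (fact k * (\<alpha> choose k) * (\<beta> - 1 choose k))"
      by (simp only: nat.distinct if_False diff_Suc_1 flip: of_nat_mult)
    then show "s ^ Suc k * ?d (Suc k) * g (\<alpha> - k) (\<beta> - Suc k) =
       s * of_nat \<beta> * (s ^ k * of_nat (fact k * (\<alpha> choose k) * (\<beta> - 1 choose k)) * g (\<alpha> - k) (\<beta> - 1 - k))"
      by (simp only: power_Suc mult_ac diff_Suc_eq_diff_pred)
  qed simp
  also have "\<dots> = s * of_nat \<beta> * contraction_sum s g \<alpha> (\<beta> - 1)" by (simp only: contraction_sum_def sum_distrib_left)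
  finally show ?thesis .
qed

text \<open>Differentiating \<open>exp (s \<partial>\<^sub>x \<partial>\<^sub>y)\<close> brings down
  \<open>\<partial>\<^sub>x \<partial>\<^sub>y\<close>, which lowers both exponents with
  multiplicity \<open>\<alpha> * \<beta>\<close>; this factor vanishes wherever the subtraction is
  truncated.\<close>

lemma contraction_sum_deriv:
  fixes s :: "'a::real_normed_field"
  shows "((\<lambda>s. contraction_sum s g \<alpha> \<beta>) has_field_derivative of_nat (\<alpha> * \<beta>) * contraction_sum s g (\<alpha> - 1) (\<beta> - 1)) (at s)"
proof (cases \<alpha>)
  case (Suc a)
  let ?c = "\<lambda>k. of_nat (fact k * (Suc a choose k) * (\<beta> choose k)) * g (Suc a - k) (\<beta> - k)"
  have "((\<lambda>s. \<Sum>k\<le>Suc a. s ^ k * ?c k) has_field_derivative (\<Sum>k\<le>Suc a. (of_nat k * s ^ (k - 1)) * ?c k)) (at s)"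
    by (intro DERIV_sum) (auto intro!: derivative_eq_intros)
  also have "(\<Sum>k\<le>Suc a. (of_nat k * s ^ (k - 1)) * ?c k) = (\<Sum>k\<le>a. (of_nat (Suc k) * s ^ k) * ?c (Suc k))"
    by (subst sum.atMost_Suc_shift) simp
  also have "\<dots> = (\<Sum>k\<le>a. of_nat (Suc a * \<beta>) * (s ^ k * of_nat (fact k * (a choose k) * (\<beta> - 1 choose k)) * g (a - k) (\<beta> - 1 - k)))"
  proof (rule sum.cong)
    fix k
    have "fact (Suc k) * (\<beta> choose Suc k) = fact k * (\<beta> * (\<beta> - 1 choose k))"
      by (rule fact_Suc_times_binomial)
    moreover have "Suc k * (Suc a choose Suc k) = Suc a * (a choose k)" by (rule Suc_times_binomial)
    ultimately have "(Suc k * (Suc a choose Suc k)) * (fact (Suc k) * (\<beta> choose Suc k)) = (Suc a * (a choose k)) * (fact k * (\<beta> * (\<beta> - 1 choose k)))" by (simp only:)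
    then have "Suc k * (fact (Suc k) * (Suc a choose Suc k) * (\<beta> choose Suc k)) = Suc a * \<beta> * (fact k * (a choose k) * (\<beta> - 1 choose k))"
      by (simp only: mult_ac)
    then have e: "(of_nat (Suc k) :: 'a) * of_nat (fact (Suc k) * (Suc a choose Suc k) * (\<beta> choose Suc k)) = of_nat (Suc a * \<beta>) * of_nat (fact k * (a choose k) * (\<beta> - 1 choose k))"
      by (simp only: flip: of_nat_mult)
    have "(of_nat (Suc k) * s ^ k) * ?c (Suc k) = s ^ k * (of_nat (Suc k) * of_nat (fact (Suc k) * (Suc a choose Suc k) * (\<beta> choose Suc k))) * g (a - k) (\<beta> - 1 - k)"
      by (simp only: mult_ac diff_Suc_1 diff_Suc_eq_diff_pred)
    also have "\<dots> = of_nat (Suc a * \<beta>) * (s ^ k * of_nat (fact k * (a choose k) * (\<beta> - 1 choose k)) * g (a - k) (\<beta> - 1 - k))"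
      unfolding e by (simp only: mult_ac)
    finally show "(of_nat (Suc k) * s ^ k) * ?c (Suc k) = of_nat (Suc a * \<beta>) * (s ^ k * of_nat (fact k * (a choose k) * (\<beta> - 1 choose k)) * g (a - k) (\<beta> - 1 - k))" .
  qed simp
  finally show ?thesis unfolding Suc contraction_sum_def sum_distrib_left by (simp only: mult.assoc diff_Suc_1)
qed simp

definition p_block_diff :: "real \<Rightarrow> real \<Rightarrow> nat \<Rightarrow> nat \<Rightarrow> real \<Rightarrow> real \<Rightarrow> real" where
  "p_block_diff r0 r1 \<alpha> \<beta> x y = p_block (- 1 / r0) r0 \<alpha> \<beta> x y - p_block (- 1 / r1) r1 \<alpha> \<beta> x y"

lemma p_block_diff_Suc1:
  "\<exists>D. ((\<lambda>y. p_block_diff r0 r1 \<alpha> \<beta> x y) has_real_derivative D) (at y) \<and>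
     p_block_diff r0 r1 (Suc \<alpha>) \<beta> x y = x * p_block_diff r0 r1 \<alpha> \<beta> x y - D / (4 * pi) + of_nat \<beta> / (4 * pi) * p_block_diff r0 r1 \<alpha> (\<beta> - 1) x y"
proof -
  obtain D0 where D0: "((\<lambda>y. p_block (- 1 / r0) r0 \<alpha> \<beta> x y) has_real_derivative D0) (at y)"
     "p_block (- 1 / r0) r0 (Suc \<alpha>) \<beta> x y = x * p_block (- 1 / r0) r0 \<alpha> \<beta> x y - D0 / (4 * pi) + of_nat \<beta> / (4 * pi) * p_block (- 1 / r0) r0 \<alpha> (\<beta> - 1) x y"
    using p_block_Suc1 by metis
  obtain D1 where D1: "((\<lambda>y. p_block (- 1 / r1) r1 \<alpha> \<beta> x y) has_real_derivative D1) (at y)"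
     "p_block (- 1 / r1) r1 (Suc \<alpha>) \<beta> x y = x * p_block (- 1 / r1) r1 \<alpha> \<beta> x y - D1 / (4 * pi) + of_nat \<beta> / (4 * pi) * p_block (- 1 / r1) r1 \<alpha> (\<beta> - 1) x y"
    using p_block_Suc1 by metis
  show ?thesis unfolding p_block_diff_def
    by (rule exI[of _ "D0 - D1"], rule conjI[OF DERIV_diff[OF D0(1) D1(1)]])
       (unfold D0(2) D1(2), simp add: algebra_simps diff_divide_distrib)
qed

lemma p_block_diff_Suc2:
  "\<exists>D. ((\<lambda>x. p_block_diff r0 r1 \<alpha> \<beta> x y) has_real_derivative D) (at x) \<and>
     p_block_diff r0 r1 \<alpha> (Suc \<beta>) x y = y * p_block_diff r0 r1 \<alpha> \<beta> x y - D / (4 * pi) + of_nat \<alpha> / (4 * pi) * p_block_diff r0 r1 (\<alpha> - 1) \<beta> x y"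
proof -
  obtain D0 where D0: "((\<lambda>x. p_block (- 1 / r0) r0 \<alpha> \<beta> x y) has_real_derivative D0) (at x)"
     "p_block (- 1 / r0) r0 \<alpha> (Suc \<beta>) x y = y * p_block (- 1 / r0) r0 \<alpha> \<beta> x y - D0 / (4 * pi) + of_nat \<alpha> / (4 * pi) * p_block (- 1 / r0) r0 (\<alpha> - 1) \<beta> x y"
    using p_block_Suc2 by metis
  obtain D1 where D1: "((\<lambda>x. p_block (- 1 / r1) r1 \<alpha> \<beta> x y) has_real_derivative D1) (at x)"
     "p_block (- 1 / r1) r1 \<alpha> (Suc \<beta>) x y = y * p_block (- 1 / r1) r1 \<alpha> \<beta> x y - D1 / (4 * pi) + of_nat \<alpha> / (4 * pi) * p_block (- 1 / r1) r1 (\<alpha> - 1) \<beta> x y"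
    using p_block_Suc2 by metis
  show ?thesis unfolding p_block_diff_def
    by (rule exI[of _ "D0 - D1"], rule conjI[OF DERIV_diff[OF D0(1) D1(1)]])
       (unfold D0(2) D1(2), simp add: algebra_simps diff_divide_distrib)
qed

text \<open>Both sides start with \<open>E (r0 * x - y / r0) - E (r1 * x - y / r1)\<close> and obey
  the same recursion in the exponents. The recursion differentiates, so the induction hypothesis is
  needed at all points.\<close>

theorem p_block_diff_eq_contraction_sum:
  assumes r: "r0 > 0" "r1 > 0"
  shows "p_block_diff r0 r1 \<alpha> \<beta> x y = contraction_sum (1 / (4 * pi)) (\<lambda>a b. J_block r0 r1 a b x y) \<alpha> \<beta>"
proof (induction \<alpha> arbitrary: \<beta> x y)
  case 0
  show ?case
  \<comment> \<open>Along \<alpha> = 0 the correction term of the recursion in \<beta> carries the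
    factor 0, and the contraction consists of one term.\<close>
  proof (induction \<beta> arbitrary: x y)
    case 0
    show ?case by (simp add: p_block_diff_def p_block_0_0 J_block_0_0[OF r])
  next
    case (Suc \<beta>)
    obtain D where D: "((\<lambda>x. p_block_diff r0 r1 0 \<beta> x y) has_real_derivative D) (at x)"
      "p_block_diff r0 r1 0 (Suc \<beta>) x y = y * p_block_diff r0 r1 0 \<beta> x y - D / (4 * pi)"
      using p_block_diff_Suc2[of r0 r1 0 \<beta> y x] by auto
    have "((\<lambda>x. p_block_diff r0 r1 0 \<beta> x y) has_real_derivative 4 * pi * (y * J_block r0 r1 0 \<beta> x y - J_block r0 r1 0 (Suc \<beta>) x y)) (at x)"
      unfolding Suc.IH contraction_sum_0_left by (rule J_block_dx[OF r])
    then have "D = 4 * pi * (y * J_block r0 r1 0 \<beta> x y - J_block r0 r1 0 (Suc \<beta>) x y)"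
      using D(1) DERIV_unique by blast
    then show ?case unfolding D(2) Suc.IH by simp
  qed
next
  case (Suc \<alpha>)
  let ?J = "\<lambda>a b. J_block r0 r1 a b x y"
  let ?s = "1 / (4 * pi)"
  obtain D where D: "((\<lambda>y. p_block_diff r0 r1 \<alpha> \<beta> x y) has_real_derivative D) (at y)"
    "p_block_diff r0 r1 (Suc \<alpha>) \<beta> x y = x * p_block_diff r0 r1 \<alpha> \<beta> x y - D / (4 * pi) + of_nat \<beta> / (4 * pi) * p_block_diff r0 r1 \<alpha> (\<beta> - 1) x y"
    using p_block_diff_Suc1[of r0 r1 \<alpha> \<beta> x y] by blast
  have "((\<lambda>y. p_block_diff r0 r1 \<alpha> \<beta> x y) has_real_derivative 4 * pi * (x * contraction_sum ?s ?J \<alpha> \<beta> - contraction_sum ?s (\<lambda>a b. ?J (Suc a) b) \<alpha> \<beta>)) (at y)"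
  proof -
    have "((\<lambda>y. contraction_sum ?s (\<lambda>a b. J_block r0 r1 a b x y) \<alpha> \<beta>) has_real_derivative
       (\<Sum>k\<le>\<alpha>. ?s ^ k * of_nat (fact k * (\<alpha> choose k) * (\<beta> choose k)) *
          (4 * pi * (x * ?J (\<alpha> - k) (\<beta> - k) - ?J (Suc (\<alpha> - k)) (\<beta> - k))))) (at y)"
      unfolding contraction_sum_def by (intro DERIV_sum DERIV_cmult J_block_dy r)
    also have "(\<Sum>k\<le>\<alpha>. ?s ^ k * of_nat (fact k * (\<alpha> choose k) * (\<beta> choose k)) *
          (4 * pi * (x * ?J (\<alpha> - k) (\<beta> - k) - ?J (Suc (\<alpha> - k)) (\<beta> - k)))) = 
        4 * pi * (x * contraction_sum ?s ?J \<alpha> \<beta> - contraction_sum ?s (\<lambda>a b. ?J (Suc a) b) \<alpha> \<beta>)"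
      unfolding contraction_sum_def sum_distrib_left right_diff_distrib sum_subtractf[symmetric]
      by (intro sum.cong refl) (simp only: mult_ac)
    finally show ?thesis unfolding Suc.IH .
  qed
  then have D': "D = 4 * pi * (x * contraction_sum ?s ?J \<alpha> \<beta> - contraction_sum ?s (\<lambda>a b. ?J (Suc a) b) \<alpha> \<beta>)"
    using D(1) DERIV_unique by blast
  \<comment> \<open>The two terms with factor \<open>x\<close> cancel; what is left is the raised
    sum and the correction.\<close>
  show ?case unfolding D(2) D' Suc.IH contraction_sum_Suc by simp
qed

section \<open>Spherical polynomials\<close>

text \<open>A vanishing polynomial stays zero when its monomials are replaced by arbitrary values
  \<open>N\<close> depending only on the exponents. It is stated for families because different
  indices may share a monomial. The induction singles out one variable and groups the indices by its
  exponent.\<close>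

lemma monomials_linearly_independent:
  fixes w N :: "'i \<Rightarrow> complex" and e :: "'i \<Rightarrow> 'v \<Rightarrow> nat"
  assumes "finite V" "finite I"
    and "\<And>X::'v \<Rightarrow> real. (\<Sum>i\<in>I. w i * of_real (\<Prod>v\<in>V. X v ^ e i v)) = 0"
    and "\<And>i i'. i \<in> I \<Longrightarrow> i' \<in> I \<Longrightarrow> (\<And>v. v \<in> V \<Longrightarrow> e i v = e i' v) \<Longrightarrow> N i = N i'"
  shows "(\<Sum>i\<in>I. w i * N i) = 0"
  using assms
proof (induction V arbitrary: I rule: finite_induct)
  case empty
  show ?case
  proof (cases "I = {}")
    case False
    then obtain i0 where "i0 \<in> I" by blast
    have "N i = N i0" if "i \<in> I" for i
      using that \<open>i0 \<in> I\<close> by (rule empty.prems(3)) simp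
    then have "(\<Sum>i\<in>I. w i * N i) = (\<Sum>i\<in>I. w i) * N i0"
      unfolding sum_distrib_right by (intro sum.cong refl arg_cong[where f = "(*) _"])
    also have "(\<Sum>i\<in>I. w i) = 0" using empty.prems(2) by simp
    finally show ?thesis by simp
  qed simp
next
  case (insert v V)
  define K where "K = (\<lambda>i. e i v) ` I"
  have K: "finite K" using insert.prems by (simp add: K_def)
  define Ik where "Ik = (\<lambda>k. {i \<in> I. e i v = k})"
  have Ik: "finite (Ik k)" for k using insert.prems by (simp add: Ik_def)
  have grp: "(\<Sum>i\<in>I. g i) = (\<Sum>k\<in>K. \<Sum>i\<in>Ik k. g i)" for g :: "'i \<Rightarrow> complex"
    unfolding Ik_def using sum.group[of I K "\<lambda>i. e i v" g] insert.prems K by (simp add: K_def)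
  have zero: "(\<Sum>i\<in>Ik k. w i * of_real (\<Prod>v\<in>V. X v ^ e i v)) = 0" if k: "k \<in> K" for X k
  proof -
    \<comment> \<open>With the other variables frozen, \<open>c k\<close> is the coefficient of the
      k-th power of \<open>v\<close>; a polynomial vanishing at all reals has only zero
      coefficients.\<close>
    define c where "c = (\<lambda>k. \<Sum>i\<in>Ik k. w i * of_real (\<Prod>v\<in>V. X v ^ e i v))"
    define p where "p = (\<Sum>k\<in>K. monom (c k) k)"
    have "poly p (of_real t) = 0" for t :: real
    proof -
      have "poly p (of_real t) = (\<Sum>k\<in>K. \<Sum>i\<in>Ik k. w i * of_real (\<Prod>u\<in>insert v V. (X(v := t)) u ^ e i u))"
        unfolding p_def poly_sum poly_monom c_def sum_distrib_right
      proof (intro sum.cong refl)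
        fix k i assume "i \<in> Ik k"
        then have "e i v = k" by (simp add: Ik_def)
        moreover have "(\<Prod>u\<in>V. (X(v := t)) u ^ e i u) = (\<Prod>u\<in>V. X u ^ e i u)"
          using insert.hyps by (intro prod.cong) auto
        ultimately show "w i * of_real (\<Prod>v\<in>V. X v ^ e i v) * of_real t ^ k =
            w i * of_real (\<Prod>u\<in>insert v V. (X(v := t)) u ^ e i u)"
          using insert.hyps by (simp add: prod.insert)
      qed
      also have "\<dots> = 0" unfolding grp[symmetric] by (rule insert.prems(2))
      finally show ?thesis .
    qed
    then have "range complex_of_real \<subseteq> {x. poly p x = 0}" by auto
    moreover have "infinite (range complex_of_real)"
      using infinite_UNIV_char_0 by (simp add: finite_image_iff inj_of_real)
    ultimately have "p = 0" using poly_roots_finite finite_subset by blast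
    moreover have "coeff p k = c k"
      unfolding p_def coeff_sum coeff_monom using K k by simp
    ultimately show ?thesis by (simp add: c_def)
  qed
  have "(\<Sum>i\<in>Ik k. w i * N i) = 0" if k: "k \<in> K" for k
  proof (rule insert.IH[OF Ik zero[OF k]])
    fix i i' assume "i \<in> Ik k" "i' \<in> Ik k" "\<And>u. u \<in> V \<Longrightarrow> e i u = e i' u"
    then show "N i = N i'" by (intro insert.prems(3)) (auto simp: Ik_def)
  qed
  then show ?case unfolding grp by simp
qed

section \<open>Derivatives of sums of products over the blocks\<close>

text \<open>In this form a partial derivative in block \<open>j\<close> is a function update of
  \<open>F\<close> at \<open>j\<close>.\<close>

definition sum_of_products :: "'a set \<Rightarrow> ('a \<Rightarrow> complex) \<Rightarrow> ('a \<Rightarrow> 'm::finite \<Rightarrow> real \<Rightarrow> real \<Rightarrow> real) \<Rightarrow> real^2^'m \<Rightarrow> complex" where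
  "sum_of_products A c F x = (\<Sum>a\<in>A. c a * of_real (\<Prod>i\<in>UNIV. F a i (x $ i $ 1) (x $ i $ 2)))"

lemma sum_of_products_fun_upd:
  "sum_of_products A c (\<lambda>a. (F a)(j := G a)) x =
     (\<Sum>a\<in>A. c a * of_real (G a (x $ j $ 1) (x $ j $ 2) * (\<Prod>i\<in>UNIV - {j}. F a i (x $ i $ 1) (x $ i $ 2))))"
  unfolding sum_of_products_def
proof (intro sum.cong refl)
  fix a
  have "(\<Prod>i\<in>UNIV. ((F a)(j := G a)) i (x $ i $ 1) (x $ i $ 2)) =
     G a (x $ j $ 1) (x $ j $ 2) * (\<Prod>i\<in>UNIV - {j}. ((F a)(j := G a)) i (x $ i $ 1) (x $ i $ 2))"
    by (subst prod.remove[of _ j]) auto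
  also have "(\<Prod>i\<in>UNIV - {j}. ((F a)(j := G a)) i (x $ i $ 1) (x $ i $ 2)) = (\<Prod>i\<in>UNIV - {j}. F a i (x $ i $ 1) (x $ i $ 2))"
    by (intro prod.cong) auto
  finally show "c a * of_real (\<Prod>i\<in>UNIV. ((F a)(j := G a)) i (x $ i $ 1) (x $ i $ 2)) =
    c a * of_real (G a (x $ j $ 1) (x $ j $ 2) * (\<Prod>i\<in>UNIV - {j}. F a i (x $ i $ 1) (x $ i $ 2)))" by simp
qed

lemma partial_sum_of_products_aux:
  assumes "\<And>a. a \<in> A \<Longrightarrow> ((\<lambda>t. F a j (p t) (q t)) has_real_derivative G a (x $ j $ 1) (x $ j $ 2)) (at 0)"
    and "\<And>t i. i \<noteq> j \<Longrightarrow> y t $ i = x $ i" and "\<And>t. y t $ j $ 1 = p t" "\<And>t. y t $ j $ 2 = q t"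
  shows "vector_derivative (\<lambda>t. sum_of_products A c F (y t)) (at 0) = sum_of_products A c (\<lambda>a. (F a)(j := G a)) x"
proof (rule vector_derivative_at)
  have eq: "sum_of_products A c F (y t) = (\<Sum>a\<in>A. c a * of_real (F a j (p t) (q t) * (\<Prod>i\<in>UNIV - {j}. F a i (x $ i $ 1) (x $ i $ 2))))" for t
  proof -
    have "sum_of_products A c F (y t) = sum_of_products A c (\<lambda>a. (F a)(j := F a j)) (y t)" by simp
    also have "\<dots> = (\<Sum>a\<in>A. c a * of_real (F a j (p t) (q t) * (\<Prod>i\<in>UNIV - {j}. F a i (x $ i $ 1) (x $ i $ 2))))"
      unfolding sum_of_products_fun_upd by (simp add: assms(2-4))
    finally show ?thesis .
  qed
  show "((\<lambda>t. sum_of_products A c F (y t)) has_vector_derivative sum_of_products A c (\<lambda>a. (F a)(j := G a)) x) (at 0)"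
    unfolding eq sum_of_products_fun_upd
    by (intro has_vector_derivative_sum has_vector_derivative_mult_right has_vector_derivative_of_real
          DERIV_cmult_right assms(1))
qed

lemma partial_1_sum_of_products:
  fixes F :: "'a \<Rightarrow> 'm::finite \<Rightarrow> real \<Rightarrow> real \<Rightarrow> real"
  assumes "\<And>a x y. a \<in> A \<Longrightarrow> ((\<lambda>x. F a j x y) has_real_derivative G a x y) (at x)"
  shows "partial j 1 (sum_of_products A c F) = sum_of_products A c (\<lambda>a. (F a)(j := G a))"
proof
  fix x :: "real^2^'m"
  show "partial j 1 (sum_of_products A c F) x = sum_of_products A c (\<lambda>a. (F a)(j := G a)) x"
    unfolding partial_def
  proof (rule partial_sum_of_products_aux[where p = "\<lambda>t. x $ j $ 1 + t" and q = "\<lambda>t. x $ j $ 2"])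
    fix a assume "a \<in> A"
    show "((\<lambda>t. F a j (x $ j $ 1 + t) (x $ j $ 2)) has_real_derivative G a (x $ j $ 1) (x $ j $ 2)) (at 0)"
      using assms[OF \<open>a \<in> A\<close>, of "x $ j $ 2" "x $ j $ 1"] DERIV_at_within_shift[of "\<lambda>z. F a j z (x $ j $ 2)" _ "x $ j $ 1" 0 UNIV] by simp
  next
    fix t i assume "i \<noteq> j"
    then show "(x + t *\<^sub>R axis j (axis 1 1)) $ i = x $ i" by (simp add: axis_def)
  qed (simp_all add: axis_def)
qed

lemma partial_2_sum_of_products:
  fixes F :: "'a \<Rightarrow> 'm::finite \<Rightarrow> real \<Rightarrow> real \<Rightarrow> real"
  assumes "\<And>a x y. a \<in> A \<Longrightarrow> ((\<lambda>y. F a j x y) has_real_derivative G a x y) (at y)"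
  shows "partial j 2 (sum_of_products A c F) = sum_of_products A c (\<lambda>a. (F a)(j := G a))"
proof
  fix x :: "real^2^'m"
  show "partial j 2 (sum_of_products A c F) x = sum_of_products A c (\<lambda>a. (F a)(j := G a)) x"
    unfolding partial_def
  proof (rule partial_sum_of_products_aux[where q = "\<lambda>t. x $ j $ 2 + t" and p = "\<lambda>t. x $ j $ 1"])
    fix a assume "a \<in> A"
    show "((\<lambda>t. F a j (x $ j $ 1) (x $ j $ 2 + t)) has_real_derivative G a (x $ j $ 1) (x $ j $ 2)) (at 0)"
      using assms[OF \<open>a \<in> A\<close>, of "x $ j $ 1" "x $ j $ 2"] DERIV_at_within_shift[of "\<lambda>z. F a j (x $ j $ 1) z" _ "x $ j $ 2" 0 UNIV] by simp
  next
    fix t i assume "i \<noteq> j"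
    then show "(x + t *\<^sub>R axis j (axis 2 1)) $ i = x $ i" by (simp add: axis_def)
  qed (simp_all add: axis_def)
qed

definition unit_c1 :: "real^2 \<Rightarrow> real" where "unit_c1 c = c $ 1 / sqrt (- Q1 c)"
definition unit_c2 :: "real^2 \<Rightarrow> real" where "unit_c2 c = c $ 2 / sqrt (- Q1 c)"

text \<open>The polynomial differentiated \<open>\<kappa> i\<close> times in block \<open>i\<close>.
  Recording only the orders turns composition of the operators into addition of exponents, whatever
  the order of the blocks.\<close>

definition derived_poly :: "(nat^2^'m) set \<Rightarrow> (nat^2^'m \<Rightarrow> complex) \<Rightarrow> real^2^'m \<Rightarrow> ('m \<Rightarrow> nat) \<Rightarrow> real^2^'m \<Rightarrow> complex" where
  "derived_poly A coef c \<kappa> = sum_of_products A coef (\<lambda>\<alpha> i x y. fact (\<kappa> i) * taylor_coeff (unit_c1 (c $ i)) (unit_c2 (c $ i)) (\<alpha> $ i $ 1) (\<alpha> $ i $ 2) (\<kappa> i) x y)"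

lemma dir_deriv_derived_poly:
  fixes c :: "real^2^'m"
  shows "dir_deriv j (c $ j) (derived_poly A coef c \<kappa>) = derived_poly A coef c (\<kappa>(j := Suc (\<kappa> j)))"
proof
  fix x :: "real^2^'m"
  let ?c1 = "unit_c1 (c $ j)" and ?c2 = "unit_c2 (c $ j)"
  let ?F = "\<lambda>(\<alpha>::nat^2^'m) i x y. fact (\<kappa> i) * taylor_coeff (unit_c1 (c $ i)) (unit_c2 (c $ i)) (\<alpha> $ i $ 1) (\<alpha> $ i $ 2) (\<kappa> i) x y"
  let ?G1 = "\<lambda>(\<alpha>::nat^2^'m) x y. fact (\<kappa> j) * (of_nat (\<alpha> $ j $ 1) * taylor_coeff ?c1 ?c2 (\<alpha> $ j $ 1 - 1) (\<alpha> $ j $ 2) (\<kappa> j) x y)"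
  let ?G2 = "\<lambda>(\<alpha>::nat^2^'m) x y. fact (\<kappa> j) * (of_nat (\<alpha> $ j $ 2) * taylor_coeff ?c1 ?c2 (\<alpha> $ j $ 1) (\<alpha> $ j $ 2 - 1) (\<kappa> j) x y)"
  let ?G = "\<lambda>(\<alpha>::nat^2^'m) x y. fact (Suc (\<kappa> j)) * taylor_coeff ?c1 ?c2 (\<alpha> $ j $ 1) (\<alpha> $ j $ 2) (Suc (\<kappa> j)) x y"
  have 1: "partial j 1 (derived_poly A coef c \<kappa>) = sum_of_products A coef (\<lambda>\<alpha>. (?F \<alpha>)(j := ?G1 \<alpha>))"
    unfolding derived_poly_def by (rule partial_1_sum_of_products) (intro DERIV_cmult taylor_coeff_dx)
  have 2: "partial j 2 (derived_poly A coef c \<kappa>) = sum_of_products A coef (\<lambda>\<alpha>. (?F \<alpha>)(j := ?G2 \<alpha>))"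
    unfolding derived_poly_def by (rule partial_2_sum_of_products) (intro DERIV_cmult taylor_coeff_dy)
  have G: "?c1 * ?G1 \<alpha> x y + ?c2 * ?G2 \<alpha> x y = ?G \<alpha> x y" for \<alpha> :: "nat^2^'m" and x y
  proof -
    have "?c1 * ?G1 \<alpha> x y + ?c2 * ?G2 \<alpha> x y = fact (\<kappa> j) * (?c1 * (of_nat (\<alpha> $ j $ 1) * taylor_coeff ?c1 ?c2 (\<alpha> $ j $ 1 - 1) (\<alpha> $ j $ 2) (\<kappa> j) x y)
        + ?c2 * (of_nat (\<alpha> $ j $ 2) * taylor_coeff ?c1 ?c2 (\<alpha> $ j $ 1) (\<alpha> $ j $ 2 - 1) (\<kappa> j) x y))"
      by (simp add: algebra_simps)
    also have "\<dots> = ?G \<alpha> x y" unfolding taylor_coeff_dir by (simp add: algebra_simps)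
    finally show ?thesis .
  qed
  have "dir_deriv j (c $ j) (derived_poly A coef c \<kappa>) x = of_real ?c1 * partial j 1 (derived_poly A coef c \<kappa>) x + of_real ?c2 * partial j 2 (derived_poly A coef c \<kappa>) x"
    by (simp add: dir_deriv_def unit_c1_def unit_c2_def scaleR_conv_of_real distrib_left)
  also have "\<dots> = sum_of_products A coef (\<lambda>\<alpha>. (?F \<alpha>)(j := ?G \<alpha>)) x"
    unfolding 1 2 sum_of_products_fun_upd sum_distrib_left sum.distrib[symmetric] G[symmetric]
    by (intro sum.cong refl) (simp add: algebra_simps)
  also have "(\<lambda>\<alpha>. (?F \<alpha>)(j := ?G \<alpha>)) = (\<lambda>\<alpha> i x y. fact ((\<kappa>(j := Suc (\<kappa> j))) i) * taylor_coeff (unit_c1 (c $ i)) (unit_c2 (c $ i)) (\<alpha> $ i $ 1) (\<alpha> $ i $ 2) ((\<kappa>(j := Suc (\<kappa> j))) i) x y)"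
    by (intro ext) simp
  finally show "dir_deriv j (c $ j) (derived_poly A coef c \<kappa>) x = derived_poly A coef c (\<kappa>(j := Suc (\<kappa> j))) x"
    unfolding derived_poly_def .
qed

lemma dir_deriv_power_derived_poly:
  "(dir_deriv j (c $ j) ^^ n) (derived_poly A coef c \<kappa>) = derived_poly A coef c (\<kappa>(j := \<kappa> j + n))"
proof (induction n)
  case (Suc n)
  have "(dir_deriv j (c $ j) ^^ Suc n) (derived_poly A coef c \<kappa>) = dir_deriv j (c $ j) (derived_poly A coef c (\<kappa>(j := \<kappa> j + n)))"
    by (simp only: funpow.simps o_apply Suc.IH)
  then show ?case by (simp only: dir_deriv_derived_poly fun_upd_upd fun_upd_same add_Suc_right)
qed simp

lemma distinct_index_list: "distinct (index_list :: 'm::finite list)" "set (index_list :: 'm list) = UNIV"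
proof -
  have "\<exists>js :: 'm list. distinct js \<and> set js = UNIV" using finite_distinct_list[OF finite[of "UNIV :: 'm set"]] by blast
  from someI_ex[OF this] show "distinct (index_list :: 'm list)" "set (index_list :: 'm list) = UNIV"
    unfolding index_list_def by auto
qed

text \<open>The enumeration is distinct, so each block receives its order once; it is complete, so
  none is left at 0.\<close>

lemma dir_deriv_prod_derived_poly:
  "dir_deriv_prod c k (derived_poly A coef c (\<lambda>_. 0)) = derived_poly A coef c (\<lambda>i. k $ i)"
proof -
  have "distinct js \<Longrightarrow> foldr (\<lambda>j. dir_deriv j (c $ j) ^^ (k $ j)) js (derived_poly A coef c (\<lambda>_. 0)) =
      derived_poly A coef c (\<lambda>i. if i \<in> set js then k $ i else 0)" for js
  proof (induction js)
    case (Cons j js)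
    then have "foldr (\<lambda>j. dir_deriv j (c $ j) ^^ (k $ j)) (j # js) (derived_poly A coef c (\<lambda>_. 0)) =
       derived_poly A coef c ((\<lambda>i. if i \<in> set js then k $ i else 0)(j := k $ j))"
      by (simp add: dir_deriv_power_derived_poly)
    also have "(\<lambda>i. if i \<in> set js then k $ i else 0)(j := k $ j) = (\<lambda>i. if i \<in> set (j # js) then k $ i else 0)"
      by auto
    finally show ?case .
  qed simp
  from this[OF distinct_index_list(1)] show ?thesis unfolding dir_deriv_prod_def distinct_index_list(2) by simp
qed

section \<open>Harmonicity in terms of coefficients\<close>

definition lower_block :: "'m \<Rightarrow> nat^2^'m \<Rightarrow> nat^2^'m" where
  "lower_block j \<alpha> = (\<chi> i. if i = j then (\<chi> l. \<alpha> $ i $ l - 1) else \<alpha> $ i)"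

lemma sum_UNIV_2: "(\<Sum>i\<in>UNIV. f i) = f 1 + f (2::2)"
  by (rule sum_2)

lemma prod_UNIV_2: "(\<Prod>i\<in>UNIV. f i) = f 1 * f (2::2)"
  unfolding UNIV_2 by simp

text \<open>The vanishing Laplacian is a linear relation between monomials, and independence
  transfers it to any quantities \<open>N\<close> in their place. With products of contraction sums
  for \<open>N\<close> it becomes the invariance under the heat flow.\<close>

theorem harmonic_coefficients:
  fixes coef :: "nat^2^'m \<Rightarrow> complex" and N :: "nat^2^'m \<Rightarrow> complex"
  assumes A: "finite A"
    and f: "\<And>x. f x = (\<Sum>\<alpha>\<in>A. coef \<alpha> * of_real (\<Prod>j\<in>UNIV. \<Prod>i\<in>UNIV. (x $ j $ i) ^ (\<alpha> $ j $ i)))"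
    and harm: "\<And>x. laplacian f x = 0"
  shows "(\<Sum>\<alpha>\<in>A. \<Sum>j\<in>UNIV. coef \<alpha> * of_nat (\<alpha> $ j $ 1 * \<alpha> $ j $ 2) * N (lower_block j \<alpha>)) = 0"
proof -
  let ?F = "\<lambda>(\<alpha>::nat^2^'m) i x y. x ^ (\<alpha> $ i $ 1) * y ^ (\<alpha> $ i $ 2) :: real"
  let ?G2 = "\<lambda>j (\<alpha>::nat^2^'m) x y. x ^ (\<alpha> $ j $ 1) * (of_nat (\<alpha> $ j $ 2) * y ^ (\<alpha> $ j $ 2 - 1)) :: real"
  let ?G = "\<lambda>j (\<alpha>::nat^2^'m) x y. of_nat (\<alpha> $ j $ 1) * x ^ (\<alpha> $ j $ 1 - 1) * (of_nat (\<alpha> $ j $ 2) * y ^ (\<alpha> $ j $ 2 - 1)) :: real"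
  have fpf: "f = sum_of_products A coef ?F"
    by (simp add: fun_eq_iff f sum_of_products_def prod_UNIV_2)
  have p2: "partial j 2 f = sum_of_products A coef (\<lambda>\<alpha>. (?F \<alpha>)(j := ?G2 j \<alpha>))" for j
    unfolding fpf by (rule partial_2_sum_of_products) (auto intro!: derivative_eq_intros)
  have p1: "partial j 1 (partial j 2 f) = sum_of_products A coef (\<lambda>\<alpha>. ((?F \<alpha>)(j := ?G2 j \<alpha>))(j := ?G j \<alpha>))" for j
    unfolding p2 by (rule partial_1_sum_of_products) (auto intro!: derivative_eq_intros)
  have lap: "(\<Sum>j\<in>UNIV. \<Sum>\<alpha>\<in>A. coef \<alpha> * of_nat (\<alpha> $ j $ 1 * \<alpha> $ j $ 2) *
       of_real (\<Prod>v\<in>UNIV. X v ^ (lower_block j \<alpha> $ fst v $ snd v))) = 0" for X :: "'m \<times> 2 \<Rightarrow> real"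
  proof -
    define x :: "real^2^'m" where "x = (\<chi> i l. X (i, l))"
    have "sum_of_products A coef (\<lambda>\<alpha>. ((?F \<alpha>)(j := ?G2 j \<alpha>))(j := ?G j \<alpha>)) x =
       (\<Sum>\<alpha>\<in>A. coef \<alpha> * of_nat (\<alpha> $ j $ 1 * \<alpha> $ j $ 2) * of_real (\<Prod>v\<in>UNIV. X v ^ (lower_block j \<alpha> $ fst v $ snd v)))" for j
      unfolding fun_upd_upd sum_of_products_fun_upd
    proof (intro sum.cong refl)
      fix \<alpha>
      have "(\<Prod>v\<in>UNIV. X v ^ (lower_block j \<alpha> $ fst v $ snd v)) = (\<Prod>i\<in>UNIV. \<Prod>l\<in>UNIV. X (i, l) ^ (lower_block j \<alpha> $ i $ l))"
        by (simp add: prod.cartesian_product case_prod_unfold)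
      also have "\<dots> = (\<Prod>i\<in>UNIV. (x $ i $ 1) ^ (lower_block j \<alpha> $ i $ 1) * (x $ i $ 2) ^ (lower_block j \<alpha> $ i $ 2))"
        by (simp add: prod_UNIV_2 x_def)
      also have "\<dots> = ((x $ j $ 1) ^ (\<alpha> $ j $ 1 - 1) * (x $ j $ 2) ^ (\<alpha> $ j $ 2 - 1)) *
          (\<Prod>i\<in>UNIV - {j}. (x $ i $ 1) ^ (lower_block j \<alpha> $ i $ 1) * (x $ i $ 2) ^ (lower_block j \<alpha> $ i $ 2))"
        by (subst prod.remove[of _ j]) (auto simp: lower_block_def)
      also have "(\<Prod>i\<in>UNIV - {j}. (x $ i $ 1) ^ (lower_block j \<alpha> $ i $ 1) * (x $ i $ 2) ^ (lower_block j \<alpha> $ i $ 2)) =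
          (\<Prod>i\<in>UNIV - {j}. (x $ i $ 1) ^ (\<alpha> $ i $ 1) * (x $ i $ 2) ^ (\<alpha> $ i $ 2))"
        by (intro prod.cong) (auto simp: lower_block_def)
      finally have eq: "(\<Prod>v\<in>UNIV. X v ^ (lower_block j \<alpha> $ fst v $ snd v)) = ((x $ j $ 1) ^ (\<alpha> $ j $ 1 - 1) * (x $ j $ 2) ^ (\<alpha> $ j $ 2 - 1)) *
          (\<Prod>i\<in>UNIV - {j}. (x $ i $ 1) ^ (\<alpha> $ i $ 1) * (x $ i $ 2) ^ (\<alpha> $ i $ 2))" .
      show "coef \<alpha> * of_real (?G j \<alpha> (x $ j $ 1) (x $ j $ 2) * (\<Prod>i\<in>UNIV - {j}. ?F \<alpha> i (x $ i $ 1) (x $ i $ 2))) =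
         coef \<alpha> * of_nat (\<alpha> $ j $ 1 * \<alpha> $ j $ 2) * of_real (\<Prod>v\<in>UNIV. X v ^ (lower_block j \<alpha> $ fst v $ snd v))"
        unfolding eq by (simp add: mult_ac)
    qed
    then have "laplacian f x = 2 * (\<Sum>j\<in>UNIV. \<Sum>\<alpha>\<in>A. coef \<alpha> * of_nat (\<alpha> $ j $ 1 * \<alpha> $ j $ 2) *
       of_real (\<Prod>v\<in>UNIV. X v ^ (lower_block j \<alpha> $ fst v $ snd v)))"
      unfolding laplacian_def p1 by simp
    then show ?thesis using harm[of x] by simp
  qed
  have "(\<Sum>q\<in>UNIV \<times> A. (coef (snd q) * of_nat (snd q $ fst q $ 1 * snd q $ fst q $ 2)) * N (lower_block (fst q) (snd q))) = 0"
  proof (rule monomials_linearly_independent[where V = UNIV and e = "\<lambda>q v. lower_block (fst q) (snd q) $ fst v $ snd v"])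
    fix X :: "'m \<times> 2 \<Rightarrow> real"
    show "(\<Sum>q\<in>UNIV \<times> A. (coef (snd q) * of_nat (snd q $ fst q $ 1 * snd q $ fst q $ 2)) *
       of_real (\<Prod>v\<in>UNIV. X v ^ (lower_block (fst q) (snd q) $ fst v $ snd v))) = 0"
      using lap[of X] by (simp add: sum.cartesian_product case_prod_unfold)
  next
    fix q q' :: "'m \<times> (nat^2^'m)"
    assume "\<And>v :: 'm \<times> 2. v \<in> UNIV \<Longrightarrow> lower_block (fst q) (snd q) $ fst v $ snd v = lower_block (fst q') (snd q') $ fst v $ snd v"
    then have "lower_block (fst q) (snd q) $ i $ l = lower_block (fst q') (snd q') $ i $ l" for i l
      by (metis UNIV_I fst_conv snd_conv)
    then show "N (lower_block (fst q) (snd q)) = N (lower_block (fst q') (snd q'))" by (metis vec_eq_iff)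
  qed (use A in auto)
  then show ?thesis
    by (subst sum.swap) (simp add: sum.cartesian_product case_prod_unfold)
qed

section \<open>Factorisation of the completion over the blocks\<close>

lemma sum_vec_prod:
  fixes t :: "'m::finite \<Rightarrow> nat \<Rightarrow> 'a::comm_semiring_1"
  assumes "finite B"
  shows "(\<Sum>k | \<forall>j. k $ j \<in> B. \<Prod>j\<in>UNIV. t j (k $ j)) = (\<Prod>j\<in>UNIV. \<Sum>k\<in>B. t j k)"
proof -
  have "(\<Prod>j\<in>UNIV. \<Sum>k\<in>B. t j k) = (\<Sum>g\<in>PiE UNIV (\<lambda>_. B). \<Prod>j\<in>UNIV. t j (g j))"
    using assms by (intro prod_sum_PiE) auto
  also have "\<dots> = (\<Sum>k | \<forall>j. k $ j \<in> B. \<Prod>j\<in>UNIV. t j (k $ j))"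
    by (rule sum.reindex_bij_witness[where i = vec_nth and j = vec_lambda])
       (auto simp: vec_lambda_inverse vec_nth_inverse PiE_iff)
  finally show ?thesis by simp
qed

lemma B1_normalised: "B1 c x / sqrt (- Q1 c) = unit_c2 c * x $ 1 + unit_c1 c * x $ 2"
  by (simp add: B1_def unit_c1_def unit_c2_def add_divide_distrib)

text \<open>On a monomial every ingredient is a product over the blocks. Distributivity, applied
  once to the orders of differentiation and once to the signs, turns the nested sums into one
  difference per block.\<close>

lemma p_op_eq_sum_prod_p_block:
  fixes c0 c1 :: "real^2^'m" and coef :: "nat^2^'m \<Rightarrow> complex" and d :: nat
  defines "A \<equiv> {\<alpha> :: nat^2^'m. (\<Sum>j\<in>UNIV. \<Sum>i\<in>UNIV. \<alpha> $ j $ i) = d}"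
  assumes f: "\<And>x. f x = (\<Sum>\<alpha>\<in>A. coef \<alpha> * of_real (\<Prod>j\<in>UNIV. \<Prod>i\<in>UNIV. (x $ j $ i) ^ (\<alpha> $ j $ i)))"
  shows "p_op d c0 c1 f x = (\<Sum>\<alpha>\<in>A. coef \<alpha> * of_real (\<Prod>j\<in>UNIV.
     p_block (unit_c1 (c0 $ j)) (unit_c2 (c0 $ j)) (\<alpha> $ j $ 1) (\<alpha> $ j $ 2) (x $ j $ 1) (x $ j $ 2) -
     p_block (unit_c1 (c1 $ j)) (unit_c2 (c1 $ j)) (\<alpha> $ j $ 1) (\<alpha> $ j $ 2) (x $ j $ 1) (x $ j $ 2)))"
proof -
  let ?s = "- 1 / (4 * pi)"
  define t where "t = (\<lambda>(c::real^2^'m) (\<alpha>::nat^2^'m) j k. ?s ^ k * ((deriv ^^ k) E (unit_c2 (c $ j) * x $ j $ 1 + unit_c1 (c $ j) * x $ j $ 2) *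
      taylor_coeff (unit_c1 (c $ j)) (unit_c2 (c $ j)) (\<alpha> $ j $ 1) (\<alpha> $ j $ 2) k (x $ j $ 1) (x $ j $ 2)))"
  define P where "P = (\<lambda>(c::real^2^'m) (\<alpha>::nat^2^'m) j. p_block (unit_c1 (c $ j)) (unit_c2 (c $ j)) (\<alpha> $ j $ 1) (\<alpha> $ j $ 2) (x $ j $ 1) (x $ j $ 2))"
  have finA: "finite A" unfolding A_def by (rule finite_multiindex)
  have fd: "f = derived_poly A coef c (\<lambda>_. 0)" for c
    by (simp add: fun_eq_iff f derived_poly_def sum_of_products_def taylor_coeff_k0 prod_UNIV_2)
  have inner: "(\<Sum>k = 0..d. of_real ((-1) ^ k / (4 * pi) ^ k) *
         (\<Sum>kv | (\<Sum>j\<in>UNIV. kv $ j) = k.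
            of_real (\<Prod>j\<in>UNIV. rho (c $ j) (kv $ j) (x $ j) / fact (kv $ j)) *
            dir_deriv_prod c kv f x)) = (\<Sum>\<alpha>\<in>A. coef \<alpha> * of_real (\<Prod>j\<in>UNIV. P c \<alpha> j))" for c :: "real^2^'m"
  proof -
    let ?K = "\<lambda>k. {kv :: nat^'m. (\<Sum>j\<in>UNIV. kv $ j) = k}"
    have finK: "finite (?K k)" for k by (rule finite_vec_sum_eq)
    have summand: "of_real ((-1) ^ k / (4 * pi) ^ k) * (of_real (\<Prod>j\<in>UNIV. rho (c $ j) (kv $ j) (x $ j) / fact (kv $ j)) *
            dir_deriv_prod c kv f x) = (\<Sum>\<alpha>\<in>A. coef \<alpha> * of_real (\<Prod>j\<in>UNIV. t c \<alpha> j (kv $ j)))" if "kv \<in> ?K k" for k kv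
    proof -
      have sk: "(-1) ^ k / (4 * pi) ^ k = (\<Prod>j\<in>UNIV. ?s ^ (kv $ j))"
      proof -
        have "(\<Prod>j\<in>UNIV. ?s ^ (kv $ j)) = ?s ^ (\<Sum>j\<in>UNIV. kv $ j)" by (rule power_sum[symmetric])
        also have "(\<Sum>j\<in>UNIV. kv $ j) = k" using that by simp
        finally show ?thesis by (simp only: power_divide)
      qed
      have dd: "dir_deriv_prod c kv f x = (\<Sum>\<alpha>\<in>A. coef \<alpha> * of_real (\<Prod>j\<in>UNIV. fact (kv $ j) *
          taylor_coeff (unit_c1 (c $ j)) (unit_c2 (c $ j)) (\<alpha> $ j $ 1) (\<alpha> $ j $ 2) (kv $ j) (x $ j $ 1) (x $ j $ 2)))"
        unfolding fd[of c] dir_deriv_prod_derived_poly by (simp add: derived_poly_def sum_of_products_def)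
      show ?thesis unfolding sk dd sum_distrib_left
      proof (intro sum.cong refl)
        fix \<alpha> :: "nat^2^'m"
        let ?T = "\<lambda>j. taylor_coeff (unit_c1 (c $ j)) (unit_c2 (c $ j)) (\<alpha> $ j $ 1) (\<alpha> $ j $ 2) (kv $ j) (x $ j $ 1) (x $ j $ 2)"
        have "(\<Prod>j\<in>UNIV. ?s ^ (kv $ j)) * ((\<Prod>j\<in>UNIV. rho (c $ j) (kv $ j) (x $ j) / fact (kv $ j)) * (\<Prod>j\<in>UNIV. fact (kv $ j) * ?T j)) =
            (\<Prod>j\<in>UNIV. t c \<alpha> j (kv $ j))"
          unfolding prod.distrib[symmetric] t_def rho_def B1_normalised by (intro prod.cong refl) simp
        from arg_cong[OF this, of complex_of_real]
        show "of_real (\<Prod>j\<in>UNIV. ?s ^ (kv $ j)) * (of_real (\<Prod>j\<in>UNIV. rho (c $ j) (kv $ j) (x $ j) / fact (kv $ j)) *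
            (coef \<alpha> * of_real (\<Prod>j\<in>UNIV. fact (kv $ j) * ?T j))) = coef \<alpha> * of_real (\<Prod>j\<in>UNIV. t c \<alpha> j (kv $ j))"
          unfolding of_real_mult by (simp only: mult_ac)
      qed
    qed
    have "(\<Sum>k = 0..d. of_real ((-1) ^ k / (4 * pi) ^ k) *
         (\<Sum>kv | (\<Sum>j\<in>UNIV. kv $ j) = k.
            of_real (\<Prod>j\<in>UNIV. rho (c $ j) (kv $ j) (x $ j) / fact (kv $ j)) *
            dir_deriv_prod c kv f x)) = (\<Sum>k = 0..d. \<Sum>kv\<in>?K k. \<Sum>\<alpha>\<in>A. coef \<alpha> * of_real (\<Prod>j\<in>UNIV. t c \<alpha> j (kv $ j)))"
      unfolding sum_distrib_left using summand by (intro sum.cong refl) auto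
    also have "\<dots> = (\<Sum>kv\<in>(\<Union>k\<in>{0..d}. ?K k). \<Sum>\<alpha>\<in>A. coef \<alpha> * of_real (\<Prod>j\<in>UNIV. t c \<alpha> j (kv $ j)))"
      using finK by (intro sum.UNION_disjoint[symmetric]) auto
    also have "\<dots> = (\<Sum>\<alpha>\<in>A. coef \<alpha> * of_real (\<Sum>kv\<in>(\<Union>k\<in>{0..d}. ?K k). \<Prod>j\<in>UNIV. t c \<alpha> j (kv $ j)))"
      by (subst sum.swap) (simp add: sum_distrib_left)
    also have "\<dots> = (\<Sum>\<alpha>\<in>A. coef \<alpha> * of_real (\<Prod>j\<in>UNIV. P c \<alpha> j))"
    proof (intro sum.cong refl arg_cong2[where f = "(*)"] arg_cong[where f = of_real])
      fix \<alpha> :: "nat^2^'m" assume \<alpha>: "\<alpha> \<in> A"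
      \<comment> \<open>Distributivity needs a box instead of the simplex of orders with total at
        most \<open>d\<close>. An added multi-index exceeds the degree of the monomial in some
        block, where the Taylor coefficient vanishes.\<close>
      let ?B = "{k :: nat^'m. \<forall>j. k $ j \<in> {..d}}"
      have finB: "finite ?B"
      proof (rule finite_subset)
        show "?B \<subseteq> (\<Union>k\<in>{0..CARD('m) * d}. ?K k)"
          using sum_bounded_above[of UNIV _ d] by fastforce
      qed (use finK in auto)
      have "(\<Sum>kv\<in>(\<Union>k\<in>{0..d}. ?K k). \<Prod>j\<in>UNIV. t c \<alpha> j (kv $ j)) = (\<Sum>kv\<in>?B. \<Prod>j\<in>UNIV. t c \<alpha> j (kv $ j))"
      proof (rule sum.mono_neutral_left[OF finB])
        show "(\<Union>k\<in>{0..d}. ?K k) \<subseteq> ?B"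
        proof
          fix kv :: "nat^'m" assume "kv \<in> (\<Union>k\<in>{0..d}. ?K k)"
          then have "(\<Sum>j\<in>UNIV. kv $ j) \<le> d" by auto
          moreover have "kv $ j \<le> (\<Sum>j\<in>UNIV. kv $ j)" for j
            by (rule member_le_sum) auto
          ultimately show "kv \<in> ?B" using order_trans by auto
        qed
        show "\<forall>kv\<in>?B - (\<Union>k\<in>{0..d}. ?K k). (\<Prod>j\<in>UNIV. t c \<alpha> j (kv $ j)) = 0"
        proof
          fix kv :: "nat^'m" assume "kv \<in> ?B - (\<Union>k\<in>{0..d}. ?K k)"
          then have gt: "(\<Sum>j\<in>UNIV. kv $ j) > d" by auto
          have "\<exists>j. kv $ j > \<alpha> $ j $ 1 + \<alpha> $ j $ 2"
          proof (rule ccontr)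
            assume "\<not> ?thesis"
            then have "(\<Sum>j\<in>UNIV. kv $ j) \<le> (\<Sum>j\<in>UNIV. \<alpha> $ j $ 1 + \<alpha> $ j $ 2)"
              by (intro sum_mono) (auto simp: not_less)
            also have "\<dots> = d" using \<alpha> by (simp add: A_def sum_UNIV_2)
            finally show False using gt by simp
          qed
          then obtain j where "kv $ j > \<alpha> $ j $ 1 + \<alpha> $ j $ 2" by blast
          then have "t c \<alpha> j (kv $ j) = 0" by (simp add: t_def taylor_coeff_eq_0)
          then show "(\<Prod>j\<in>UNIV. t c \<alpha> j (kv $ j)) = 0" by (meson UNIV_I finite prod_zero)
        qed
      qed
      also have "\<dots> = (\<Prod>j\<in>UNIV. \<Sum>k\<le>d. t c \<alpha> j k)" by (rule sum_vec_prod) simp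
      also have "\<dots> = (\<Prod>j\<in>UNIV. P c \<alpha> j)"
      proof (rule prod.cong)
        fix j
        have "\<alpha> $ j $ 1 + \<alpha> $ j $ 2 \<le> (\<Sum>j\<in>UNIV. \<alpha> $ j $ 1 + \<alpha> $ j $ 2)"
          by (rule member_le_sum) auto
        also have "\<dots> = d" using \<alpha> by (simp add: A_def sum_UNIV_2)
        finally show "(\<Sum>k\<le>d. t c \<alpha> j k) = P c \<alpha> j"
          unfolding P_def t_def by (rule p_block_upto[symmetric])
      qed simp
      finally show "(\<Sum>kv\<in>(\<Union>k\<in>{0..d}. ?K k). \<Prod>j\<in>UNIV. t c \<alpha> j (kv $ j)) = (\<Prod>j\<in>UNIV. P c \<alpha> j)" .
    qed
    finally show ?thesis .
  qed
  let ?S = "{\<sigma> :: nat^'m. \<forall>j. \<sigma> $ j \<in> {0, 1}}"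
  have "p_op d c0 c1 f x = (\<Sum>\<sigma>\<in>?S. (-1) ^ (\<Sum>j\<in>UNIV. \<sigma> $ j) * (\<Sum>\<alpha>\<in>A. coef \<alpha> * of_real (\<Prod>j\<in>UNIV. P (select c0 c1 \<sigma>) \<alpha> j)))"
    unfolding p_op_def inner ..
  also have "\<dots> = (\<Sum>\<alpha>\<in>A. \<Sum>\<sigma>\<in>?S. (-1) ^ (\<Sum>j\<in>UNIV. \<sigma> $ j) * (coef \<alpha> * of_real (\<Prod>j\<in>UNIV. P (select c0 c1 \<sigma>) \<alpha> j)))"
    unfolding sum_distrib_left by (rule sum.swap)
  also have "\<dots> = (\<Sum>\<alpha>\<in>A. coef \<alpha> * of_real (\<Prod>j\<in>UNIV. P c0 \<alpha> j - P c1 \<alpha> j))"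
  proof (intro sum.cong refl)
    fix \<alpha> :: "nat^2^'m"
    \<comment> \<open>The global sign is absorbed into the blocks with \<sigma> = 1.\<close>
    let ?h = "\<lambda>j k. if k = 0 then P c0 \<alpha> j else - P c1 \<alpha> j"
    have "(\<Sum>\<sigma>\<in>?S. (-1) ^ (\<Sum>j\<in>UNIV. \<sigma> $ j) * (coef \<alpha> * of_real (\<Prod>j\<in>UNIV. P (select c0 c1 \<sigma>) \<alpha> j))) =
       (\<Sum>\<sigma>\<in>?S. coef \<alpha> * of_real (\<Prod>j\<in>UNIV. ?h j (\<sigma> $ j)))"
    proof (intro sum.cong refl)
      fix \<sigma> :: "nat^'m" assume s: "\<sigma> \<in> ?S"
      have "(-1) ^ (\<Sum>j\<in>UNIV. \<sigma> $ j) * (\<Prod>j\<in>UNIV. P (select c0 c1 \<sigma>) \<alpha> j) = (\<Prod>j\<in>UNIV. (-1) ^ (\<sigma> $ j) * P (select c0 c1 \<sigma>) \<alpha> j)"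
        by (simp add: power_sum prod.distrib)
      also have "\<dots> = (\<Prod>j\<in>UNIV. ?h j (\<sigma> $ j))"
      proof (rule prod.cong)
        fix j
        have "\<sigma> $ j = 0 \<or> \<sigma> $ j = 1" using s by auto
        then show "(-1) ^ (\<sigma> $ j) * P (select c0 c1 \<sigma>) \<alpha> j = ?h j (\<sigma> $ j)"
          by (auto simp: P_def select_def)
      qed simp
      finally have "of_real ((-1) ^ (\<Sum>j\<in>UNIV. \<sigma> $ j) * (\<Prod>j\<in>UNIV. P (select c0 c1 \<sigma>) \<alpha> j)) = (of_real (\<Prod>j\<in>UNIV. ?h j (\<sigma> $ j)) :: complex)"
        by (rule arg_cong)
      then show "(-1) ^ (\<Sum>j\<in>UNIV. \<sigma> $ j) * (coef \<alpha> * of_real (\<Prod>j\<in>UNIV. P (select c0 c1 \<sigma>) \<alpha> j)) = coef \<alpha> * of_real (\<Prod>j\<in>UNIV. ?h j (\<sigma> $ j))"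
        unfolding of_real_mult of_real_power of_real_minus of_real_1 by (simp only: mult_ac)
    qed
    also have "\<dots> = coef \<alpha> * of_real (\<Sum>\<sigma>\<in>?S. \<Prod>j\<in>UNIV. ?h j (\<sigma> $ j))"
      by (simp add: sum_distrib_left)
    also have "(\<Sum>\<sigma>\<in>?S. \<Prod>j\<in>UNIV. ?h j (\<sigma> $ j)) = (\<Prod>j\<in>UNIV. \<Sum>k\<in>{0, 1::nat}. ?h j k)"
      by (rule sum_vec_prod) simp
    also have "\<dots> = (\<Prod>j\<in>UNIV. P c0 \<alpha> j - P c1 \<alpha> j)" by simp
    finally show "(\<Sum>\<sigma>\<in>?S. (-1) ^ (\<Sum>j\<in>UNIV. \<sigma> $ j) * (coef \<alpha> * of_real (\<Prod>j\<in>UNIV. P (select c0 c1 \<sigma>) \<alpha> j))) =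
       coef \<alpha> * of_real (\<Prod>j\<in>UNIV. P c0 \<alpha> j - P c1 \<alpha> j)" .
  qed
  finally show ?thesis unfolding P_def .
qed

text \<open>Normalised to \<open>Q1 = - 1\<close>, a vector of the cone lies on the branch
  \<open>(- 1 / r, r)\<close> with \<open>r > 0\<close>, where the parameter of the path
  lives.\<close>

lemma unit_cone:
  assumes "c \<in> cone_C"
  shows "unit_c2 c > 0" "unit_c1 c = - 1 / unit_c2 c"
proof -
  have c: "Q1 c < 0" "c $ 2 > 0" using assms by (auto simp: cone_C_def)
  then show "unit_c2 c > 0" by (simp add: unit_c2_def)
  have "sqrt (- Q1 c) * sqrt (- Q1 c) = - (c $ 1 * c $ 2)" using c by (simp add: Q1_def)
  then show "unit_c1 c = - 1 / unit_c2 c" using c by (simp add: unit_c1_def unit_c2_def divide_simps mult_ac)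
qed

lemma of_real_contraction_sum: "of_real (contraction_sum s g \<alpha> \<beta>) = (contraction_sum (of_real s) (\<lambda>a b. of_real (g a b)) \<alpha> \<beta> :: complex)"
  by (simp add: contraction_sum_def)

text \<open>The blockwise contractions combine to the heat flow of the Laplacian at time
  \<open>1 / (4 * pi)\<close>, acting on \<open>f\<close> with \<open>J_block\<close> in place of
  monomials. Harmonicity makes the flow constant, so time 0 may be taken, where no contraction
  remains.\<close>

theorem p_op_eq_sum_prod_J_block:
  fixes c0 c1 :: "real^2^'m" and coef :: "nat^2^'m \<Rightarrow> complex" and d :: nat
  defines "A \<equiv> {\<alpha> :: nat^2^'m. (\<Sum>j\<in>UNIV. \<Sum>i\<in>UNIV. \<alpha> $ j $ i) = d}"
  assumes f: "\<And>x. f x = (\<Sum>\<alpha>\<in>A. coef \<alpha> * of_real (\<Prod>j\<in>UNIV. \<Prod>i\<in>UNIV. (x $ j $ i) ^ (\<alpha> $ j $ i)))"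
    and harm: "\<And>x. laplacian f x = 0"
    and c0: "\<And>j. c0 $ j \<in> cone_C" and c1: "\<And>j. c1 $ j \<in> cone_C"
  shows "p_op d c0 c1 f x = (\<Sum>\<alpha>\<in>A. coef \<alpha> * of_real (\<Prod>j\<in>UNIV.
     J_block (unit_c2 (c0 $ j)) (unit_c2 (c1 $ j)) (\<alpha> $ j $ 1) (\<alpha> $ j $ 2) (x $ j $ 1) (x $ j $ 2)))"
proof -
  have finA: "finite A" unfolding A_def by (rule finite_multiindex)
  define g where "g = (\<lambda>j a b. complex_of_real (J_block (unit_c2 (c0 $ j)) (unit_c2 (c1 $ j)) a b (x $ j $ 1) (x $ j $ 2)))"
  define \<Phi> where "\<Phi> = (\<lambda>s::complex. \<Sum>\<alpha>\<in>A. coef \<alpha> * (\<Prod>j\<in>UNIV. contraction_sum s (g j) (\<alpha> $ j $ 1) (\<alpha> $ j $ 2)))"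
  have "p_op d c0 c1 f x = \<Phi> (of_real (1 / (4 * pi)))"
  proof -
    have "of_real (\<Prod>j\<in>UNIV.
     p_block (unit_c1 (c0 $ j)) (unit_c2 (c0 $ j)) (\<alpha> $ j $ 1) (\<alpha> $ j $ 2) (x $ j $ 1) (x $ j $ 2) -
     p_block (unit_c1 (c1 $ j)) (unit_c2 (c1 $ j)) (\<alpha> $ j $ 1) (\<alpha> $ j $ 2) (x $ j $ 1) (x $ j $ 2)) =
     (\<Prod>j\<in>UNIV. contraction_sum (of_real (1 / (4 * pi))) (g j) (\<alpha> $ j $ 1) (\<alpha> $ j $ 2))" for \<alpha> :: "nat^2^'m"
      unfolding unit_cone(2)[OF c0] unit_cone(2)[OF c1] p_block_diff_def[symmetric] p_block_diff_eq_contraction_sum[OF unit_cone(1)[OF c0] unit_cone(1)[OF c1]]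
        of_real_prod of_real_contraction_sum g_def ..
    then show ?thesis unfolding \<Phi>_def 
      using p_op_eq_sum_prod_p_block[where f = f and d = d and coef = coef and ?c0.0 = c0 and ?c1.0 = c1 and x = x] f
      unfolding A_def by simp
  qed
  also have "\<Phi> (of_real (1 / (4 * pi))) = \<Phi> 0"
  proof -
    have "(\<Phi> has_field_derivative 0) (at s)" for s
    proof -
      \<comment> \<open>By the product rule the derivative of \<open>\<Phi>\<close> evaluates
        \<open>N\<close> at the lowered exponents, which is the relation given by the vanishing
        Laplacian.\<close>
      define N where "N = (\<lambda>\<gamma>::nat^2^'m. \<Prod>i\<in>UNIV. contraction_sum s (g i) (\<gamma> $ i $ 1) (\<gamma> $ i $ 2))"
      have "(\<Phi> has_field_derivative (\<Sum>\<alpha>\<in>A. coef \<alpha> * (\<Sum>j\<in>UNIV. of_nat (\<alpha> $ j $ 1 * \<alpha> $ j $ 2) * contraction_sum s (g j) (\<alpha> $ j $ 1 - 1) (\<alpha> $ j $ 2 - 1) *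
          (\<Prod>i\<in>UNIV - {j}. contraction_sum s (g i) (\<alpha> $ i $ 1) (\<alpha> $ i $ 2))))) (at s)"
        unfolding \<Phi>_def by (intro DERIV_sum DERIV_cmult has_field_derivative_prod contraction_sum_deriv)
      also have "(\<Sum>\<alpha>\<in>A. coef \<alpha> * (\<Sum>j\<in>UNIV. of_nat (\<alpha> $ j $ 1 * \<alpha> $ j $ 2) * contraction_sum s (g j) (\<alpha> $ j $ 1 - 1) (\<alpha> $ j $ 2 - 1) *
          (\<Prod>i\<in>UNIV - {j}. contraction_sum s (g i) (\<alpha> $ i $ 1) (\<alpha> $ i $ 2)))) =
         (\<Sum>\<alpha>\<in>A. \<Sum>j\<in>UNIV. coef \<alpha> * of_nat (\<alpha> $ j $ 1 * \<alpha> $ j $ 2) * N (lower_block j \<alpha>))"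
        unfolding sum_distrib_left
      proof (intro sum.cong refl)
        fix \<alpha> :: "nat^2^'m" and j :: 'm
        have "N (lower_block j \<alpha>) = contraction_sum s (g j) (lower_block j \<alpha> $ j $ 1) (lower_block j \<alpha> $ j $ 2) * (\<Prod>i\<in>UNIV - {j}. contraction_sum s (g i) (lower_block j \<alpha> $ i $ 1) (lower_block j \<alpha> $ i $ 2))"
          unfolding N_def by (subst prod.remove[of _ j]) auto
        also have "(\<Prod>i\<in>UNIV - {j}. contraction_sum s (g i) (lower_block j \<alpha> $ i $ 1) (lower_block j \<alpha> $ i $ 2)) = (\<Prod>i\<in>UNIV - {j}. contraction_sum s (g i) (\<alpha> $ i $ 1) (\<alpha> $ i $ 2))"
          by (intro prod.cong) (auto simp: lower_block_def)
        finally have "N (lower_block j \<alpha>) = contraction_sum s (g j) (\<alpha> $ j $ 1 - 1) (\<alpha> $ j $ 2 - 1) * (\<Prod>i\<in>UNIV - {j}. contraction_sum s (g i) (\<alpha> $ i $ 1) (\<alpha> $ i $ 2))"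
          by (simp add: lower_block_def)
        then show "coef \<alpha> * (of_nat (\<alpha> $ j $ 1 * \<alpha> $ j $ 2) * contraction_sum s (g j) (\<alpha> $ j $ 1 - 1) (\<alpha> $ j $ 2 - 1) *
            (\<Prod>i\<in>UNIV - {j}. contraction_sum s (g i) (\<alpha> $ i $ 1) (\<alpha> $ i $ 2))) = coef \<alpha> * of_nat (\<alpha> $ j $ 1 * \<alpha> $ j $ 2) * N (lower_block j \<alpha>)"
          by (simp only: mult.assoc)
      qed
      also have "\<dots> = 0" by (rule harmonic_coefficients[OF finA f harm])
      finally show ?thesis .
    qed
    then show ?thesis
      using has_field_derivative_zero_constant[of UNIV \<Phi>] by (metis UNIV_I convex_UNIV has_field_derivative_at_within)
  qed
  also have "\<Phi> 0 = (\<Sum>\<alpha>\<in>A. coef \<alpha> * of_real (\<Prod>j\<in>UNIV.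
     J_block (unit_c2 (c0 $ j)) (unit_c2 (c1 $ j)) (\<alpha> $ j $ 1) (\<alpha> $ j $ 2) (x $ j $ 1) (x $ j $ 2)))"
    unfolding \<Phi>_def contraction_sum_s0 g_def of_real_prod ..
  finally show ?thesis .
qed

section \<open>The theta series\<close>

lemma infsum_finite_sum:
  fixes f :: "'a \<Rightarrow> 'b \<Rightarrow> 'c :: real_normed_vector"
  assumes "finite A" "\<And>a. a \<in> A \<Longrightarrow> f a summable_on B"
  shows "(\<lambda>x. \<Sum>a\<in>A. f a x) summable_on B" "(\<Sum>\<^sub>\<infinity>x\<in>B. \<Sum>a\<in>A. f a x) = (\<Sum>a\<in>A. \<Sum>\<^sub>\<infinity>x\<in>B. f a x)"
proof -
  have "((\<lambda>x. \<Sum>a\<in>A. f a x) has_sum (\<Sum>a\<in>A. \<Sum>\<^sub>\<infinity>x\<in>B. f a x)) B"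
    using assms
  proof (induction A rule: finite_induct)
    case (insert a A)
    then show ?case by (simp add: has_sum_add)
  qed simp
  then show "(\<lambda>x. \<Sum>a\<in>A. f a x) summable_on B" "(\<Sum>\<^sub>\<infinity>x\<in>B. \<Sum>a\<in>A. f a x) = (\<Sum>a\<in>A. \<Sum>\<^sub>\<infinity>x\<in>B. f a x)"
    by (auto simp: summable_on_def infsumI)
qed

text \<open>Lattice points indexed by functions on the blocks, the shape in which a sum of products
  factors into a product of sums.\<close>

definition lattice_pt :: "real^2^'m \<Rightarrow> ('m \<Rightarrow> int \<times> int) \<Rightarrow> real^2^'m" where
  "lattice_pt a p = (\<chi> j l. a $ j $ l + of_int (if l = 1 then fst (p j) else snd (p j)))"

lemma lattice_pt_nth [simp]:
  "lattice_pt a p $ j $ 1 = a $ j $ 1 + of_int (fst (p j))"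
  "lattice_pt a p $ j $ 2 = a $ j $ 2 + of_int (snd (p j))"
  by (simp_all add: lattice_pt_def)

lemma bij_lattice_pt: "bij_betw (lattice_pt a) UNIV (shifted_lattice a)"
  unfolding bij_betw_def
proof
  show "inj (lattice_pt a)"
  proof (rule injI)
    fix p q assume eq: "lattice_pt a p = lattice_pt a q"
    have "fst (p j) = fst (q j)" for j
      using arg_cong[OF eq, of "\<lambda>z. z $ j $ 1"] by simp
    moreover have "snd (p j) = snd (q j)" for j
      using arg_cong[OF eq, of "\<lambda>z. z $ j $ 2"] by simp
    ultimately show "p = q" by (simp add: fun_eq_iff prod_eq_iff)
  qed
  show "range (lattice_pt a) = shifted_lattice a"
  proof (intro equalityI subsetI)
    fix x assume "x \<in> range (lattice_pt a)"
    then obtain p where p: "x = lattice_pt a p" by blast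
    define n :: "real^2^'a" where "n = (\<chi> j l. of_int (if l = 1 then fst (p j) else snd (p j)))"
    have "x = a + n" by (simp add: p lattice_pt_def n_def vec_eq_iff)
    moreover have "\<forall>j i. n $ j $ i \<in> \<int>" by (simp add: n_def)
    ultimately show "x \<in> shifted_lattice a" unfolding shifted_lattice_def by blast
  next
    fix x assume "x \<in> shifted_lattice a"
    then obtain n where n: "x = a + n" "\<And>j i. n $ j $ i \<in> \<int>" unfolding shifted_lattice_def by blast
    define p where "p = (\<lambda>j. (\<lfloor>n $ j $ 1\<rfloor>, \<lfloor>n $ j $ 2\<rfloor>))"
    have "lattice_pt a p = x"
      unfolding vec_eq_iff forall_2 using n(2) by (simp add: n(1) p_def)
    then show "x \<in> range (lattice_pt a)" by blast
  qed
qed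

lemma theta_term_eq:
  fixes c0 c1 b :: "real^2^'m" and coef :: "nat^2^'m \<Rightarrow> complex" and d :: nat
  defines "A \<equiv> {\<alpha> :: nat^2^'m. (\<Sum>j\<in>UNIV. \<Sum>i\<in>UNIV. \<alpha> $ j $ i) = d}"
  assumes f: "\<And>x. f x = (\<Sum>\<alpha>\<in>A. coef \<alpha> * of_real (\<Prod>j\<in>UNIV. \<Prod>i\<in>UNIV. (x $ j $ i) ^ (\<alpha> $ j $ i)))"
    and harm: "\<And>x. laplacian f x = 0"
    and c0: "\<And>j. c0 $ j \<in> cone_C" and c1: "\<And>j. c1 $ j \<in> cone_C"
  shows "theta_term d c0 c1 b f \<tau> x = (\<Sum>\<alpha>\<in>A. coef \<alpha> * (\<Prod>j\<in>UNIV.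
     theta_block_term (unit_c2 (c0 $ j)) (unit_c2 (c1 $ j)) (\<alpha> $ j $ 1) (\<alpha> $ j $ 2) \<tau> (b $ j $ 1) (b $ j $ 2) (x $ j $ 1) (x $ j $ 2)))"
proof -
  let ?e1 = "\<lambda>j. exp (2 * of_real pi * \<i> * of_real (x $ j $ 1 * x $ j $ 2) * \<tau>)"
  let ?e2 = "\<lambda>j. cis2pi (x $ j $ 1 * b $ j $ 2 + x $ j $ 2 * b $ j $ 1)"
  have e1: "exp (2 * of_real pi * \<i> * of_real (Qm x) * \<tau>) = (\<Prod>j\<in>UNIV. ?e1 j)"
    by (simp add: Qm_def Q1_def exp_sum[symmetric] sum_distrib_left sum_distrib_right)
  have e2: "exp (2 * of_real pi * \<i> * of_real (Bm x b)) = (\<Prod>j\<in>UNIV. ?e2 j)"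
    unfolding cis2pi_exp exp_sum[OF finite, symmetric] by (simp add: Bm_def B1_def sum_distrib_left)
  have "theta_term d c0 c1 b f \<tau> x = (\<Sum>\<alpha>\<in>A. coef \<alpha> * of_real (\<Prod>j\<in>UNIV.
     J_block (unit_c2 (c0 $ j)) (unit_c2 (c1 $ j)) (\<alpha> $ j $ 1) (\<alpha> $ j $ 2) (sqrt (Im \<tau>) * x $ j $ 1) (sqrt (Im \<tau>) * x $ j $ 2)))
     * (\<Prod>j\<in>UNIV. ?e1 j) * (\<Prod>j\<in>UNIV. ?e2 j)"
    unfolding theta_term_def e1 e2
    using p_op_eq_sum_prod_J_block[where f = f and d = d and coef = coef and ?c0.0 = c0 and ?c1.0 = c1 and x = "sqrt (Im \<tau>) *\<^sub>R x"] f harm c0 c1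
    unfolding A_def by simp
  also have "\<dots> = (\<Sum>\<alpha>\<in>A. coef \<alpha> * (\<Prod>j\<in>UNIV.
     theta_block_term (unit_c2 (c0 $ j)) (unit_c2 (c1 $ j)) (\<alpha> $ j $ 1) (\<alpha> $ j $ 2) \<tau> (b $ j $ 1) (b $ j $ 2) (x $ j $ 1) (x $ j $ 2)))"
    unfolding sum_distrib_right
    by (intro sum.cong refl) (simp only: theta_block_term_def prod.distrib of_real_prod mult.assoc)
  finally show ?thesis .
qed

text \<open>Absolute convergence in each block gives it for the products over the blocks and
  justifies their factorisation; the sum over \<alpha> is finite.\<close>

lemma theta_eq:
  fixes c0 c1 a b :: "real^2^'m" and coef :: "nat^2^'m \<Rightarrow> complex" and d :: nat
  defines "A \<equiv> {\<alpha> :: nat^2^'m. (\<Sum>j\<in>UNIV. \<Sum>i\<in>UNIV. \<alpha> $ j $ i) = d}"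
  assumes f: "\<And>x. f x = (\<Sum>\<alpha>\<in>A. coef \<alpha> * of_real (\<Prod>j\<in>UNIV. \<Prod>i\<in>UNIV. (x $ j $ i) ^ (\<alpha> $ j $ i)))"
    and harm: "\<And>x. laplacian f x = 0"
    and c0: "\<And>j. c0 $ j \<in> cone_C" and c1: "\<And>j. c1 $ j \<in> cone_C"
    and v: "Im \<tau> > 0"
  shows "(\<lambda>x. norm (theta_term d c0 c1 b f \<tau> x)) summable_on shifted_lattice a"
    and "theta d c0 c1 a b f \<tau> = of_real (Im \<tau> powr (- real d / 2)) * (\<Sum>\<alpha>\<in>A. coef \<alpha> * (\<Prod>j\<in>UNIV. 
      \<Sum>\<^sub>\<infinity>(m::int, k::int). theta_block_term (unit_c2 (c0 $ j)) (unit_c2 (c1 $ j)) (\<alpha> $ j $ 1) (\<alpha> $ j $ 2) \<tau> (b $ j $ 1) (b $ j $ 2)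
          (a $ j $ 1 + of_int m) (a $ j $ 2 + of_int k)))"
proof -
  have finA: "finite A" unfolding A_def by (rule finite_multiindex)
  define g where "g = (\<lambda>(\<alpha>::nat^2^'m) j (q::int \<times> int). theta_block_term (unit_c2 (c0 $ j)) (unit_c2 (c1 $ j)) (\<alpha> $ j $ 1) (\<alpha> $ j $ 2) \<tau> (b $ j $ 1) (b $ j $ 2)
          (a $ j $ 1 + of_int (fst q)) (a $ j $ 2 + of_int (snd q)))"
  have g: "(\<lambda>q. norm (g \<alpha> j q)) summable_on UNIV" for \<alpha> j
    unfolding g_def using theta_block_term_sum(1)[OF v unit_cone(1)[OF c0] unit_cone(1)[OF c1]] by (simp add: case_prod_unfold)
  have PU: "PiE (UNIV::'m set) (\<lambda>_. UNIV :: (int \<times> int) set) = UNIV" by auto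
  have prodg: "(\<lambda>p. norm (\<Prod>j\<in>UNIV. g \<alpha> j (p j))) summable_on UNIV" for \<alpha>
    using abs_summable_on_prod_PiE[of "UNIV::'m set" "\<lambda>_. UNIV" "g \<alpha>"] g[of \<alpha>]
    unfolding PU abs_summable_equivalent[symmetric] by simp
  have sumg: "(\<Sum>\<^sub>\<infinity>p. \<Prod>j\<in>UNIV. g \<alpha> j (p j)) = (\<Prod>j\<in>UNIV. \<Sum>\<^sub>\<infinity>q. g \<alpha> j q)" for \<alpha>
    using infsum_prod_PiE_abs[of "UNIV::'m set" "g \<alpha>" "\<lambda>_. UNIV"] g[of \<alpha>] unfolding PU by simp
  have tt: "theta_term d c0 c1 b f \<tau> (lattice_pt a p) = (\<Sum>\<alpha>\<in>A. coef \<alpha> * (\<Prod>j\<in>UNIV. g \<alpha> j (p j)))" for p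
    using theta_term_eq[where f = f and d = d and coef = coef and ?c0.0 = c0 and ?c1.0 = c1 and x = "lattice_pt a p" and b = b and \<tau> = \<tau>]
      f harm c0 c1 unfolding A_def g_def by simp
  have "(\<lambda>p. norm (theta_term d c0 c1 b f \<tau> (lattice_pt a p))) summable_on UNIV"
  proof (rule Infinite_Sum.abs_summable_on_comparison_test')
    show "(\<lambda>p. \<Sum>\<alpha>\<in>A. norm (coef \<alpha>) * norm (\<Prod>j\<in>UNIV. g \<alpha> j (p j))) summable_on UNIV"
      by (intro infsum_finite_sum(1) finA summable_on_cmult_right prodg)
    show "norm (theta_term d c0 c1 b f \<tau> (lattice_pt a p)) \<le> (\<Sum>\<alpha>\<in>A. norm (coef \<alpha>) * norm (\<Prod>j\<in>UNIV. g \<alpha> j (p j)))" for p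
      unfolding tt by (rule order_trans[OF norm_sum]) (simp add: norm_mult)
  qed
  then show "(\<lambda>x. norm (theta_term d c0 c1 b f \<tau> x)) summable_on shifted_lattice a"
    using summable_on_reindex_bij_betw[OF bij_lattice_pt, of "\<lambda>x. norm (theta_term d c0 c1 b f \<tau> x)" a] by simp
  have "(\<Sum>\<^sub>\<infinity>x\<in>shifted_lattice a. theta_term d c0 c1 b f \<tau> x) = (\<Sum>\<^sub>\<infinity>p. theta_term d c0 c1 b f \<tau> (lattice_pt a p))"
    by (rule infsum_reindex_bij_betw[OF bij_lattice_pt, symmetric])
  also have "\<dots> = (\<Sum>\<alpha>\<in>A. \<Sum>\<^sub>\<infinity>p. coef \<alpha> * (\<Prod>j\<in>UNIV. g \<alpha> j (p j)))"
    unfolding tt by (intro infsum_finite_sum(2) finA summable_on_cmult_right) (rule abs_summable_summable[OF prodg])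
  also have "\<dots> = (\<Sum>\<alpha>\<in>A. coef \<alpha> * (\<Prod>j\<in>UNIV. \<Sum>\<^sub>\<infinity>q. g \<alpha> j q))"
    unfolding infsum_cmult_right' sumg ..
  finally show "theta d c0 c1 a b f \<tau> = of_real (Im \<tau> powr (- real d / 2)) * (\<Sum>\<alpha>\<in>A. coef \<alpha> * (\<Prod>j\<in>UNIV. 
      \<Sum>\<^sub>\<infinity>(m::int, k::int). theta_block_term (unit_c2 (c0 $ j)) (unit_c2 (c1 $ j)) (\<alpha> $ j $ 1) (\<alpha> $ j $ 2) \<tau> (b $ j $ 1) (b $ j $ 2)
          (a $ j $ 1 + of_int m) (a $ j $ 2 + of_int k)))"
    unfolding theta_def g_def case_prod_unfold by simp
qed

lemma Im_inversion_powr: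
  assumes "\<tau> \<noteq> 0"
  shows "Im (- 1 / \<tau>) powr (- real d / 2) = Im \<tau> powr (- real d / 2) * norm \<tau> ^ d"
proof -
  have n0: "norm \<tau> > 0" using assms by simp
  have "((norm \<tau>)\<^sup>2) powr (- real d / 2) = (norm \<tau> powr 2) powr (- real d / 2)"
    using n0 by simp
  also have "\<dots> = inverse (norm \<tau> ^ d)"
    unfolding powr_powr using n0 by (simp add: powr_minus powr_realpow)
  finally have *: "((norm \<tau>)\<^sup>2) powr (- real d / 2) = inverse (norm \<tau> ^ d)" .
  show ?thesis unfolding Im_inversion powr_divide * by (simp only: divide_inverse inverse_inverse_eq)
qed
text \<open>This cancels the non-holomorphic parts of the automorphy factor.\<close>

lemma norm_times_phase:
  assumes "\<tau> \<noteq> 0"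
  shows "of_real (norm \<tau>) * (- of_real (norm \<tau>) / cnj \<tau>) = - \<tau>"
proof -
  have "of_real (norm \<tau>) * of_real (norm \<tau>) = \<tau> * cnj \<tau>"
    unfolding complex_norm_square[symmetric] power2_eq_square of_real_mult ..
  then have "of_real (norm \<tau>) * (- of_real (norm \<tau>) / cnj \<tau>) = - (\<tau> * cnj \<tau> / cnj \<tau>)"
    by (simp only: times_divide_eq_right mult_minus_right minus_divide_left)
  then show ?thesis using assms by simp
qed

theorem theorem2p6:
  fixes c0 c1 a b :: "real^2^'m"
    and f :: "real^2^'m \<Rightarrow> complex"
    and d :: nat
    and \<tau> :: complex
  assumes "\<forall>j. c0 $ j \<in> cone_C"
    and "\<forall>j. c1 $ j \<in> cone_C"
    and "spherical_polynomial d f"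
    and "Im \<tau> > 0"
  shows "(\<lambda>x. norm (theta_term d c0 c1 b f \<tau> x)) summable_on shifted_lattice a
     \<and> theta d c0 c1 a b f (- 1 / \<tau>) =
         (- \<tau>) ^ (CARD('m) + d) * exp (2 * of_real pi * \<i> * of_real (Bm a b)) *
         theta d c0 c1 (- b) a f \<tau>"
proof -
  have c0: "c0 $ j \<in> cone_C" and c1: "c1 $ j \<in> cone_C" for j using assms by auto
  define A where "A = {\<alpha> :: nat^2^'m. (\<Sum>j\<in>UNIV. \<Sum>i\<in>UNIV. \<alpha> $ j $ i) = d}"
  obtain coef where f: "\<And>x. f x = (\<Sum>\<alpha>\<in>A. coef \<alpha> * of_real (\<Prod>j\<in>UNIV. \<Prod>i\<in>UNIV. (x $ j $ i) ^ (\<alpha> $ j $ i)))"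
    using assms(3) unfolding spherical_polynomial_def homogeneous_polynomial_def A_def by blast
  have harm: "laplacian f x = 0" for x using assms(3) by (simp add: spherical_polynomial_def)
  note v = assms(4)
  have t0: "\<tau> \<noteq> 0" using v by auto
  have v': "Im (- 1 / \<tau>) > 0" using Im_inversion[of \<tau>] v t0 by simp
  note te = theta_eq[where f = f and coef = coef and d = d and ?c0.0 = c0 and ?c1.0 = c1,
      OF f[unfolded A_def] harm c0 c1, folded A_def]
  let ?S = "\<lambda>\<alpha> j. \<Sum>\<^sub>\<infinity>(m::int, k::int). theta_block_term (unit_c2 (c0 $ j)) (unit_c2 (c1 $ j)) (\<alpha> $ j $ 1) (\<alpha> $ j $ 2) \<tau> (a $ j $ 1) (a $ j $ 2)
          (- b $ j $ 1 + of_int m) (- b $ j $ 2 + of_int k)"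
  let ?n = "of_real (norm \<tau>) :: complex" and ?h = "- of_real (norm \<tau>) / cnj \<tau>"
  let ?E = "exp (2 * of_real pi * \<i> * of_real (Bm a b))"
  have prod: "(\<Prod>j\<in>UNIV. ?n * ?h ^ Suc (\<alpha> $ j $ 1 + \<alpha> $ j $ 2) * cis2pi (a $ j $ 1 * b $ j $ 2 + a $ j $ 2 * b $ j $ 1) * ?S \<alpha> j) =
     ?n ^ CARD('m) * ?h ^ (CARD('m) + d) * ?E * (\<Prod>j\<in>UNIV. ?S \<alpha> j)" if "\<alpha> \<in> A" for \<alpha>
  proof -
    have "(\<Prod>j\<in>UNIV. ?h ^ Suc (\<alpha> $ j $ 1 + \<alpha> $ j $ 2)) = ?h ^ (\<Sum>j\<in>UNIV. Suc (\<alpha> $ j $ 1 + \<alpha> $ j $ 2))"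
      by (rule power_sum[symmetric])
    also have "(\<Sum>j\<in>UNIV. Suc (\<alpha> $ j $ 1 + \<alpha> $ j $ 2)) = CARD('m) + d"
      using that by (simp add: A_def sum_UNIV_2 sum.distrib sum_Suc)
    finally have 1: "(\<Prod>j\<in>UNIV. ?h ^ Suc (\<alpha> $ j $ 1 + \<alpha> $ j $ 2)) = ?h ^ (CARD('m) + d)" .
    have 2: "(\<Prod>j\<in>UNIV. cis2pi (a $ j $ 1 * b $ j $ 2 + a $ j $ 2 * b $ j $ 1)) = ?E"
      unfolding cis2pi_exp exp_sum[OF finite, symmetric] by (simp add: Bm_def B1_def sum_distrib_left)
    show ?thesis unfolding prod.distrib 1 2 by simp
  qed
  \<comment> \<open>The blocks supply only \<open>m\<close> factors \<open>norm \<tau>\<close> for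
    \<open>m + d\<close> phases; the power of the imaginary part supplies the other
    \<open>d\<close>.\<close>
  have fac: "of_real (Im (- 1 / \<tau>) powr (- real d / 2)) * (?n ^ CARD('m) * ?h ^ (CARD('m) + d)) =
     (- \<tau>) ^ (CARD('m) + d) * of_real (Im \<tau> powr (- real d / 2))"
  proof -
    have "(- \<tau>) ^ (CARD('m) + d) = ?n ^ (CARD('m) + d) * ?h ^ (CARD('m) + d)"
      unfolding norm_times_phase[OF t0, symmetric] power_mult_distrib ..
    then show ?thesis
      unfolding Im_inversion_powr[OF t0] of_real_mult of_real_power power_add by (simp only: mult_ac)
  qed
  have "theta d c0 c1 a b f (- 1 / \<tau>) = of_real (Im (- 1 / \<tau>) powr (- real d / 2)) * (\<Sum>\<alpha>\<in>A. coef \<alpha> *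
      (\<Prod>j\<in>UNIV. ?n * ?h ^ Suc (\<alpha> $ j $ 1 + \<alpha> $ j $ 2) * cis2pi (a $ j $ 1 * b $ j $ 2 + a $ j $ 2 * b $ j $ 1) * ?S \<alpha> j))"
    unfolding te(2)[OF v'] theta_block_term_inversion[OF v unit_cone(1)[OF c0] unit_cone(1)[OF c1]] ..
  also have "(\<Sum>\<alpha>\<in>A. coef \<alpha> *
      (\<Prod>j\<in>UNIV. ?n * ?h ^ Suc (\<alpha> $ j $ 1 + \<alpha> $ j $ 2) * cis2pi (a $ j $ 1 * b $ j $ 2 + a $ j $ 2 * b $ j $ 1) * ?S \<alpha> j)) =
      (?n ^ CARD('m) * ?h ^ (CARD('m) + d)) * ?E * (\<Sum>\<alpha>\<in>A. coef \<alpha> * (\<Prod>j\<in>UNIV. ?S \<alpha> j))"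
    unfolding sum_distrib_left
  proof (intro sum.cong refl)
    fix \<alpha> :: "nat^2^'m" assume "\<alpha> \<in> A"
    show "coef \<alpha> * (\<Prod>j\<in>UNIV. ?n * ?h ^ Suc (\<alpha> $ j $ 1 + \<alpha> $ j $ 2) * cis2pi (a $ j $ 1 * b $ j $ 2 + a $ j $ 2 * b $ j $ 1) * ?S \<alpha> j) =
      (?n ^ CARD('m) * ?h ^ (CARD('m) + d)) * ?E * (coef \<alpha> * (\<Prod>j\<in>UNIV. ?S \<alpha> j))"
      unfolding prod[OF \<open>\<alpha> \<in> A\<close>] by (simp only: mult_ac)
  qed
  also have "of_real (Im (- 1 / \<tau>) powr (- real d / 2)) * ((?n ^ CARD('m) * ?h ^ (CARD('m) + d)) * ?E * (\<Sum>\<alpha>\<in>A. coef \<alpha> * (\<Prod>j\<in>UNIV. ?S \<alpha> j))) =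
      (of_real (Im (- 1 / \<tau>) powr (- real d / 2)) * (?n ^ CARD('m) * ?h ^ (CARD('m) + d))) * ?E * (\<Sum>\<alpha>\<in>A. coef \<alpha> * (\<Prod>j\<in>UNIV. ?S \<alpha> j))"
    by (simp only: mult.assoc)
  also have "\<dots> = (- \<tau>) ^ (CARD('m) + d) * ?E * theta d c0 c1 (- b) a f \<tau>"
    unfolding fac te(2)[OF v] vector_uminus_component by (simp only: mult_ac)
  finally show ?thesis using te(1)[OF v] by blast
qed

end
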